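(* Let $(\mathbf M,c)$ be a self-dual complex 4-manifold and let $\mathbf Q\subset\mathbf M$ be an umbilic hypersurface on which the restriction of $c$ is nondegenerate. Then: (i) the Weyl tensor of $\mathbf M$, restricted to $\mathbf Q$ (i.e. at every point of $\mathbf Q$), is identically zero; (ii) the Cotton–York tensor $C$ of $\mathbf Q$ is related to the self-dual Weyl tensor $W^+$ of $\mathbf M$ by $$g(\nabla_\nu W^+(A),B)_x=-C(A)( *^{\mathbf Q}B)_x,$$ for every $x\in\mathbf Q$, $A,B\in\Lambda^2_x\mathbf Q$, every local metric $g$ in $c$ and every $g$-unitary vector $\nu\perp T_x\mathbf Q$, where $\nabla$ is the Levi-Civita connection of $g$ and the Hodge operator $*^{\mathbf Q}:\Lambda^2\mathbf Q\to\Lambda^1\mathbf Q$ is induced by $g$ and by the orientation of $\mathbf Q$ admitting $\nu$ as an exterior normal vector.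
   Context: Everything is holomorphic. A conformal structure $c$ on a complex manifold is locally represented by holomorphic metrics (nondegenerate symmetric $\mathbb C$-bilinear forms) determined up to multiplication by nowhere zero holomorphic functions. On a 4-manifold $\mathbf M$, an orientation is a choice of holomorphic Hodge operator $*$ on $\Lambda^2\mathbf M$ compatible with $c$, with $\pm1$-eigenbundles $\Lambda^\pm\mathbf M$; for an oriented orthonormal basis $(e_1,e_2,e_3,e_4)$, $*(e_1\wedge e_2)=e_3\wedge e_4$. $W=W^++W^-$, where $W^\pm$ is the trace-free part of the curvature in $\mathrm{End}(\Lambda^\pm\mathbf M)$; self-dual means $W^-=0$. 2-forms and bivectors are identified by $g$; $\Lambda^2\mathbf Q\subset\Lambda^2\mathbf M|_{\mathbf Q}$ and $g(W^+(X\wedge Y),Z\wedge T)=g(W^+(X,Y)Z,T)$. Orientation of $\mathbf Q$: an orthonormal basis $(X,Y,Z)$ of $T_x\mathbf Q$ is oriented if and only if $(X,Y,Z,\nu)$ is an oriented orthonormal basis of $T_x\mathbf M$; then e.g. $*^{\mathbf Q}(Z\wedge X)=Y$. Umbilic: the trace-free part of the second fundamental form vanishes (equivalently, locally there is a metric in $c$ for which $\mathbf Q$ is totally geodesic). In dimension $n\ge3$ the normalized Ricci tensor is $h=\frac1{2n(n-1)}\mathrm{Scal}\cdot g+\frac1{n-2}\mathrm{Ric}_0$ ($\mathrm{Ric}_0$ trace-free Ricci tensor), and the Cotton–York tensor is $C(X,Y)(Z)=(\nabla_Xh)(Y,Z)-(\nabla_Yh)(X,Z)$; in dimension 3 it depends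 only on the conformal structure. Here $C$ is computed on the 3-manifold $\mathbf Q$ with the induced conformal structure. The curvature sign convention is that $R=h\wedge I+W$ with $g((h\wedge I)(X,Y)X,Y)=h(X,X)g(Y,Y)+h(Y,Y)g(X,X)-2h(X,Y)g(X,Y)$, i.e. $R(X,Y)=\nabla_{[X,Y]}-[\nabla_X,\nabla_Y]$ (so that $g(R(X,Y)X,Y)$ is positive on a round sphere). *)

theory Defs
  imports "HOL-Analysis.Analysis"
begin

section \<open>Holomorphic functions of several variables, complex manifolds\<close>

definition hol_on :: "(complex^'n \<Rightarrow> complex) \<Rightarrow> (complex^'n) set \<Rightarrow> bool" where
  "hol_on f S \<longleftrightarrow> (\<forall>x\<in>S. \<exists>D. (f has_derivative D) (at x) \<and> (\<forall>c v. D (c *s v) = c * D v))"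

definition dirderiv :: "(complex^'n \<Rightarrow> complex) \<Rightarrow> complex^'n \<Rightarrow> complex^'n \<Rightarrow> complex" where
  "dirderiv f v x = deriv (\<lambda>t. f (x + t *s v)) 0"

definition jacobian :: "(complex^'n \<Rightarrow> complex^'n) \<Rightarrow> complex^'n \<Rightarrow> complex^'n^'n" where
  "jacobian f x = (\<chi> k i. dirderiv (\<lambda>y. f y $ k) (axis i 1) x)"

text \<open>A chart is its domain together with a coordinate map, which only matters on the domain.\<close>

type_synonym ('a, 'n) chart = "'a set \<times> ('a \<Rightarrow> complex^'n)"

definition is_chart :: "('a::topological_space, 'n::finite) chart \<Rightarrow> bool" where
  "is_chart \<kappa> \<longleftrightarrow> open (fst \<kappa>) \<and> open (snd \<kappa> ` fst \<kappa>) \<and>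
     homeomorphism (fst \<kappa>) (snd \<kappa> ` fst \<kappa>) (snd \<kappa>) (inv_into (fst \<kappa>) (snd \<kappa>))"

definition transition :: "('a, 'n) chart \<Rightarrow> ('a, 'n) chart \<Rightarrow> complex^'n \<Rightarrow> complex^'n" where
  "transition \<kappa> \<kappa>' y = snd \<kappa>' (inv_into (fst \<kappa>) (snd \<kappa>) y)"

definition compatible :: "('a, 'n::finite) chart \<Rightarrow> ('a, 'n) chart \<Rightarrow> bool" where
  "compatible \<kappa> \<kappa>' \<longleftrightarrow>
     (\<forall>k. hol_on (\<lambda>y. transition \<kappa> \<kappa>' y $ k) (snd \<kappa> ` (fst \<kappa> \<inter> fst \<kappa>'))) \<and>
     (\<forall>k. hol_on (\<lambda>y. transition \<kappa>' \<kappa> y $ k) (snd \<kappa>' ` (fst \<kappa> \<inter> fst \<kappa>')))"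

text \<open>A complex manifold structure on the topological space \<open>'a\<close>: a maximal holomorphic atlas.\<close>

definition complex_structure :: "('a::topological_space, 'n::finite) chart set \<Rightarrow> bool" where
  "complex_structure \<A> \<longleftrightarrow>
     (\<forall>\<kappa>\<in>\<A>. is_chart \<kappa>) \<and> (\<Union>\<kappa>\<in>\<A>. fst \<kappa>) = UNIV \<and>
     (\<forall>\<kappa>\<in>\<A>. \<forall>\<kappa>'\<in>\<A>. compatible \<kappa> \<kappa>') \<and>
     (\<forall>\<kappa>. is_chart \<kappa> \<and> (\<forall>\<kappa>'\<in>\<A>. compatible \<kappa> \<kappa>') \<longrightarrow> \<kappa> \<in> \<A>)"

section \<open>Bilinear forms and bivectors\<close>

definition bil :: "complex^'n^'n \<Rightarrow> complex^'n \<Rightarrow> complex^'n \<Rightarrow> complex" where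
  "bil G X Y = (\<Sum>i\<in>UNIV. \<Sum>j\<in>UNIV. X $ i * G $ i $ j * Y $ j)"

definition nondegenerate :: "complex^'n^'n \<Rightarrow> bool" where
  "nondegenerate G \<longleftrightarrow> invertible G"

definition orthonormal :: "complex^'n^'n \<Rightarrow> ('n \<Rightarrow> complex^'n) \<Rightarrow> bool" where
  "orthonormal G e \<longleftrightarrow> (\<forall>i j. bil G (e i) (e j) = (if i = j then 1 else 0))"

text \<open>The bivector \<open>1/2 \<Sum> A\<^sup>i\<^sup>j e\<^sub>i \<and> e\<^sub>j\<close> is represented by the antisymmetric matrix of its components.\<close>

definition bivectors :: "(complex^'n^'n) set" where
  "bivectors = {A. transpose A = - A}"

definition wedge :: "complex^'n \<Rightarrow> complex^'n \<Rightarrow> complex^'n^'n" where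
  "wedge X Y = (\<chi> i j. X $ i * Y $ j - X $ j * Y $ i)"

definition cscale :: "complex \<Rightarrow> complex^'n^'n \<Rightarrow> complex^'n^'n" where
  "cscale c A = (\<chi> i j. c * A $ i $ j)"

text \<open>The factor 1/2 gives \<open>g(X \<and> Y, Z \<and> T) = g(X,Z) g(Y,T) - g(X,T) g(Y,Z)\<close>.\<close>

definition bil2 :: "complex^'n^'n \<Rightarrow> complex^'n^'n \<Rightarrow> complex^'n^'n \<Rightarrow> complex" where
  "bil2 G A B = (1/2) * (\<Sum>a\<in>UNIV. \<Sum>b\<in>UNIV. \<Sum>c\<in>UNIV. \<Sum>d\<in>UNIV.
      A $ a $ b * B $ c $ d * G $ a $ c * G $ b $ d)"

text \<open>Trace of an endomorphism of the space of bivectors; each basis element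
  \<open>e\<^sub>i \<and> e\<^sub>j\<close> (\<open>i < j\<close>) is counted twice in the sum.\<close>

definition trace2 :: "(complex^'n^'n \<Rightarrow> complex^'n^'n) \<Rightarrow> complex" where
  "trace2 K = (1/2) * (\<Sum>i\<in>UNIV. \<Sum>j\<in>UNIV. K (wedge (axis i 1) (axis j 1)) $ i $ j)"

section \<open>Levi-Civita connection and curvature in coordinates\<close>

text \<open>\<open>G\<close> is the matrix of components of a metric, as a function of the coordinates.\<close>

definition christoffel :: "(complex^'n \<Rightarrow> complex^'n^'n) \<Rightarrow> complex^'n \<Rightarrow> 'n::finite \<Rightarrow> 'n \<Rightarrow> 'n \<Rightarrow> complex" where
  "christoffel G x k i j = (1/2) * (\<Sum>l\<in>UNIV. matrix_inv (G x) $ k $ l *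
      (dirderiv (\<lambda>y. G y $ j $ l) (axis i 1) x + dirderiv (\<lambda>y. G y $ i $ l) (axis j 1) x
       - dirderiv (\<lambda>y. G y $ i $ j) (axis l 1) x))"

definition covd :: "(complex^'n \<Rightarrow> complex^'n^'n) \<Rightarrow> (complex^'n \<Rightarrow> complex^'n) \<Rightarrow>
    (complex^'n \<Rightarrow> complex^'n) \<Rightarrow> complex^'n \<Rightarrow> complex^'n::finite" where
  "covd G X Y x = (\<chi> k. dirderiv (\<lambda>y. Y y $ k) (X x) x
      + (\<Sum>i\<in>UNIV. \<Sum>j\<in>UNIV. christoffel G x k i j * X x $ i * Y x $ j))"

text \<open>\<open>R(u,v)w\<close> with the sign \<open>R(X,Y) = \<nabla>\<^bsub>[X,Y]\<^esub> - [\<nabla>\<^sub>X,\<nabla>\<^sub>Y]\<close>, evaluated on the vector fields with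
  constant components \<open>u, v, w\<close>, whose brackets vanish.\<close>

definition curv :: "(complex^'n \<Rightarrow> complex^'n^'n) \<Rightarrow> complex^'n \<Rightarrow>
    complex^'n \<Rightarrow> complex^'n \<Rightarrow> complex^'n \<Rightarrow> complex^'n::finite" where
  "curv G x u v w = - (covd G (\<lambda>_. u) (covd G (\<lambda>_. v) (\<lambda>_. w)) x
                       - covd G (\<lambda>_. v) (covd G (\<lambda>_. u) (\<lambda>_. w)) x)"

text \<open>The trace of \<open>Z \<mapsto> R(u,Z)w\<close>, positive on round spheres.\<close>

definition ricci :: "(complex^'n \<Rightarrow> complex^'n^'n) \<Rightarrow> complex^'n \<Rightarrow> complex^'n \<Rightarrow> complex^'n::finite \<Rightarrow> complex" where
  "ricci G x u w = (\<Sum>i\<in>UNIV. curv G x u (axis i 1) w $ i)"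

definition scal :: "(complex^'n \<Rightarrow> complex^'n^'n) \<Rightarrow> complex^'n::finite \<Rightarrow> complex" where
  "scal G x = (\<Sum>i\<in>UNIV. \<Sum>j\<in>UNIV. matrix_inv (G x) $ i $ j * ricci G x (axis i 1) (axis j 1))"

definition ricci0 :: "(complex^'n \<Rightarrow> complex^'n^'n) \<Rightarrow> complex^'n \<Rightarrow> complex^'n \<Rightarrow> complex^'n::finite \<Rightarrow> complex" where
  "ricci0 G x u w = ricci G x u w - scal G x / of_nat CARD('n) * bil (G x) u w"

definition nricci :: "(complex^'n \<Rightarrow> complex^'n^'n) \<Rightarrow> complex^'n \<Rightarrow> complex^'n \<Rightarrow> complex^'n::finite \<Rightarrow> complex" where
  "nricci G x u w =
     1 / (2 * of_nat CARD('n) * (of_nat CARD('n) - 1)) * scal G x * bil (G x) u w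
     + 1 / (of_nat CARD('n) - 2) * ricci0 G x u w"

text \<open>\<open>g((h \<and> I)(X,Y)Z,T)\<close>: the curvature-type polarization of
  \<open>h(X,X) g(Y,Y) + h(Y,Y) g(X,X) - 2 h(X,Y) g(X,Y)\<close>.\<close>

definition susp :: "(complex^'n \<Rightarrow> complex^'n^'n) \<Rightarrow> complex^'n \<Rightarrow>
    complex^'n \<Rightarrow> complex^'n \<Rightarrow> complex^'n \<Rightarrow> complex^'n::finite \<Rightarrow> complex" where
  "susp G x X Y Z T = nricci G x X Z * bil (G x) Y T + nricci G x Y T * bil (G x) X Z
                    - nricci G x X T * bil (G x) Y Z - nricci G x Y Z * bil (G x) X T"

text \<open>The Weyl tensor \<open>g(W(X,Y)Z,T)\<close>, where \<open>R = h \<and> I + W\<close>.\<close>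

definition weyl :: "(complex^'n \<Rightarrow> complex^'n^'n) \<Rightarrow> complex^'n \<Rightarrow>
    complex^'n \<Rightarrow> complex^'n \<Rightarrow> complex^'n \<Rightarrow> complex^'n::finite \<Rightarrow> complex" where
  "weyl G x X Y Z T = bil (G x) (curv G x X Y Z) T - susp G x X Y Z T"

definition covd_nricci :: "(complex^'n \<Rightarrow> complex^'n^'n) \<Rightarrow> complex^'n \<Rightarrow>
    complex^'n \<Rightarrow> complex^'n \<Rightarrow> complex^'n::finite \<Rightarrow> complex" where
  "covd_nricci G x X Y Z = dirderiv (\<lambda>y. nricci G y Y Z) X x
      - nricci G x (covd G (\<lambda>_. X) (\<lambda>_. Y) x) Z - nricci G x Y (covd G (\<lambda>_. X) (\<lambda>_. Z) x)"

text \<open>\<open>C(A)(Z)\<close> for a bivector \<open>A\<close>, so that \<open>C(X \<and> Y)(Z) = (\<nabla>\<^sub>Xh)(Y,Z) - (\<nabla>\<^sub>Yh)(X,Z)\<close>.\<close>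

definition cotton_york :: "(complex^'n \<Rightarrow> complex^'n^'n) \<Rightarrow> complex^'n \<Rightarrow>
    complex^'n^'n \<Rightarrow> complex^'n::finite \<Rightarrow> complex" where
  "cotton_york G x A Z = (1/2) * (\<Sum>a\<in>UNIV. \<Sum>b\<in>UNIV. A $ a $ b *
      (covd_nricci G x (axis a 1) (axis b 1) Z - covd_nricci G x (axis b 1) (axis a 1) Z))"

text \<open>The curvature as an endomorphism of bivectors: \<open>g(R(X \<and> Y), Z \<and> T) = g(R(X,Y)Z,T)\<close>.
  The components of \<open>R(e\<^sub>i \<and> e\<^sub>j)\<close> arise from those of \<open>R(e\<^sub>i,e\<^sub>j)e\<^sub>c\<close> by raising the index \<open>c\<close>.\<close>

definition curvop :: "(complex^'n \<Rightarrow> complex^'n^'n) \<Rightarrow> complex^'n \<Rightarrow> complex^'n^'n \<Rightarrow> complex^'n^'n::finite" where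
  "curvop G x A = (\<chi> a b. (1/2) * (\<Sum>i\<in>UNIV. \<Sum>j\<in>UNIV. A $ i $ j *
      (\<Sum>c\<in>UNIV. matrix_inv (G x) $ a $ c * curv G x (axis i 1) (axis j 1) (axis c 1) $ b)))"

text \<open>\<open>(\<nabla>\<^sub>v K)(A)\<close> for a field \<open>K\<close> of endomorphisms of bivectors.\<close>

definition conn2 :: "(complex^'n \<Rightarrow> complex^'n^'n) \<Rightarrow> complex^'n \<Rightarrow> complex^'n \<Rightarrow> complex^'n^'n \<Rightarrow> complex^'n^'n::finite" where
  "conn2 G x v A = (let N = (\<chi> k j. \<Sum>i\<in>UNIV. christoffel G x k i j * v $ i)
                    in N ** A + A ** transpose N)"

definition covd_end2 :: "(complex^'n \<Rightarrow> complex^'n^'n) \<Rightarrow> (complex^'n \<Rightarrow> complex^'n^'n \<Rightarrow> complex^'n^'n) \<Rightarrow>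
    complex^'n \<Rightarrow> complex^'n \<Rightarrow> complex^'n^'n \<Rightarrow> complex^'n^'n::finite" where
  "covd_end2 G K v x A = (\<chi> a b. dirderiv (\<lambda>y. K y A $ a $ b) v x)
                         + conn2 G x v (K x A) - K x (conn2 G x v A)"

section \<open>Hodge operators in dimension 4 and the half Weyl tensors\<close>

definition is_hodge :: "complex^4^4 \<Rightarrow> (complex^4^4 \<Rightarrow> complex^4^4) \<Rightarrow> bool" where
  "is_hodge G S \<longleftrightarrow>
     (\<forall>A\<in>bivectors. \<forall>B\<in>bivectors. S (A + B) = S A + S B) \<and>
     (\<forall>c. \<forall>A\<in>bivectors. S (cscale c A) = cscale c (S A)) \<and>
     (\<exists>e. orthonormal G e \<and>
        S (wedge (e 1) (e 2)) = wedge (e 3) (e 4) \<and> S (wedge (e 3) (e 4)) = wedge (e 1) (e 2) \<and>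
        S (wedge (e 1) (e 3)) = wedge (e 4) (e 2) \<and> S (wedge (e 4) (e 2)) = wedge (e 1) (e 3) \<and>
        S (wedge (e 1) (e 4)) = wedge (e 2) (e 3) \<and> S (wedge (e 2) (e 3)) = wedge (e 1) (e 4))"

text \<open>The orientation of an orthonormal basis is read off from the given Hodge operator.\<close>

definition oriented_onb :: "complex^4^4 \<Rightarrow> (complex^4^4 \<Rightarrow> complex^4^4) \<Rightarrow> (4 \<Rightarrow> complex^4) \<Rightarrow> bool" where
  "oriented_onb G S e \<longleftrightarrow> orthonormal G e \<and> S (wedge (e 1) (e 2)) = wedge (e 3) (e 4)"

text \<open>Projection onto the eigenbundle of \<open>S\<close> for the eigenvalue \<open>s = 1\<close> or \<open>s = -1\<close>.\<close>

definition eproj :: "complex \<Rightarrow> (complex^4^4 \<Rightarrow> complex^4^4) \<Rightarrow> complex^4^4 \<Rightarrow> complex^4^4" where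
  "eproj s S A = cscale (1/2) (A + cscale s (S A))"

text \<open>The trace-free part of the curvature in \<open>End(\<Lambda>\<^sup>\<plusminus>)\<close>, extended by zero on the other
  eigenbundle; the rank of \<open>\<Lambda>\<^sup>\<plusminus>\<close> is 3.\<close>

definition half_weyl :: "complex \<Rightarrow> (complex^4 \<Rightarrow> complex^4^4) \<Rightarrow> (complex^4 \<Rightarrow> complex^4^4 \<Rightarrow> complex^4^4) \<Rightarrow>
    complex^4 \<Rightarrow> complex^4^4 \<Rightarrow> complex^4^4" where
  "half_weyl s G S x A = (let P = eproj s (S x); K = (\<lambda>B. P (curvop G x (P B)))
                          in K A - cscale (trace2 K / 3) (P A))"

abbreviation weyl_plus where "weyl_plus \<equiv> half_weyl 1"
abbreviation weyl_minus where "weyl_minus \<equiv> half_weyl (-1)"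

section \<open>Conformal structures and orientations on a complex 4-manifold\<close>

text \<open>A tensor field is a family of component functions indexed by the charts; its values only
  matter for charts of the atlas and points of the chart domain.
  \<open>coord \<kappa> f\<close> expresses the components of \<open>f\<close> in \<open>\<kappa>\<close> as functions of the coordinates.\<close>

definition coord :: "('a, 'n) chart \<Rightarrow> (('a, 'n) chart \<Rightarrow> 'a \<Rightarrow> 'b) \<Rightarrow> complex^'n \<Rightarrow> 'b" where
  "coord \<kappa> f y = f \<kappa> (inv_into (fst \<kappa>) (snd \<kappa>) y)"

type_synonym 'a metric = "('a, 4) chart \<Rightarrow> 'a \<Rightarrow> complex^4^4"
type_synonym 'a hodge = "('a, 4) chart \<Rightarrow> 'a \<Rightarrow> complex^4^4 \<Rightarrow> complex^4^4"

definition local_metric :: "('a::topological_space, 4) chart set \<Rightarrow> 'a set \<Rightarrow> 'a metric \<Rightarrow> bool" where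
  "local_metric \<A> V g \<longleftrightarrow> open V \<and>
     (\<forall>\<kappa>\<in>\<A>. \<forall>p\<in>V \<inter> fst \<kappa>. transpose (g \<kappa> p) = g \<kappa> p \<and> nondegenerate (g \<kappa> p)) \<and>
     (\<forall>\<kappa>\<in>\<A>. \<forall>i j. hol_on (\<lambda>y. coord \<kappa> g y $ i $ j) (snd \<kappa> ` (V \<inter> fst \<kappa>))) \<and>
     (\<forall>\<kappa>\<in>\<A>. \<forall>\<kappa>'\<in>\<A>. \<forall>p\<in>V \<inter> fst \<kappa> \<inter> fst \<kappa>'.
        let J = jacobian (transition \<kappa> \<kappa>') (snd \<kappa> p)
        in g \<kappa> p = transpose J ** g \<kappa>' p ** J)"

definition conformally_related ::
  "('a::topological_space, 4) chart set \<Rightarrow> 'a set \<times> 'a metric \<Rightarrow> 'a set \<times> 'a metric \<Rightarrow> bool" where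
  "conformally_related \<A> Ug Vh \<longleftrightarrow> (\<exists>f. 
     (\<forall>p\<in>fst Ug \<inter> fst Vh. f p \<noteq> 0) \<and>
     (\<forall>\<kappa>\<in>\<A>. hol_on (\<lambda>y. f (inv_into (fst \<kappa>) (snd \<kappa>) y)) (snd \<kappa> ` (fst Ug \<inter> fst Vh \<inter> fst \<kappa>))) \<and>
     (\<forall>\<kappa>\<in>\<A>. \<forall>p\<in>fst Ug \<inter> fst Vh \<inter> fst \<kappa>. snd Vh \<kappa> p = cscale (f p) (snd Ug \<kappa> p)))"

text \<open>A conformal structure is the collection of all its local metrics, with their domains.\<close>

definition conformal_structure :: "('a::topological_space, 4) chart set \<Rightarrow> ('a set \<times> 'a metric) set \<Rightarrow> bool" where
  "conformal_structure \<A> c \<longleftrightarrow>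
     (\<forall>(V,g)\<in>c. local_metric \<A> V g) \<and> (\<Union>(V,g)\<in>c. V) = UNIV \<and>
     (\<forall>Ug\<in>c. \<forall>Vh\<in>c. conformally_related \<A> Ug Vh) \<and>
     (\<forall>V h. local_metric \<A> V h \<and> (\<forall>Ug\<in>c. conformally_related \<A> Ug (V,h)) \<longrightarrow> (V,h) \<in> c)"

definition orientation :: "('a::topological_space, 4) chart set \<Rightarrow> ('a set \<times> 'a metric) set \<Rightarrow> 'a hodge \<Rightarrow> bool" where
  "orientation \<A> c S \<longleftrightarrow>
     (\<forall>(V,g)\<in>c. \<forall>\<kappa>\<in>\<A>. \<forall>p\<in>V \<inter> fst \<kappa>. is_hodge (g \<kappa> p) (S \<kappa> p)) \<and>
     (\<forall>\<kappa>\<in>\<A>. \<forall>A\<in>bivectors. \<forall>i j. hol_on (\<lambda>y. coord \<kappa> S y A $ i $ j) (snd \<kappa> ` fst \<kappa>)) \<and>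
     (\<forall>\<kappa>\<in>\<A>. \<forall>\<kappa>'\<in>\<A>. \<forall>p\<in>fst \<kappa> \<inter> fst \<kappa>'. \<forall>A\<in>bivectors.
        let J = jacobian (transition \<kappa> \<kappa>') (snd \<kappa> p)
        in S \<kappa>' p (J ** A ** transpose J) = J ** S \<kappa> p A ** transpose J)"

definition self_dual :: "('a::topological_space, 4) chart set \<Rightarrow> ('a set \<times> 'a metric) set \<Rightarrow> 'a hodge \<Rightarrow> bool" where
  "self_dual \<A> c S \<longleftrightarrow>
     (\<forall>(V,g)\<in>c. \<forall>\<kappa>\<in>\<A>. \<forall>p\<in>V \<inter> fst \<kappa>. \<forall>A\<in>bivectors.
        weyl_minus (coord \<kappa> g) (coord \<kappa> S) (snd \<kappa> p) A = 0)"

section \<open>Hypersurfaces\<close>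

definition incl :: "complex^3 \<Rightarrow> complex^4" where
  "incl u = vector [u $ 1, u $ 2, u $ 3, 0]"

definition slice_coord :: "complex^4 \<Rightarrow> complex^3" where
  "slice_coord y = vector [y $ 1, y $ 2, y $ 3]"

definition incl2 :: "complex^3^3 \<Rightarrow> complex^4^4" where
  "incl2 A = matrix incl ** A ** transpose (matrix incl)"

definition slice_charts :: "('a, 4) chart set \<Rightarrow> 'a set \<Rightarrow> ('a, 4) chart set" where
  "slice_charts \<A> Q = {\<kappa>\<in>\<A>. snd \<kappa> ` (fst \<kappa> \<inter> Q) = {y \<in> snd \<kappa> ` fst \<kappa>. y $ 4 = 0}}"

text \<open>A slice chart \<open>\<kappa>\<close> of \<open>Q\<close> induces the chart \<open>slice_coord \<circ> \<kappa>\<close> of the 3-manifold \<open>Q\<close>, in which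
  the inclusion into the ambient manifold reads \<open>incl\<close>.\<close>

definition hypersurface :: "('a, 4) chart set \<Rightarrow> 'a set \<Rightarrow> bool" where
  "hypersurface \<A> Q \<longleftrightarrow> (\<forall>x\<in>Q. \<exists>\<kappa>\<in>slice_charts \<A> Q. x \<in> fst \<kappa>)"

definition induced :: "(complex^4 \<Rightarrow> complex^4^4) \<Rightarrow> complex^3 \<Rightarrow> complex^3^3" where
  "induced G u = (\<chi> i j. bil (G (incl u)) (incl (axis i 1)) (incl (axis j 1)))"

definition nondegenerate_on :: "('a, 4) chart set \<Rightarrow> ('a set \<times> 'a metric) set \<Rightarrow> 'a set \<Rightarrow> bool" where
  "nondegenerate_on \<A> c Q \<longleftrightarrow>
     (\<forall>(V,g)\<in>c. \<forall>\<kappa>\<in>slice_charts \<A> Q. \<forall>x\<in>Q \<inter> V \<inter> fst \<kappa>.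
        nondegenerate (induced (coord \<kappa> g) (slice_coord (snd \<kappa> x))))"

definition unit_normal :: "(complex^4 \<Rightarrow> complex^4^4) \<Rightarrow> complex^4 \<Rightarrow> complex^4 \<Rightarrow> bool" where
  "unit_normal G y \<nu> \<longleftrightarrow> bil (G y) \<nu> \<nu> = 1 \<and> (\<forall>X. bil (G y) (incl X) \<nu> = 0)"

text \<open>\<open>g(\<nabla>\<^sub>X Y, \<nu>)\<close>, where \<open>X\<close>, \<open>Y\<close> are extended with constant components, hence tangent to the slice.\<close>

definition second_ff :: "(complex^4 \<Rightarrow> complex^4^4) \<Rightarrow> complex^3 \<Rightarrow> complex^4 \<Rightarrow> complex^3 \<Rightarrow> complex^3 \<Rightarrow> complex" where
  "second_ff G u \<nu> X Y = bil (G (incl u)) (covd G (\<lambda>_. incl X) (\<lambda>_. incl Y) (incl u)) \<nu>"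

definition mean_curv :: "(complex^4 \<Rightarrow> complex^4^4) \<Rightarrow> complex^3 \<Rightarrow> complex^4 \<Rightarrow> complex" where
  "mean_curv G u \<nu> = (1/3) * (\<Sum>i\<in>UNIV. \<Sum>j\<in>UNIV.
      matrix_inv (induced G u) $ i $ j * second_ff G u \<nu> (axis i 1) (axis j 1))"

definition umbilic :: "('a, 4) chart set \<Rightarrow> ('a set \<times> 'a metric) set \<Rightarrow> 'a set \<Rightarrow> bool" where
  "umbilic \<A> c Q \<longleftrightarrow>
     (\<forall>(V,g)\<in>c. \<forall>\<kappa>\<in>slice_charts \<A> Q. \<forall>x\<in>Q \<inter> V \<inter> fst \<kappa>. \<forall>\<nu>.
        let G = coord \<kappa> g; u = slice_coord (snd \<kappa> x)
        in unit_normal G (snd \<kappa> x) \<nu> \<longrightarrow>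
           (\<forall>X Y. second_ff G u \<nu> X Y - mean_curv G u \<nu> * bil (induced G u) X Y = 0))"

text \<open>\<open>(X,Y,Z)\<close> is an oriented orthonormal basis of the hypersurface with exterior normal \<open>\<nu>\<close>.\<close>

definition oriented_onb3 :: "complex^4^4 \<Rightarrow> (complex^4^4 \<Rightarrow> complex^4^4) \<Rightarrow> complex^4 \<Rightarrow>
    complex^3 \<Rightarrow> complex^3 \<Rightarrow> complex^3 \<Rightarrow> bool" where
  "oriented_onb3 G S \<nu> X Y Z \<longleftrightarrow>
     oriented_onb G S (\<lambda>i. if i = 1 then incl X else if i = 2 then incl Y else if i = 3 then incl Z else \<nu>)"

text \<open>The Hodge operator of the hypersurface, its values being identified with tangent vectors
  by the metric: \<open>Y \<and> Z \<mapsto> X\<close>, \<open>Z \<and> X \<mapsto> Y\<close>, \<open>X \<and> Y \<mapsto> Z\<close> for every oriented orthonormal basis.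
  It is applied to the components of a bivector \<open>B\<close> in such a basis.\<close>

definition hodge3 :: "complex^3^3 \<Rightarrow> complex^4^4 \<Rightarrow> (complex^4^4 \<Rightarrow> complex^4^4) \<Rightarrow> complex^4 \<Rightarrow>
    complex^3^3 \<Rightarrow> complex^3" where
  "hodge3 GQ G S \<nu> B = (THE v. \<forall>X Y Z. oriented_onb3 G S \<nu> X Y Z \<longrightarrow>
      v = bil2 GQ B (wedge Y Z) *s X + bil2 GQ B (wedge Z X) *s Y + bil2 GQ B (wedge X Y) *s Z)"

end

theory Submission
  imports Defs "HOL-Complex_Analysis.Cauchy_Integral_Formula"
begin

text \<open>All computations take place at the points of the slice \<open>y\<^sub>4 = 0\<close> of a slice chart. Let \<open>n\<close> be the
  metric dual of \<open>dy\<^sub>4\<close>; umbilicity says that \<open>\<nabla>\<^sub>XY = \<nabla>\<^sup>Q\<^sub>XY + \<rho> g(X,Y) n\<close> for tangent fields. The Codazzi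
  equation then gives \<open>W(X,Y,Z,n) = \<gamma>(Y) g(X,Z) - \<gamma>(X) g(Y,Z)\<close> for a 1-form \<open>\<gamma>\<close>, which is zero because \<open>W\<close> is
  trace-free. In dimension four \<open>W\<close> commutes with the Hodge operator, so self-duality means
  \<open>W(A, *B) = W(A,B)\<close>; as \<open>*\<close> exchanges tangent bivectors and those of the form \<open>X \<and> n\<close>, \<open>W\<close> vanishes
  along \<open>Q\<close>.

  Since \<open>W = 0\<close> on \<open>Q\<close>, the Gauss equation yields \<open>h\<^sup>Q = h + \<sigma>/2 g\<close> on \<open>TQ\<close> with \<open>\<sigma> = \<rho>\<^sup>2 g(n,n)\<close>, and the tensors
  \<open>C\<close> of the ambient manifold and of \<open>Q\<close> agree on tangent vectors, because the difference of the two
  covariant derivatives is totally symmetric. Only the normal derivative of \<open>W\<close> survives on \<open>Q\<close>, so the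
  differential Bianchi identity with one normal argument in front reads
  \<open>(\<nabla>\<^sub>\<nu>W)(X,Y,Z,\<nu>) = - C(X,Y)(Z)\<close> up to a trace term, which the identity with tangent arguments removes.
  Finally \<open>(\<nabla>\<^sub>\<nu>W)(A,B) = (\<nabla>\<^sub>\<nu>W)(A,*B)\<close> and \<open>*B = *\<^sup>QB \<and> \<nu>\<close>.\<close>

section \<open>Holomorphic functions of several variables\<close>

text \<open>Umbilicity is used for the given metric, with \<open>rho\<close> a function on the
  hypersurface. A metric making the hypersurface totally geodesic would give \<open>rho = 0\<close>,
  but would call for the behaviour of every tensor under conformal change; instead the terms in
  \<open>rho\<close> are carried along until symmetry cancels them. \<open>hol_on\<close> asserts
  complex differentiability and nothing about the derivative as a function of the point, whereas the
  Cotton-York tensor involves three derivatives of the metric. Holomorphy and symmetry of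
  derivatives have to be extracted from Cauchy estimates on complex lines. Once \<open>W\<close>
  vanishes along the hypersurface, so does every product of a component of \<open>W\<close> with a
  Christoffel symbol or with a derivative of the metric or of the Hodge operator. Hence
  \<open>\<nabla>W\<close> is there the plain derivative of components. Curvature operators are
  compared through the bilinear forms they define on bivectors: the half Weyl tensors arise by
  projecting and removing a trace, while the Bianchi identities concern the 4-tensor
  \<open>R - h \<and> I\<close>.\<close>

lemma norm_cvec_scale: "norm (c *s (v :: complex^'n)) = cmod c * norm v"
  by (simp add: norm_vec_def norm_mult L2_set_right_distrib)

lemma has_derivative_affine_line:
  "((\<lambda>t. y + t *s (v :: complex^'n)) has_derivative (\<lambda>t. t *s v)) (at z)"
proof -
  have "bounded_linear (\<lambda>t. t *s v)"
    by (rule bounded_linear_intro[where K = "norm v"])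
       (auto simp: norm_cvec_scale vec_eq_iff algebra_simps)
  then show ?thesis
    by (auto intro!: derivative_eq_intros bounded_linear_imp_has_derivative)
qed

lemma has_field_derivative_along_line:
  assumes "(f has_derivative D) (at (y + z *s v))" "\<And>c v. D (c *s v) = c * D v"
  shows "((\<lambda>t. f (y + t *s (v :: complex^'n))) has_field_derivative D v) (at z)"
proof -
  have "((\<lambda>t. f (y + t *s v)) has_derivative (\<lambda>t. D (t *s v))) (at z)"
    using diff_chain_at[OF has_derivative_affine_line assms(1)] by (simp add: o_def)
  moreover have "(\<lambda>t. D (t *s v)) = (*) (D v)"
    using assms(2) by (auto simp: mult.commute)
  ultimately show ?thesis by (simp add: has_field_derivative_def)
qed

lemma dirderiv_eqI:
  assumes "(f has_derivative D) (at x)" "\<And>c v. D (c *s v) = c * D v"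
  shows "dirderiv f v x = D v"
  unfolding dirderiv_def
  by (rule DERIV_imp_deriv, rule has_field_derivative_along_line) (use assms in auto)

lemma hol_onI:
  assumes "\<And>x. x \<in> S \<Longrightarrow> (f has_derivative D x) (at x)" "\<And>x c v. x \<in> S \<Longrightarrow> D x (c *s v) = c * D x v"
  shows "hol_on f S"
  using assms unfolding hol_on_def by blast

lemma hol_on_has_derivative:
  assumes "hol_on f S" "x \<in> S"
  shows "(f has_derivative (\<lambda>v. dirderiv f v x)) (at x)"
proof -
  obtain D where D: "(f has_derivative D) (at x)" "\<And>c v. D (c *s v) = c * D v"
    using assms unfolding hol_on_def by blast
  then have "(\<lambda>v. dirderiv f v x) = D" using dirderiv_eqI by blast
  with D show ?thesis by simp
qed

lemma dirderiv_scale: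
  assumes "hol_on f S" "x \<in> S"
  shows "dirderiv f (c *s v) x = c * dirderiv f v x"
  using assms dirderiv_eqI unfolding hol_on_def by metis

lemma dirderiv_add_dir:
  assumes "hol_on f S" "x \<in> S"
  shows "dirderiv f (v + w) x = dirderiv f v x + dirderiv f w x"
  using linear_add[OF has_derivative_linear[OF hol_on_has_derivative[OF assms]]] .

lemma hol_on_subset: "hol_on f S \<Longrightarrow> T \<subseteq> S \<Longrightarrow> hol_on f T"
  unfolding hol_on_def by blast

lemma hol_on_continuous: "hol_on f S \<Longrightarrow> continuous_on S f"
  by (meson continuous_at_imp_continuous_on has_derivative_continuous hol_on_has_derivative)

section \<open>Restriction to complex lines and Cauchy estimates\<close>

lemma hol_on_line_has_field_derivative:
  assumes "hol_on f S" "y + z *s v \<in> S"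
  shows "((\<lambda>t. f (y + t *s v)) has_field_derivative dirderiv f v (y + z *s v)) (at z)"
  by (rule has_field_derivative_along_line)
     (use assms hol_on_has_derivative dirderiv_scale in blast)+

lemma holomorphic_line:
  assumes "hol_on f S" "\<And>z. z \<in> A \<Longrightarrow> y + z *s v \<in> S"
  shows "(\<lambda>t. f (y + t *s v)) holomorphic_on A"
  using hol_on_line_has_field_derivative[OF assms(1)] assms(2)
  by (meson holomorphic_onI field_differentiable_at_within field_differentiable_def)

text \<open>Taylor's formula of order one for \<open>t \<mapsto> f (y + t *s h)\<close> between 0
  and 1. This function is defined on the disc of radius \<open>R = r / (2 |h|)\<close>, and Cauchy's
  inequality on circles of radius \<open>R / 4\<close> bounds its second derivative on the unit disc
  by \<open>32 M / R\<^sup>2\<close>, which is \<open>128 M |h|\<^sup>2 / r\<^sup>2\<close>. The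
  point is uniformity in \<open>y\<close>.\<close>

lemma second_order_remainder:
  assumes hol: "hol_on f (ball x r)" and r: "0 < r"
    and M: "\<And>z. z \<in> ball x r \<Longrightarrow> cmod (f z) \<le> M"
    and y: "y \<in> ball x (r/2)" and h: "norm h \<le> r / 4"
  shows "cmod (f (y + h) - f y - dirderiv f h y) \<le> (128 * M / r\<^sup>2) * (norm h)\<^sup>2"
proof (cases "h = 0")
  case True
  have "dirderiv f (0 *s 0) y = 0 * dirderiv f 0 y"
    by (rule dirderiv_scale[OF hol]) (use y r in auto)
  then show ?thesis using True by simp
next
  case False
  then have hp: "norm h > 0" by simp
  define R where "R = r / 2 / norm h"
  have R: "R \<ge> 2" using h hp by (simp add: R_def field_simps)
  define \<phi> where "\<phi> t = f (y + t *s h)" for t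
  have inb: "y + t *s h \<in> ball x r" if "t \<in> ball 0 R" for t
  proof -
    have "norm (t *s h) < r / 2"
      using that hp by (simp add: norm_cvec_scale R_def field_simps)
    moreover have "dist x (y + t *s h) \<le> dist x y + norm (t *s h)"
      by (metis add_diff_cancel_left' dist_norm dist_triangle norm_minus_commute)
    ultimately show ?thesis using y by simp
  qed
  have holp: "\<phi> holomorphic_on ball 0 R"
    unfolding \<phi>_def by (rule holomorphic_line[OF hol]) (use inb in auto)
  have M0: "M \<ge> 0" using M[of x] r by (meson centre_in_ball norm_ge_zero order_trans)
  have B: "cmod ((deriv ^^ 2) \<phi> t) \<le> 32 * M / R\<^sup>2" if t: "t \<in> cball 0 1" for t
  proof -
    have sub: "cball t (R/4) \<subseteq> ball 0 R"
    proof
      fix s assume "s \<in> cball t (R/4)"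
      then have "cmod (s - t) \<le> R/4" by (simp add: dist_norm norm_minus_commute)
      moreover have "cmod s \<le> cmod t + cmod (s - t)" by (metis add.commute diff_add_cancel norm_triangle_ineq)
      ultimately show "s \<in> ball 0 R" using t R by simp
    qed
    have "cmod ((deriv ^^ 2) \<phi> t) \<le> fact 2 * M / (R/4)^2"
    proof (rule Cauchy_inequality)
      show "\<phi> holomorphic_on ball t (R/4)"
        using holp sub ball_subset_cball holomorphic_on_subset by (metis subset_trans)
      show "continuous_on (cball t (R/4)) \<phi>"
        using holomorphic_on_imp_continuous_on[OF holp] sub continuous_on_subset by blast
      show "0 < R/4" using R by simp
      fix s assume "cmod (t - s) = R/4"
      then have "s \<in> cball t (R/4)" by (simp add: dist_norm)
      then show "cmod (\<phi> s) \<le> M" unfolding \<phi>_def using sub inb M by blast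
    qed
    also have "\<dots> = 32 * M / R\<^sup>2" by (simp add: power2_eq_square)
    finally show ?thesis .
  qed
  have d: "((deriv ^^ i) \<phi> has_field_derivative (deriv ^^ Suc i) \<phi> t) (at t within cball 0 1)"
    if "t \<in> cball 0 1" for i t
  proof -
    have "t \<in> ball 0 R" using that R by auto
    then show ?thesis
      using has_field_derivative_higher_deriv[OF holp open_ball] has_field_derivative_at_within by blast
  qed
  have T: "cmod ((deriv ^^ 0) \<phi> 1 - (\<Sum>i\<le>1. (deriv ^^ i) \<phi> 0 * (1 - 0) ^ i / fact i))
      \<le> 32 * M / R\<^sup>2 * cmod (1 - 0) ^ Suc 1 / fact 1"
    by (rule complex_Taylor[where S = "cball 0 1"])
       (use d B in \<open>auto simp: numeral_2_eq_2\<close>)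
  have "deriv \<phi> 0 = dirderiv f h y" by (simp add: \<phi>_def[abs_def] dirderiv_def)
  moreover have "32 * M / R\<^sup>2 = 128 * M / r\<^sup>2 * (norm h)\<^sup>2"
    by (simp add: R_def power_divide field_simps power_mult_distrib)
  ultimately show ?thesis using T by (simp add: \<phi>_def algebra_simps)
qed

lemma hol_on_locally_bounded:
  assumes "hol_on f S" "open S" "x \<in> S"
  obtains r M where "0 < r" "ball x r \<subseteq> S" "\<And>y. y \<in> ball x r \<Longrightarrow> cmod (f y) \<le> M"
proof -
  obtain d where d: "0 < d" "ball x d \<subseteq> S" using assms(2,3) open_contains_ball by blast
  have "isCont f x" using assms hol_on_has_derivative has_derivative_continuous by blast
  then obtain e where e: "0 < e" "\<And>y. dist y x < e \<Longrightarrow> dist (f y) (f x) < 1"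
    unfolding continuous_at_eps_delta by (metis zero_less_one)
  show ?thesis
  proof (rule that[of "min d e" "cmod (f x) + 1"])
    fix y assume "y \<in> ball x (min d e)"
    then have "dist (f y) (f x) < 1" using e(2)[of y] by (simp add: dist_commute)
    then show "cmod (f y) \<le> cmod (f x) + 1"
      by (metis add.commute add_le_cancel_left dist_norm less_imp_le norm_triangle_ineq2 diff_le_eq order_trans)
  qed (use d e in auto)
qed

lemma line_in_ball:
  assumes "z \<in> cball 0 \<rho>" "\<rho> * norm v < r"
  shows "x + z *s (v :: complex^'n) \<in> ball x r"
proof -
  have "cmod z * norm v \<le> \<rho> * norm v" using assms by (intro mult_right_mono) auto
  then show ?thesis using assms by (simp add: dist_norm norm_cvec_scale)
qed

text \<open>Weierstrass' theorem: the difference quotients of \<open>f\<close> in the direction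
  \<open>h\<close> are holomorphic in \<open>t\<close>, and \<open>second_order_remainder\<close>
  makes them converge uniformly on the closed disc.\<close>

lemma dirderiv_holomorphic_along_line:
  fixes f :: "complex^'n \<Rightarrow> complex"
  assumes hol: "hol_on f (ball x r)" and r: "0 < r"
    and M: "\<And>z. z \<in> ball x r \<Longrightarrow> cmod (f z) \<le> M"
    and \<rho>: "\<rho> * norm v < r / 2"
  shows "(\<lambda>t. dirderiv f h (x + t *s v)) holomorphic_on ball 0 \<rho>"
proof -
  define F where "F n t = of_nat n * (f (x + (1 / of_nat n) *s h + t *s v) - f (x + t *s v))" for n :: nat and t :: complex
  have inb: "x + t *s v \<in> ball x (r/2)" if "t \<in> cball 0 \<rho>" for t
    using line_in_ball that \<rho> by blast
  have small: "\<forall>\<^sub>F n in sequentially. norm ((1 / of_nat n) *s h) < r / 4"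
  proof -
    have "(\<lambda>n. norm h / real n) \<longlonglongrightarrow> 0" by (rule lim_const_over_n)
    then have "\<forall>\<^sub>F n in sequentially. norm h / real n < r / 4"
      by (rule order_tendstoD) (use r in simp)
    then show ?thesis by (simp add: norm_cvec_scale norm_divide)
  qed
  have step: "x + (1 / of_nat n) *s h + t *s v \<in> ball x r"
    if "norm ((1 / of_nat n) *s h) < r / 4" "t \<in> cball 0 \<rho>" for n t
  proof -
    have "norm (t *s v) < r / 2" using inb[OF that(2)] by (simp add: dist_norm)
    then have "norm ((1 / of_nat n) *s h + t *s v) < r"
      using that(1) r norm_triangle_ineq[of "(1 / of_nat n) *s h" "t *s v"] by simp
    then show ?thesis by (metis add.assoc add_diff_cancel_left' dist_commute dist_norm mem_ball)
  qed
  have ul: "uniform_limit (cball 0 \<rho>) F (\<lambda>t. dirderiv f h (x + t *s v)) sequentially"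
  proof (rule uniform_limitI)
    fix e :: real assume "0 < e"
    then have "\<forall>\<^sub>F n in sequentially. 128 * M / r\<^sup>2 * (norm h)\<^sup>2 / real n < e"
      by (intro order_tendstoD(2)[OF lim_const_over_n])
    with small eventually_gt_at_top[of 0]
    show "\<forall>\<^sub>F n in sequentially. \<forall>t\<in>cball 0 \<rho>. dist (F n t) (dirderiv f h (x + t *s v)) < e"
    proof eventually_elim
      case (elim n)
      show ?case
      proof
        fix t :: complex assume t: "t \<in> cball 0 \<rho>"
        let ?y = "x + t *s v" and ?k = "(1 / of_nat n) *s h"
        have y: "?y \<in> ball x r" using inb[OF t] r by simp
        \<comment> \<open>By homogeneity the error of the n-th quotient is n times the second order
          remainder for the step \<open>h / n\<close>, hence of order \<open>1 / n\<close>.\<close>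
        have "dirderiv f h ?y = of_nat n * dirderiv f ?k ?y"
          using dirderiv_scale[OF hol y, of "1 / of_nat n" h] elim by simp
        moreover have "x + ?k + t *s v = ?y + ?k" by (simp add: add.commute add.left_commute)
        ultimately have "F n t - dirderiv f h ?y = of_nat n * (f (?y + ?k) - f ?y - dirderiv f ?k ?y)"
          unfolding F_def by (simp only: right_diff_distrib)
        then have "dist (F n t) (dirderiv f h ?y) = real n * cmod (f (?y + ?k) - f ?y - dirderiv f ?k ?y)"
          by (simp add: dist_norm norm_mult)
        also have "\<dots> \<le> real n * (128 * M / r\<^sup>2 * (norm ?k)\<^sup>2)"
          using second_order_remainder[OF hol r M inb[OF t], of ?k] elim
          by (intro mult_left_mono) auto
        also have "\<dots> = 128 * M / r\<^sup>2 * (norm h)\<^sup>2 / real n"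
          using elim by (simp add: norm_cvec_scale norm_divide power2_eq_square field_simps)
        also have "\<dots> < e" using elim by simp
        finally show "dist (F n t) (dirderiv f h ?y) < e" .
      qed
    qed
  qed
  have "\<forall>\<^sub>F n in sequentially. continuous_on (cball 0 \<rho>) (F n) \<and> F n holomorphic_on ball 0 \<rho>"
    using small
  proof eventually_elim
    case (elim n)
    have 1: "(\<lambda>t. f (x + (1 / of_nat n) *s h + t *s v)) holomorphic_on A" if "A \<subseteq> cball 0 \<rho>" for A
      by (rule holomorphic_line[OF hol]) (use step[OF elim] that in blast)
    have 2: "(\<lambda>t. f (x + t *s v)) holomorphic_on A" if "A \<subseteq> cball 0 \<rho>" for A
      by (rule holomorphic_line[OF hol]) (use inb that r in fastforce)
    have "F n holomorphic_on A" if "A \<subseteq> cball 0 \<rho>" for A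
      unfolding F_def by (intro holomorphic_intros 1 2 that)
    then show ?case using holomorphic_on_imp_continuous_on ball_subset_cball by blast
  qed
  then show ?thesis
    using holomorphic_uniform_limit[OF _ ul] by (metis trivial_limit_sequentially)
qed

text \<open>Cauchy's estimate on the lines parallel to \<open>v\<close>, applied to the first order remainder of \<open>f\<close> in the
  direction \<open>h\<close>. The form of the derivative contains the symmetry of second derivatives.\<close>

theorem dirderiv_has_derivative:
  fixes f :: "complex^'n \<Rightarrow> complex"
  assumes hol: "hol_on f S" and S: "open S" and x: "x \<in> S"
  shows "(dirderiv f v has_derivative (\<lambda>h. dirderiv (dirderiv f h) v x)) (at x)"
    and "dirderiv (dirderiv f (c *s h)) v x = c * dirderiv (dirderiv f h) v x"
proof -
  obtain r M where r: "0 < r" and sub: "ball x r \<subseteq> S" and M: "\<And>y. y \<in> ball x r \<Longrightarrow> cmod (f y) \<le> M"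
    using hol_on_locally_bounded[OF hol S x] by blast
  have holr: "hol_on f (ball x r)" using hol_on_subset hol sub by blast
  define \<rho> where "\<rho> = (r / 4) / (norm v + 1)"
  have nv: "norm v + 1 > 0" by (simp add: add_nonneg_pos)
  have \<rho>0: "\<rho> > 0" using r nv unfolding \<rho>_def by simp
  have \<rho>: "\<rho> * norm v < r / 2"
  proof -
    have "\<rho> * norm v \<le> \<rho> * (norm v + 1)" using \<rho>0 by simp
    also have "\<dots> = r / 4" using nv unfolding \<rho>_def by (metis nonzero_eq_divide_eq less_irrefl)
    finally show ?thesis using r by simp
  qed
  define D where "D h = dirderiv (dirderiv f h) v x" for h
  have lineh: "(\<lambda>t. dirderiv f h (x + t *s v)) holomorphic_on ball 0 \<rho>" for h
    by (rule dirderiv_holomorphic_along_line[OF holr r M \<rho>])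
  have derh: "((\<lambda>t. dirderiv f h (x + t *s v)) has_field_derivative D h) (at 0)" for h
    unfolding D_def dirderiv_def[of "dirderiv f h"]
    by (rule holomorphic_derivI[OF lineh]) (use \<rho>0 in auto)
  have inb: "x + t *s v \<in> ball x (r/2)" if "t \<in> cball 0 \<rho>" for t
    using line_in_ball that \<rho> by blast
  then have inr: "x + t *s v \<in> ball x r" if "t \<in> cball 0 \<rho>" for t
    using that r by (metis add_cancel_right_left half_gt_zero less_add_same_cancel1 linorder_not_le mem_ball not_less_iff_gr_or_eq field_sum_of_halves order_less_trans)
  \<comment> \<open>\<open>D h\<close> only sees \<open>dirderiv f h\<close> near \<open>x\<close>
    on one line. Identities between these functions on the ball therefore pass to \<open>D\<close>,
    which gives its linearity in \<open>h\<close> before any differentiability of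
    \<open>dirderiv f h\<close> in several variables is known.\<close>
  have cong: "D h = d" if "\<And>y. y \<in> ball x r \<Longrightarrow> dirderiv f h y = g y"
    "((\<lambda>t. g (x + t *s v)) has_field_derivative d) (at 0)" for h g d
  proof -
    have "((\<lambda>t. dirderiv f h (x + t *s v)) has_field_derivative d) (at 0)"
      by (rule has_field_derivative_transform_within_open[OF that(2), of "ball 0 \<rho>"])
         (use \<rho>0 inr that(1) in auto)
    then show ?thesis using derh DERIV_unique by blast
  qed
  have Dadd: "D (h + k) = D h + D k" for h k
    by (rule cong[of _ "\<lambda>y. dirderiv f h y + dirderiv f k y"])
       (use dirderiv_add_dir[OF holr] derh in \<open>auto intro!: derivative_eq_intros\<close>)
  have Dscale: "D (c *s h) = c * D h" for c h
    by (rule cong[of _ "\<lambda>y. c * dirderiv f h y"])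
       (use dirderiv_scale[OF holr] derh in \<open>auto intro!: derivative_eq_intros\<close>)
  have scaleR: "c *\<^sub>R h = complex_of_real c *s h" for c and h :: "complex^'n"
    by (simp add: vec_eq_iff) (simp add: scaleR_conv_of_real)
  have lin: "bounded_linear D"
    unfolding linear_conv_bounded_linear[symmetric]
    by (rule linearI) (auto simp: Dadd scaleR Dscale scaleR_conv_of_real)
  have bound: "cmod (dirderiv f v (x + h) - dirderiv f v x - D h) \<le> 256 * M / r\<^sup>2 / \<rho> * (norm h)\<^sup>2"
    if h: "norm h < r / 4" for h
  proof -
    have hx: "x + h + t *s v \<in> ball x r" if "t \<in> cball 0 \<rho>" for t
    proof -
      have "norm (t *s v) < r / 2" using inb[OF that] by (simp add: dist_norm)
      then have "norm (h + t *s v) < r"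
        using h r norm_triangle_ineq[of h "t *s v"] by simp
      then show ?thesis by (metis add.assoc add_diff_cancel_left' dist_commute dist_norm mem_ball)
    qed
    define g where "g t = f (x + h + t *s v) - f (x + t *s v) - dirderiv f h (x + t *s v)" for t
    have "(g has_field_derivative (dirderiv f v (x + h) - dirderiv f v x - D h)) (at 0)"
    proof -
      have 1: "((\<lambda>t. f (x + h + t *s v)) has_field_derivative dirderiv f v (x + h + 0 *s v)) (at 0)"
        by (rule hol_on_line_has_field_derivative[OF holr]) (use hx[of 0] \<rho>0 in auto)
      have 2: "((\<lambda>t. f (x + t *s v)) has_field_derivative dirderiv f v (x + 0 *s v)) (at 0)"
        by (rule hol_on_line_has_field_derivative[OF holr]) (use r in auto)
      show ?thesis unfolding g_def using 1 2 derh[of h] by (auto intro!: derivative_eq_intros)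
    qed
    then have "dirderiv f v (x + h) - dirderiv f v x - D h = (deriv ^^ 1) g 0"
      by (simp add: DERIV_imp_deriv)
    also have "cmod \<dots> \<le> fact 1 * (128 * M / r\<^sup>2 * (norm h)\<^sup>2) / (\<rho>/2) ^ 1"
    proof (rule Cauchy_inequality)
      have g: "g holomorphic_on ball 0 \<rho>"
        unfolding g_def using hx inr
        by (intro holomorphic_intros lineh holomorphic_line[OF holr]) auto
      have sub: "cball 0 (\<rho>/2) \<subseteq> ball (0::complex) \<rho>" using \<rho>0 by auto
      show "g holomorphic_on ball 0 (\<rho>/2)"
        by (rule holomorphic_on_subset[OF g]) (use \<rho>0 in auto)
      show "continuous_on (cball 0 (\<rho>/2)) g"
        by (rule continuous_on_subset[OF holomorphic_on_imp_continuous_on[OF g] sub])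
      fix t :: complex assume "cmod (0 - t) = \<rho>/2"
      then have "t \<in> cball 0 \<rho>" using \<rho>0 by simp
      then show "cmod (g t) \<le> 128 * M / r\<^sup>2 * (norm h)\<^sup>2"
        unfolding g_def using second_order_remainder[OF holr r M inb, of t h] h by (simp add: algebra_simps)
    qed (use \<rho>0 in simp)
    finally show ?thesis by (simp add: field_simps)
  qed
  have "(dirderiv f v has_derivative D) (at x)"
    unfolding has_derivative_at
  proof (intro conjI lin)
    show "(\<lambda>h. norm (dirderiv f v (x + h) - dirderiv f v x - D h) / norm h) \<midarrow>0\<rightarrow> 0"
    proof (rule Lim_null_comparison)
      show "\<forall>\<^sub>F h in at 0. norm (norm (dirderiv f v (x + h) - dirderiv f v x - D h) / norm h)
          \<le> 256 * M / r\<^sup>2 / \<rho> * norm h"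
        unfolding eventually_at
      proof (intro exI[of _ "r/4"] conjI ballI impI)
        fix h :: "complex^'n" assume "h \<noteq> 0 \<and> dist h 0 < r / 4"
        then show "norm (norm (dirderiv f v (x + h) - dirderiv f v x - D h) / norm h)
            \<le> 256 * M / r\<^sup>2 / \<rho> * norm h"
          using bound[of h] by (simp add: divide_le_eq power2_eq_square mult.assoc)
      qed (use r in simp)
      show "((\<lambda>h :: complex^'n. 256 * M / r\<^sup>2 / \<rho> * norm h) \<longlongrightarrow> 0) (at 0)"
        by (intro tendsto_mult_right_zero tendsto_norm_zero tendsto_ident_at)
    qed
  qed
  then show "(dirderiv f v has_derivative (\<lambda>h. dirderiv (dirderiv f h) v x)) (at x)"
    by (simp add: D_def[abs_def])
  show "dirderiv (dirderiv f (c *s h)) v x = c * dirderiv (dirderiv f h) v x"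
    using Dscale by (simp add: D_def)
qed

lemma dirderiv_cong:
  fixes f :: "complex^'n \<Rightarrow> complex"
  assumes "\<And>y. y \<in> S \<Longrightarrow> f y = g y" "open S" "x \<in> S"
  shows "dirderiv f v x = dirderiv g v x"
proof -
  have "isCont (\<lambda>t. x + t *s v) 0"
    by (rule has_derivative_continuous[OF has_derivative_affine_line])
  then have "((\<lambda>t. x + t *s v) \<longlongrightarrow> x + 0 *s v) (nhds 0)"
    unfolding isCont_def by (subst (asm) tendsto_at_iff_tendsto_nhds)
  then have "\<forall>\<^sub>F t in nhds 0. x + t *s v \<in> S"
    using assms(2,3) by (auto dest: topological_tendstoD)
  then have "\<forall>\<^sub>F t in nhds 0. f (x + t *s v) = g (x + t *s v)"
    by eventually_elim (rule assms(1))
  then show ?thesis unfolding dirderiv_def by (rule deriv_cong_ev) simp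
qed

lemma hol_on_cong:
  assumes "hol_on f S" "\<And>y. y \<in> S \<Longrightarrow> f y = g y" "open S"
  shows "hol_on g S"
  by (rule hol_onI[OF has_derivative_transform_within_open[OF hol_on_has_derivative[OF assms(1)] assms(3)]])
     (use assms dirderiv_scale[OF assms(1)] in auto)

text \<open>The differential found in \<open>dirderiv_has_derivative\<close> already has the two
  directions exchanged, so uniqueness of the derivative is enough.\<close>

lemma dirderiv_commute:
  assumes "hol_on f S" "open S" "x \<in> S"
  shows "dirderiv (dirderiv f v) w x = dirderiv (dirderiv f w) v x"
  by (rule dirderiv_eqI) (use dirderiv_has_derivative[OF assms] in blast)+

section \<open>Rules of holomorphic calculus\<close>

lemma hol_on_dirderiv:
  assumes "hol_on f S" "open S"
  shows "hol_on (dirderiv f v) S"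
  by (rule hol_onI) (use dirderiv_has_derivative[OF assms] in blast)+

lemma dirderiv_const [simp]: "dirderiv (\<lambda>_. c) v x = 0"
  unfolding dirderiv_def by simp

lemma hol_on_const: "hol_on (\<lambda>_. c) S"
  by (rule hol_onI[where D = "\<lambda>_ _. 0"]) auto

lemma assumes "hol_on f S" "hol_on g S"
  shows hol_on_add: "hol_on (\<lambda>x. f x + g x) S"
    and hol_on_mult: "hol_on (\<lambda>x. f x * g x) S"
    and dirderiv_add: "x \<in> S \<Longrightarrow> dirderiv (\<lambda>x. f x + g x) v x = dirderiv f v x + dirderiv g v x"
    and dirderiv_mult: "x \<in> S \<Longrightarrow> dirderiv (\<lambda>x. f x * g x) v x = dirderiv f v x * g x + f x * dirderiv g v x"
proof -
  note * = hol_on_has_derivative[OF assms(1)] hol_on_has_derivative[OF assms(2)]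
  note ** = dirderiv_scale[OF assms(1)] dirderiv_scale[OF assms(2)]
  have a: "((\<lambda>x. f x + g x) has_derivative (\<lambda>v. dirderiv f v x + dirderiv g v x)) (at x)" if "x \<in> S" for x
    by (rule has_derivative_add[OF *[OF that]])
  show "hol_on (\<lambda>x. f x + g x) S"
    by (rule hol_onI[OF a]) (auto simp: ** algebra_simps)
  show "x \<in> S \<Longrightarrow> dirderiv (\<lambda>x. f x + g x) v x = dirderiv f v x + dirderiv g v x"
    by (rule dirderiv_eqI[OF a]) (auto simp: ** algebra_simps)
  have m: "((\<lambda>x. f x * g x) has_derivative (\<lambda>v. dirderiv f v x * g x + f x * dirderiv g v x)) (at x)" if "x \<in> S" for x
    using has_derivative_mult[OF *[OF that]] by (simp add: algebra_simps)
  show "hol_on (\<lambda>x. f x * g x) S"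
    by (rule hol_onI[OF m]) (auto simp: ** algebra_simps)
  show "x \<in> S \<Longrightarrow> dirderiv (\<lambda>x. f x * g x) v x = dirderiv f v x * g x + f x * dirderiv g v x"
    by (rule dirderiv_eqI[OF m]) (auto simp: ** algebra_simps)
qed

lemma assumes "hol_on f S"
  shows hol_on_cmult: "hol_on (\<lambda>x. c * f x) S"
    and dirderiv_cmult: "x \<in> S \<Longrightarrow> dirderiv (\<lambda>x. c * f x) v x = c * dirderiv f v x"
  using hol_on_mult[OF hol_on_const assms] dirderiv_mult[OF hol_on_const assms] by simp_all

lemma assumes "hol_on f S"
  shows hol_on_uminus: "hol_on (\<lambda>x. - f x) S"
    and dirderiv_uminus: "x \<in> S \<Longrightarrow> dirderiv (\<lambda>x. - f x) v x = - dirderiv f v x"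
  using hol_on_cmult[OF assms, of "-1"] dirderiv_cmult[OF assms, of x "-1"] by simp_all

lemma assumes "hol_on f S" "hol_on g S"
  shows hol_on_diff: "hol_on (\<lambda>x. f x - g x) S"
    and dirderiv_diff: "x \<in> S \<Longrightarrow> dirderiv (\<lambda>x. f x - g x) v x = dirderiv f v x - dirderiv g v x"
  using hol_on_add[OF assms(1) hol_on_uminus[OF assms(2)]]
    dirderiv_add[OF assms(1) hol_on_uminus[OF assms(2)]] dirderiv_uminus[OF assms(2)] by simp_all

lemma hol_on_sum: "(\<And>i. i \<in> I \<Longrightarrow> hol_on (f i) S) \<Longrightarrow> hol_on (\<lambda>x. \<Sum>i\<in>I. f i x) S"
  by (induction I rule: infinite_finite_induct) (auto intro: hol_on_const hol_on_add)

lemma dirderiv_sum: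
  assumes "\<And>i. i \<in> I \<Longrightarrow> hol_on (f i) S" "x \<in> S"
  shows "dirderiv (\<lambda>x. \<Sum>i\<in>I. f i x) v x = (\<Sum>i\<in>I. dirderiv (f i) v x)"
  using assms
  by (induction I rule: infinite_finite_induct)
     (simp_all add: hol_on_sum dirderiv_add[where S = S])

lemma hol_on_prod: "(\<And>i. i \<in> I \<Longrightarrow> hol_on (f i) S) \<Longrightarrow> hol_on (\<lambda>x. \<Prod>i\<in>I. f i x) S"
  by (induction I rule: infinite_finite_induct) (auto intro: hol_on_const hol_on_mult)

lemma hol_on_divide:
  assumes "hol_on f S" "hol_on g S" "\<And>x. x \<in> S \<Longrightarrow> g x \<noteq> 0"
  shows "hol_on (\<lambda>x. f x / g x) S"
proof (rule hol_onI)
  fix x assume x: "x \<in> S"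
  show "((\<lambda>x. f x / g x) has_derivative
      (\<lambda>v. (dirderiv f v x * g x - f x * dirderiv g v x) / (g x * g x))) (at x)"
    by (rule has_derivative_divide'[OF hol_on_has_derivative[OF assms(1) x]
          hol_on_has_derivative[OF assms(2) x] assms(3)[OF x]])
next
  fix x c v assume "x \<in> S"
  then show "(dirderiv f (c *s v) x * g x - f x * dirderiv g (c *s v) x) / (g x * g x) =
      c * ((dirderiv f v x * g x - f x * dirderiv g v x) / (g x * g x))"
    using assms(3) by (simp add: dirderiv_scale[OF assms(1)] dirderiv_scale[OF assms(2)] field_simps)
qed

section \<open>Holomorphic vector fields and the chain rule\<close>

definition vhol :: "(complex^'n \<Rightarrow> complex^'m) \<Rightarrow> (complex^'n) set \<Rightarrow> bool" where
  "vhol Y S \<longleftrightarrow> (\<forall>k. hol_on (\<lambda>y. Y y $ k) S)"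

definition vdd :: "(complex^'n \<Rightarrow> complex^'m) \<Rightarrow> complex^'n \<Rightarrow> complex^'n \<Rightarrow> complex^'m" where
  "vdd Y v x = (\<chi> k. dirderiv (\<lambda>y. Y y $ k) v x)"

lemma vdd_nth [simp]: "vdd Y v x $ k = dirderiv (\<lambda>y. Y y $ k) v x"
  by (simp add: vdd_def)

lemma vholD: "vhol Y S \<Longrightarrow> hol_on (\<lambda>y. Y y $ k) S"
  by (simp add: vhol_def)

lemma vhol_const [simp]: "vhol (\<lambda>_. c) S"
  by (simp add: vhol_def hol_on_const)

lemma vdd_const [simp]: "vdd (\<lambda>_. c) v x = 0"
  by (simp add: vec_eq_iff)

lemma vhol_vdd: "vhol Y S \<Longrightarrow> open S \<Longrightarrow> vhol (vdd Y v) S"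
  using hol_on_dirderiv by (auto simp: vhol_def)

lemma hol_on_compose:
  fixes f :: "complex^'m \<Rightarrow> complex" and \<phi> :: "complex^'n \<Rightarrow> complex^'m"
  assumes "hol_on f T" "vhol \<phi> S" "\<And>x. x \<in> S \<Longrightarrow> \<phi> x \<in> T"
  shows "hol_on (\<lambda>x. f (\<phi> x)) S"
    and "x \<in> S \<Longrightarrow> dirderiv (\<lambda>x. f (\<phi> x)) v x = dirderiv f (vdd \<phi> v x) (\<phi> x)"
proof -
  have vd: "(\<phi> has_derivative (\<lambda>v. vdd \<phi> v x)) (at x)" if x: "x \<in> S" for x
  proof -
    have bl: "bounded_linear (\<lambda>z. z *s (axis k 1 :: complex^'m))" for k
      by (rule bounded_linear_intro[where K = 1]) (auto simp: norm_cvec_scale vec_eq_iff algebra_simps norm_axis_1)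
    have "((\<lambda>y. \<Sum>k\<in>UNIV. \<phi> y $ k *s axis k 1) has_derivative
        (\<lambda>v. \<Sum>k\<in>UNIV. dirderiv (\<lambda>y. \<phi> y $ k) v x *s axis k 1)) (at x)"
      by (intro has_derivative_sum bounded_linear.has_derivative[OF bl]
          hol_on_has_derivative[OF vholD[OF assms(2)] x])
    then show ?thesis using basis_expansion[of "\<phi> _"] basis_expansion[of "vdd \<phi> _ x"] by simp
  qed
  have vs: "vdd \<phi> (c *s v) x = c *s vdd \<phi> v x" if "x \<in> S" for c v x
    using dirderiv_scale[OF vholD[OF assms(2)] that] by (simp add: vec_eq_iff)
  have d: "((\<lambda>x. f (\<phi> x)) has_derivative (\<lambda>v. dirderiv f (vdd \<phi> v x) (\<phi> x))) (at x)" if x: "x \<in> S" for x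
    using diff_chain_at[OF vd[OF x] hol_on_has_derivative[OF assms(1) assms(3)[OF x]]] by (simp add: o_def)
  show "hol_on (\<lambda>x. f (\<phi> x)) S"
    by (rule hol_onI[OF d]) (auto simp: vs dirderiv_scale[OF assms(1) assms(3)])
  show "x \<in> S \<Longrightarrow> dirderiv (\<lambda>x. f (\<phi> x)) v x = dirderiv f (vdd \<phi> v x) (\<phi> x)"
    by (rule dirderiv_eqI[OF d]) (auto simp: vs dirderiv_scale[OF assms(1) assms(3)])
qed

section \<open>Complex linear forms depending holomorphically on a point\<close>

definition clin :: "(complex^'n \<Rightarrow> complex) \<Rightarrow> bool" where
  "clin f \<longleftrightarrow> (\<forall>u v. f (u + v) = f u + f v) \<and> (\<forall>c u. f (c *s u) = c * f u)"

lemma clinI: "(\<And>u v. f (u + v) = f u + f v) \<Longrightarrow> (\<And>c u. f (c *s u) = c * f u) \<Longrightarrow> clin f"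
  by (simp add: clin_def)

lemma assumes "clin f"
  shows clin_add: "f (u + v) = f u + f v"
    and clin_scale: "f (c *s u) = c * f u"
    and clin_zero: "f 0 = 0"
    and clin_minus: "f (- u) = - f u"
    and clin_diff: "f (u - v) = f u - f v"
proof -
  show *: "f (u + v) = f u + f v" "f (c *s u) = c * f u" for u v c using assms by (simp_all add: clin_def)
  show "f 0 = 0" using *(2)[of 0 0] by simp
  show m: "f (- u) = - f u" for u using *(2)[of "-1" u] by (simp add: vector_smult_lneg)
  show "f (u - v) = f u - f v" using *(1)[of u "-v"] m[of v] by simp
qed

lemma clin_sum: "clin f \<Longrightarrow> f (\<Sum>i\<in>I. g i) = (\<Sum>i\<in>I. f (g i))"
  by (induction I rule: infinite_finite_induct) (auto simp: clin_zero clin_add)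

lemma clin_expand: "clin f \<Longrightarrow> f v = (\<Sum>i\<in>UNIV. v $ i * f (axis i 1))"
  using clin_sum[of f "\<lambda>i. v $ i *s axis i 1" UNIV] by (simp add: clin_scale basis_expansion)

lemma clin_dirderiv: "hol_on f S \<Longrightarrow> x \<in> S \<Longrightarrow> clin (\<lambda>v. dirderiv f v x)"
  by (auto intro!: clinI simp: dirderiv_add_dir dirderiv_scale)

text \<open>Leibniz rule for a family of linear forms applied to a vector field: expansion in the
  standard basis turns it into the rule for products of functions. Metric, connection and pullbacks
  are all differentiated through this.\<close>

lemma assumes "open S" "\<And>y. y \<in> S \<Longrightarrow> clin (F y)" "\<And>a. hol_on (\<lambda>y. F y a) S" "vhol Y S"
  shows hol_on_clin: "hol_on (\<lambda>y. F y (Y y)) S"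
    and dirderiv_clin: "x \<in> S \<Longrightarrow> dirderiv (\<lambda>y. F y (Y y)) v x = dirderiv (\<lambda>y. F y (Y x)) v x + F x (vdd Y v x)"
proof -
  have e: "(\<Sum>i\<in>UNIV. Y y $ i * F y (axis i 1)) = F y (Y y)"
     "(\<Sum>i\<in>UNIV. a $ i * F y (axis i 1)) = F y a" if "y \<in> S" for y a
    by (simp_all add: clin_expand[OF assms(2)[OF that], symmetric])
  note h = vholD[OF assms(4)] assms(3)
  have "hol_on (\<lambda>y. \<Sum>i\<in>UNIV. Y y $ i * F y (axis i 1)) S"
    by (intro hol_on_sum hol_on_mult h)
  then show "hol_on (\<lambda>y. F y (Y y)) S" by (rule hol_on_cong) (use e assms(1) in auto)
  assume x: "x \<in> S"
  have "dirderiv (\<lambda>y. F y (Y y)) v x = dirderiv (\<lambda>y. \<Sum>i\<in>UNIV. Y y $ i * F y (axis i 1)) v x"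
    by (rule dirderiv_cong[OF _ assms(1) x]) (simp add: e)
  also have "\<dots> = (\<Sum>i\<in>UNIV. dirderiv (\<lambda>y. Y y $ i) v x * F x (axis i 1) + Y x $ i * dirderiv (\<lambda>y. F y (axis i 1)) v x)"
    by (subst dirderiv_sum[where S = S]) (auto intro!: hol_on_mult h x sum.cong dirderiv_mult[OF h x])
  also have "\<dots> = F x (vdd Y v x) + (\<Sum>i\<in>UNIV. Y x $ i * dirderiv (\<lambda>y. F y (axis i 1)) v x)"
    by (simp add: sum.distrib clin_expand[OF assms(2)[OF x], of "vdd Y v x"])
  also have "(\<Sum>i\<in>UNIV. Y x $ i * dirderiv (\<lambda>y. F y (axis i 1)) v x)
      = dirderiv (\<lambda>y. \<Sum>i\<in>UNIV. Y x $ i * F y (axis i 1)) v x"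
    by (subst dirderiv_sum[where S = S])
       (auto intro!: hol_on_mult hol_on_const h x sum.cong simp: dirderiv_cmult[OF h(2) x])
  also have "\<dots> = dirderiv (\<lambda>y. F y (Y x)) v x"
    by (rule dirderiv_cong[OF _ assms(1) x]) (simp add: e)
  finally show "dirderiv (\<lambda>y. F y (Y y)) v x = dirderiv (\<lambda>y. F y (Y x)) v x + F x (vdd Y v x)"
    by simp
qed

lemma clin_ext:
  assumes "clin f" "clin g" "\<And>i. f (axis i 1) = g (axis i 1)"
  shows "f v = g v"
  by (simp add: clin_expand[OF assms(1), of v] clin_expand[OF assms(2), of v] assms(3))

lemma clin_dirderiv_family:
  assumes "open S" "x \<in> S" "\<And>y. y \<in> S \<Longrightarrow> clin (F y)" "\<And>a. hol_on (\<lambda>y. F y a) S"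
  shows "clin (\<lambda>a. dirderiv (\<lambda>y. F y a) v x)"
proof (rule clinI)
  fix a b c
  have "dirderiv (\<lambda>y. F y (a + b)) v x = dirderiv (\<lambda>y. F y a + F y b) v x"
    by (rule dirderiv_cong[OF _ assms(1,2)]) (simp add: clin_add[OF assms(3)])
  then show "dirderiv (\<lambda>y. F y (a + b)) v x = dirderiv (\<lambda>y. F y a) v x + dirderiv (\<lambda>y. F y b) v x"
    by (simp add: dirderiv_add[OF assms(4) assms(4) assms(2)])
  have "dirderiv (\<lambda>y. F y (c *s a)) v x = dirderiv (\<lambda>y. c * F y a) v x"
    by (rule dirderiv_cong[OF _ assms(1,2)]) (simp add: clin_scale[OF assms(3)])
  then show "dirderiv (\<lambda>y. F y (c *s a)) v x = c * dirderiv (\<lambda>y. F y a) v x"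
    by (simp add: dirderiv_cmult[OF assms(4) assms(2)])
qed

lemma
  assumes S: "open S" and F: "\<And>y b. y \<in> S \<Longrightarrow> clin (\<lambda>a. F y a b)" "\<And>y a. y \<in> S \<Longrightarrow> clin (F y a)"
    "\<And>a b. hol_on (\<lambda>y. F y a b) S" and Y: "vhol Y S" and Z: "vhol Z S"
  shows hol_on_bilinear: "hol_on (\<lambda>y. F y (Y y) (Z y)) S"
    and dirderiv_bilinear: "x \<in> S \<Longrightarrow> dirderiv (\<lambda>y. F y (Y y) (Z y)) v x
      = dirderiv (\<lambda>y. F y (Y x) (Z x)) v x + F x (vdd Y v x) (Z x) + F x (Y x) (vdd Z v x)"
proof -
  have 1: "hol_on (\<lambda>y. F y a (Z y)) S"
    "\<And>x v. x \<in> S \<Longrightarrow> dirderiv (\<lambda>y. F y a (Z y)) v x = dirderiv (\<lambda>y. F y a (Z x)) v x + F x a (vdd Z v x)" for a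
    by (rule hol_on_clin[OF S F(2,3) Z] dirderiv_clin[OF S F(2,3) Z]; assumption)+
  show "hol_on (\<lambda>y. F y (Y y) (Z y)) S"
    by (rule hol_on_clin[where F = "\<lambda>y a. F y a (Z y)", OF S F(1) 1(1) Y])
  show "x \<in> S \<Longrightarrow> dirderiv (\<lambda>y. F y (Y y) (Z y)) v x
      = dirderiv (\<lambda>y. F y (Y x) (Z x)) v x + F x (vdd Y v x) (Z x) + F x (Y x) (vdd Z v x)"
    using dirderiv_clin[where F = "\<lambda>y a. F y a (Z y)", OF S F(1) 1(1) Y] 1(2)[of x "Y x" v] by simp
qed

section \<open>Bilinear forms\<close>

lemma matrix_inv_right: "invertible A \<Longrightarrow> A ** matrix_inv A = mat 1"
  and matrix_inv_left: "invertible A \<Longrightarrow> matrix_inv A ** A = mat 1"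
  unfolding invertible_def matrix_inv_def by (metis (mono_tags, lifting) someI_ex)+

lemma matrix_inv_unique:
  fixes A :: "complex^'n^'n"
  assumes "A ** B = mat 1"
  shows "matrix_inv A = B"
proof -
  have "B ** A = mat 1" using assms matrix_left_right_inverse by blast
  then have "invertible A" using assms invertible_def by blast
  then have "matrix_inv A ** (A ** B) = B"
    by (simp add: matrix_mul_assoc matrix_inv_left)
  then show ?thesis using assms by simp
qed

lemma clin_bil_left: "clin (\<lambda>X. bil G X Y)" and clin_bil_right: "clin (bil G X)"
  unfolding clin_def bil_def
  by (auto simp: algebra_simps sum.distrib sum_distrib_left)

lemmas bil_add_left = clin_add[OF clin_bil_left] and bil_add_right = clin_add[OF clin_bil_right]
  and bil_scale_left = clin_scale[OF clin_bil_left] and bil_scale_right = clin_scale[OF clin_bil_right]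
  and bil_zero_left = clin_zero[OF clin_bil_left] and bil_zero_right = clin_zero[OF clin_bil_right]
  and bil_minus_left = clin_minus[OF clin_bil_left] and bil_minus_right = clin_minus[OF clin_bil_right]
  and bil_diff_left = clin_diff[OF clin_bil_left] and bil_diff_right = clin_diff[OF clin_bil_right]

lemmas bil_simps = bil_add_left bil_add_right bil_scale_left bil_scale_right bil_zero_left
  bil_zero_right bil_minus_left bil_minus_right bil_diff_left bil_diff_right

lemma bil_matrix: "bil G X Y = (\<Sum>i\<in>UNIV. X $ i * (G *v Y) $ i)"
  by (simp add: bil_def matrix_vector_mult_def sum_distrib_left mult.assoc)

lemma sum_axis: "(\<Sum>i\<in>UNIV. axis k (1::complex) $ i * f i) = f k"
  "(\<Sum>i\<in>UNIV. f i * axis k (1::complex) $ i) = f k"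
proof -
  have "axis k (1::complex) $ i * f i = (if i = k then f i else 0)"
    "f i * axis k (1::complex) $ i = (if i = k then f i else 0)" for i
    by (auto simp: axis_def)
  then show "(\<Sum>i\<in>UNIV. axis k (1::complex) $ i * f i) = f k"
    "(\<Sum>i\<in>UNIV. f i * axis k (1::complex) $ i) = f k" by simp_all
qed

lemma matrix_vector_axis: "((A :: complex^'n^'m) *v axis j 1) $ i = A $ i $ j"
  by (simp add: matrix_vector_mult_def sum_axis)

lemma bil_axis_left: "bil G (axis i 1) Y = (G *v Y) $ i"
  by (simp add: bil_matrix sum_axis)

lemma bil_axis: "bil G (axis i 1) (axis j 1) = G $ i $ j"
  by (simp add: bil_axis_left matrix_vector_axis)

lemma bil_sym: "transpose G = G \<Longrightarrow> bil G X Y = bil G Y X"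
  unfolding bil_def
  by (subst sum.swap) (auto simp: vec_eq_iff transpose_def mult.assoc mult.commute mult.left_commute intro!: sum.cong)

lemma bil_congruence: "bil (transpose J ** G ** J) X Y = bil G (J *v X) (J *v Y)"
proof -
  have tr: "(z v* J) $ i = (\<Sum>k\<in>UNIV. J $ k $ i * z $ k)" for z i
    by (simp add: vector_matrix_mult_def mult.commute)
  have "bil (transpose J ** G ** J) X Y = (\<Sum>i\<in>UNIV. X $ i * (transpose J *v (G *v (J *v Y))) $ i)"
    by (simp add: bil_matrix matrix_vector_mul_assoc matrix_mul_assoc)
  also have "\<dots> = (\<Sum>i\<in>UNIV. \<Sum>k\<in>UNIV. X $ i * (J $ k $ i * (G *v (J *v Y)) $ k))"
    by (simp add: tr sum_distrib_left)
  also have "\<dots> = (\<Sum>k\<in>UNIV. (J *v X) $ k * (G *v (J *v Y)) $ k)"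
    by (subst sum.swap) (simp add: matrix_vector_mult_def[of J X] sum_distrib_right sum_distrib_left algebra_simps)
  finally show ?thesis by (simp add: bil_matrix)
qed

lemma nondegenerate_eqI:
  assumes "nondegenerate G" "\<And>T. bil G T X = bil G T Y"
  shows "X = Y"
proof -
  have "G *v X = G *v Y"
    using assms(2) by (metis bil_axis_left vec_eq_iff)
  then show ?thesis
    using assms(1) matrix_inv_left unfolding nondegenerate_def
    by (metis matrix_vector_mul_assoc matrix_vector_mul_lid)
qed

lemma nondegenerate_eqI':
  assumes "nondegenerate G" "transpose G = G" "\<And>T. bil G X T = bil G Y T"
  shows "X = Y"
  using nondegenerate_eqI[OF assms(1)] bil_sym[OF assms(2)] assms(3) by metis

text \<open>Cramer's rule writes the inverse as a quotient of polynomials in the entries, which is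
  what makes the inverse metric, and with it the Christoffel symbols, holomorphic.\<close>

lemma matrix_inv_cramer:
  fixes A :: "complex^'n^'n"
  assumes "invertible A"
  shows "matrix_inv A $ k $ l = det (\<chi> i j. if j = k then (if i = l then 1 else 0) else A $ i $ j) / det A"
proof -
  have "A *v (matrix_inv A *v axis l 1) = axis l 1"
    using matrix_inv_right[OF assms] by (simp add: matrix_vector_mul_assoc)
  then have "matrix_inv A *v axis l 1 = (\<chi> k. det (\<chi> i j. if j = k then axis l 1 $ i else A $ i $ j) / det A)"
    using assms by (subst (asm) cramer) (auto simp: invertible_det_nz)
  moreover have "(matrix_inv A *v axis l 1) $ k = matrix_inv A $ k $ l"
    by (rule matrix_vector_axis)
  ultimately have "matrix_inv A $ k $ l = det (\<chi> i j. if j = k then axis l 1 $ i else A $ i $ j) / det A"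
    by simp
  moreover have "axis l 1 $ i = (if i = l then 1 else 0 :: complex)" for i by (simp add: axis_def)
  ultimately show ?thesis by (simp only:)
qed

lemma hol_on_det:
  fixes A :: "complex^'n \<Rightarrow> complex^'m^'m"
  assumes "\<And>i j. hol_on (\<lambda>y. A y $ i $ j) S"
  shows "hol_on (\<lambda>y. det (A y)) S"
  unfolding det_def by (intro hol_on_sum hol_on_mult hol_on_const hol_on_prod assms)

definition vlin :: "(complex^'n \<Rightarrow> complex^'m) \<Rightarrow> bool" where
  "vlin f \<longleftrightarrow> (\<forall>k. clin (\<lambda>u. f u $ k))"

lemma
  fixes f :: "complex^'n \<Rightarrow> complex^'m"
  assumes "vlin f"
  shows vlin_nth: "clin (\<lambda>u. f u $ k)"
    and vlin_add: "f (u + v) = f u + f v"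
    and vlin_scale: "f (c *s u) = c *s f u"
    and vlin_zero: "f 0 = 0"
    and vlin_minus: "f (- u) = - f u"
    and vlin_diff: "f (u - v) = f u - f v"
proof -
  show *: "clin (\<lambda>u. f u $ k)" for k using assms by (simp add: vlin_def)
  show "f (u + v) = f u + f v" "f (c *s u) = c *s f u" "f 0 = 0" "f (- u) = - f u" "f (u - v) = f u - f v"
    using clin_add[OF *] clin_scale[OF *] clin_zero[OF *] clin_minus[OF *] clin_diff[OF *]
    by (simp_all add: vec_eq_iff)
qed

lemma clin_compose: "clin f \<Longrightarrow> vlin g \<Longrightarrow> clin (\<lambda>u. f (g u))"
  by (auto intro!: clinI simp: clin_add clin_scale vlin_add vlin_scale)

lemma vlin_compose:
  fixes f :: "complex^'n \<Rightarrow> complex^'m"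
  assumes "vlin f" "vlin g"
  shows "vlin (\<lambda>u. f (g u))"
  unfolding vlin_def
proof
  fix k show "clin (\<lambda>u. f (g u) $ k)"
    by (rule clin_compose[OF vlin_nth[OF assms(1)] assms(2)])
qed

lemma clin_add_fun: "clin f \<Longrightarrow> clin g \<Longrightarrow> clin (\<lambda>u. f u + g u)"
  and clin_diff_fun: "clin f \<Longrightarrow> clin g \<Longrightarrow> clin (\<lambda>u. f u - g u)"
  and clin_minus_fun: "clin f \<Longrightarrow> clin (\<lambda>u. - f u)"
  and clin_mult_fun: "clin f \<Longrightarrow> clin (\<lambda>u. c * f u)"
  and clin_mult_fun': "clin f \<Longrightarrow> clin (\<lambda>u. f u * c)"
  and clin_sum_fun: "(\<And>i. clin (h i)) \<Longrightarrow> clin (\<lambda>u. \<Sum>i\<in>I. h i u)"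
  by (auto intro!: clinI simp: clin_add clin_scale algebra_simps sum.distrib sum_distrib_left)

lemmas clin_intros = clin_add_fun clin_diff_fun clin_minus_fun clin_mult_fun clin_mult_fun' clin_sum_fun

lemma vlin_add_fun: "vlin f \<Longrightarrow> vlin g \<Longrightarrow> vlin (\<lambda>u. f u + g u)"
  and vlin_diff_fun: "vlin f \<Longrightarrow> vlin g \<Longrightarrow> vlin (\<lambda>u. f u - g u)"
  and vlin_minus_fun: "vlin f \<Longrightarrow> vlin (\<lambda>u. - f u)"
  by (auto simp: vlin_def intro!: clin_intros)

lemmas vlin_intros = vlin_add_fun vlin_diff_fun vlin_minus_fun

lemma sum_rotate3:
  "(\<Sum>i\<in>A. \<Sum>j\<in>B. \<Sum>l\<in>C. f i j l) = (\<Sum>l\<in>C. \<Sum>i\<in>A. \<Sum>j\<in>B. f i j l)"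
proof -
  have "(\<Sum>i\<in>A. \<Sum>j\<in>B. \<Sum>l\<in>C. f i j l) = (\<Sum>i\<in>A. \<Sum>l\<in>C. \<Sum>j\<in>B. f i j l)"
    by (intro sum.cong refl sum.swap)
  also have "\<dots> = (\<Sum>l\<in>C. \<Sum>i\<in>A. \<Sum>j\<in>B. f i j l)" by (rule sum.swap)
  finally show ?thesis .
qed

section \<open>The Levi-Civita connection\<close>

text \<open>The Christoffel symbols as a bilinear map: on fields with constant components the
  derivative part of \<open>covd\<close> vanishes.\<close>

abbreviation gam :: "(complex^'n \<Rightarrow> complex^'n^'n) \<Rightarrow> complex^'n \<Rightarrow> complex^'n \<Rightarrow> complex^'n \<Rightarrow> complex^'n::finite" where
  "gam G x u v \<equiv> covd G (\<lambda>_. u) (\<lambda>_. v) x"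

abbreviation R4 :: "(complex^'n \<Rightarrow> complex^'n^'n) \<Rightarrow> complex^'n \<Rightarrow> complex^'n \<Rightarrow> complex^'n \<Rightarrow> complex^'n \<Rightarrow> complex^'n::finite \<Rightarrow> complex" where
  "R4 G x u v w t \<equiv> bil (G x) (curv G x u v w) t"

lemma gam_nth: "gam G x u v $ k = (\<Sum>i\<in>UNIV. \<Sum>j\<in>UNIV. christoffel G x k i j * u $ i * v $ j)"
  by (simp add: covd_def)

lemma covd_eq: "covd G (\<lambda>_. u) Y x = vdd Y u x + gam G x u (Y x)"
  by (simp add: covd_def vec_eq_iff)

lemma vlin_gam_left: "vlin (\<lambda>u. gam G x u v)" and vlin_gam_right: "vlin (\<lambda>v. gam G x u v)"
  unfolding vlin_def gam_nth by (auto intro!: clin_sum_fun clinI simp: algebra_simps)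

lemmas gam_simps = vlin_add[OF vlin_gam_left] vlin_scale[OF vlin_gam_left] vlin_zero[OF vlin_gam_left]
  vlin_minus[OF vlin_gam_left] vlin_diff[OF vlin_gam_left]
  vlin_add[OF vlin_gam_right] vlin_scale[OF vlin_gam_right] vlin_zero[OF vlin_gam_right]
  vlin_minus[OF vlin_gam_right] vlin_diff[OF vlin_gam_right]

text \<open>The dimension stays open because the same calculus is applied to the ambient metric on
  an open set of the 4-dimensional space and to the induced metric in dimension 3.\<close>

locale hol_metric =
  fixes U :: "(complex^'n::finite) set" and G :: "complex^'n \<Rightarrow> complex^'n^'n"
  assumes open_U: "open U"
    and sym_G: "x \<in> U \<Longrightarrow> transpose (G x) = G x"
    and nondeg_G: "x \<in> U \<Longrightarrow> nondegenerate (G x)"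
    and hol_G: "hol_on (\<lambda>y. G y $ i $ j) U"
begin

lemma bil_commute: "x \<in> U \<Longrightarrow> bil (G x) u v = bil (G x) v u"
  by (rule bil_sym[OF sym_G])

lemma hol_inv: "hol_on (\<lambda>y. matrix_inv (G y) $ k $ l) U"
proof (rule hol_on_cong[OF _ _ open_U])
  show "hol_on (\<lambda>y. det (\<chi> i j. if j = k then (if i = l then 1 else 0) else G y $ i $ j) / det (G y)) U"
  proof (rule hol_on_divide[OF hol_on_det hol_on_det])
    show "hol_on (\<lambda>y. (\<chi> i j. if j = k then (if i = l then 1 else 0) else G y $ i $ j) $ i $ j) U" for i j
      by (cases "j = k") (simp_all add: hol_on_const hol_G)
    show "hol_on (\<lambda>y. G y $ i $ j) U" for i j by (rule hol_G)
    show "x \<in> U \<Longrightarrow> det (G x) \<noteq> 0" for x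
      using nondeg_G by (simp add: nondegenerate_def invertible_det_nz)
  qed
qed (use nondeg_G in \<open>simp add: matrix_inv_cramer nondegenerate_def\<close>)

lemma hol_bil: "hol_on (\<lambda>y. bil (G y) a b) U"
  unfolding bil_def by (intro hol_on_sum hol_on_mult hol_on_const hol_G)

lemma vhol_gam: "vhol (\<lambda>y. gam G y u v) U"
  unfolding vhol_def gam_nth christoffel_def
  by (intro allI hol_on_sum hol_on_mult hol_on_const hol_inv hol_on_add hol_on_diff hol_on_dirderiv hol_G open_U)

lemma bil_inv_left:
  assumes x: "x \<in> U"
  shows "bil (G x) v (matrix_inv (G x) *v w) = (\<Sum>i\<in>UNIV. v $ i * w $ i)"
  using matrix_inv_right[of "G x"] nondeg_G[OF x]
  by (simp add: bil_matrix nondegenerate_def matrix_vector_mul_assoc)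

lemma bil_inv_axis: "x \<in> U \<Longrightarrow> bil (G x) v (matrix_inv (G x) *v axis k 1) = v $ k"
  by (simp add: bil_inv_left sum_axis)

text \<open>Both sides are linear in each of \<open>u\<close>, \<open>v\<close>, \<open>w\<close>.
  On basis vectors the formula is the definition of the Christoffel symbols with the upper index
  lowered.\<close>

lemma koszul:
  assumes x: "x \<in> U"
  shows "bil (G x) (gam G x u v) w = (1/2) * (dirderiv (\<lambda>y. bil (G y) v w) u x
      + dirderiv (\<lambda>y. bil (G y) u w) v x - dirderiv (\<lambda>y. bil (G y) u v) w x)"
proof -
  define D where "D u v w = dirderiv (\<lambda>y. bil (G y) v w) u x" for u v w
  have D: "clin (\<lambda>u. D u v w)" "clin (\<lambda>v. D u v w)" "clin (D u v)" for u v w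
    unfolding D_def
    by (rule clin_dirderiv[OF hol_bil x] clin_dirderiv_family[OF open_U x clin_bil_left hol_bil]
        clin_dirderiv_family[OF open_U x clin_bil_right hol_bil])+
  let ?L = "\<lambda>u v w. bil (G x) (gam G x u v) w" and ?R = "\<lambda>u v w. (1/2) * (D u v w + D v u w - D w u v)"
  have L: "clin (\<lambda>u. ?L u v w)" "clin (\<lambda>v. ?L u v w)" "clin (?L u v)" for u v w
    by (rule clin_compose[OF clin_bil_left vlin_gam_left] clin_compose[OF clin_bil_left vlin_gam_right]
        clin_bil_right)+
  have R: "clin (\<lambda>u. ?R u v w)" "clin (\<lambda>v. ?R u v w)" "clin (?R u v)" for u v w
    by (intro clin_intros D)+
  have 0: "?L (axis i 1) (axis j 1) (axis l 1) = ?R (axis i 1) (axis j 1) (axis l 1)" for i j l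
  proof -
    define E :: "complex^'n" where "E = (\<chi> m. D (axis i 1) (axis j 1) (axis m 1)
      + D (axis j 1) (axis i 1) (axis m 1) - D (axis m 1) (axis i 1) (axis j 1))"
    have "gam G x (axis i 1) (axis j 1) $ k = christoffel G x k i j" for k
      by (simp only: gam_nth sum_axis)
    then have "gam G x (axis i 1) (axis j 1) = (1/2) *s (matrix_inv (G x) *v E)"
      by (simp add: vec_eq_iff christoffel_def matrix_vector_mult_def E_def D_def bil_axis)
    then show ?thesis
      by (simp add: bil_simps bil_commute[OF x, of "matrix_inv (G x) *v E"] bil_inv_left[OF x] sum_axis)
         (simp add: E_def)
  qed
  have 1: "?L (axis i 1) (axis j 1) w = ?R (axis i 1) (axis j 1) w" for i j
    by (rule clin_ext[OF L(3) R(3) 0])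
  have 2: "?L (axis i 1) v w = ?R (axis i 1) v w" for i
    by (rule clin_ext[OF L(2) R(2) 1])
  have "?L u v w = ?R u v w"
    by (rule clin_ext[OF L(1) R(1) 2])
  then show ?thesis by (simp add: D_def)
qed

lemma bil_covd:
  assumes "vhol Y U" "vhol Z U" "x \<in> U"
  shows "hol_on (\<lambda>y. bil (G y) (Y y) (Z y)) U"
    and "dirderiv (\<lambda>y. bil (G y) (Y y) (Z y)) u x
      = bil (G x) (covd G (\<lambda>_. u) Y x) (Z x) + bil (G x) (Y x) (covd G (\<lambda>_. u) Z x)"
proof -
  \<comment> \<open>In the sum of the Koszul formulas for \<open>(u,v,w)\<close> and
    \<open>(u,w,v)\<close> the derivatives in the directions \<open>v\<close> and \<open>w\<close>
    cancel.\<close>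
  have metric: "dirderiv (\<lambda>y. bil (G y) v w) u x = bil (G x) (gam G x u v) w + bil (G x) v (gam G x u w)" for v w
  proof -
    have "dirderiv (\<lambda>y. bil (G y) a b) c x = dirderiv (\<lambda>y. bil (G y) b a) c x" for a b c
      by (rule dirderiv_cong[OF _ open_U \<open>x \<in> U\<close>]) (rule bil_commute)
    from this[of w v u] show ?thesis
      unfolding bil_commute[OF \<open>x \<in> U\<close>, of v "gam G x u w"] koszul[OF \<open>x \<in> U\<close>] by (simp add: field_simps)
  qed
  note bi = open_U clin_bil_left clin_bil_right hol_bil assms(1,2)
  show "hol_on (\<lambda>y. bil (G y) (Y y) (Z y)) U"
    by (rule hol_on_bilinear[where F = "\<lambda>y. bil (G y)", OF bi])
  show "dirderiv (\<lambda>y. bil (G y) (Y y) (Z y)) u x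
      = bil (G x) (covd G (\<lambda>_. u) Y x) (Z x) + bil (G x) (Y x) (covd G (\<lambda>_. u) Z x)"
    by (simp add: dirderiv_bilinear[where F = "\<lambda>y. bil (G y)", OF bi assms(3)] metric
        covd_eq[of _ _ Y] covd_eq[of _ _ Z] bil_simps)
qed

lemma gam_sym:
  assumes "x \<in> U"
  shows "gam G x u v = gam G x v u"
proof (rule nondegenerate_eqI'[OF nondeg_G[OF assms] sym_G[OF assms]])
  fix t
  have "dirderiv (\<lambda>y. bil (G y) u v) t x = dirderiv (\<lambda>y. bil (G y) v u) t x"
    by (rule dirderiv_cong[OF _ open_U assms]) (rule bil_commute)
  then show "bil (G x) (gam G x u v) t = bil (G x) (gam G x v u) t"
    by (simp add: koszul[OF assms])
qed

lemma gam_field: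
  assumes "vhol Y U"
  shows "vhol (\<lambda>y. gam G y v (Y y)) U"
    and "x \<in> U \<Longrightarrow> vdd (\<lambda>y. gam G y v (Y y)) u x = vdd (\<lambda>y. gam G y v (Y x)) u x + gam G x v (vdd Y u x)"
proof -
  have *: "hol_on (\<lambda>y. gam G y v (Y y) $ k) U"
    "x \<in> U \<Longrightarrow> dirderiv (\<lambda>y. gam G y v (Y y) $ k) u x = dirderiv (\<lambda>y. gam G y v (Y x) $ k) u x + gam G x v (vdd Y u x) $ k" for k x
    by (rule hol_on_clin[OF open_U vlin_nth[OF vlin_gam_right] vholD[OF vhol_gam] assms]
        dirderiv_clin[OF open_U vlin_nth[OF vlin_gam_right] vholD[OF vhol_gam] assms])+
  show "vhol (\<lambda>y. gam G y v (Y y)) U" using * by (simp add: vhol_def)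
  show "x \<in> U \<Longrightarrow> vdd (\<lambda>y. gam G y v (Y y)) u x = vdd (\<lambda>y. gam G y v (Y x)) u x + gam G x v (vdd Y u x)"
    using * by (simp add: vec_eq_iff)
qed

lemma covd_fun: "covd G (\<lambda>_. v) Y = (\<lambda>y. vdd Y v y + gam G y v (Y y))"
  by (rule ext) (rule covd_eq)

lemma vhol_covd: "vhol Y U \<Longrightarrow> vhol (covd G (\<lambda>_. v) Y) U"
  unfolding covd_fun[of v Y] using gam_field(1)[of Y v] vhol_vdd[OF _ open_U, of Y v]
  by (auto simp: vhol_def intro!: hol_on_add)

lemma vdd_add: "vhol Y U \<Longrightarrow> vhol Z U \<Longrightarrow> x \<in> U \<Longrightarrow> vdd (\<lambda>y. Y y + Z y) u x = vdd Y u x + vdd Z u x"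
  by (simp add: vec_eq_iff dirderiv_add[where S = U] vhol_def)

lemma vdd_diff: "vhol Y U \<Longrightarrow> vhol Z U \<Longrightarrow> x \<in> U \<Longrightarrow> vdd (\<lambda>y. Y y - Z y) u x = vdd Y u x - vdd Z u x"
  by (simp add: vec_eq_iff dirderiv_diff[where S = U] vhol_def)

lemma covd_covd:
  assumes Y: "vhol Y U" and x: "x \<in> U"
  shows "covd G (\<lambda>_. u) (covd G (\<lambda>_. v) Y) x = vdd (vdd Y v) u x + vdd (\<lambda>y. gam G y v (Y x)) u x
    + gam G x v (vdd Y u x) + gam G x u (vdd Y v x) + gam G x u (gam G x v (Y x))"
proof -
  have "covd G (\<lambda>_. u) (covd G (\<lambda>_. v) Y) x
      = vdd (\<lambda>y. vdd Y v y + gam G y v (Y y)) u x + gam G x u (vdd Y v x + gam G x v (Y x))"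
    unfolding covd_fun[of v Y] by (rule covd_eq)
  then show ?thesis
    by (simp add: vdd_add[OF vhol_vdd[OF Y open_U] gam_field(1)[OF Y] x] gam_field(2)[OF Y x] gam_simps)
qed

section \<open>The curvature tensor and its symmetries\<close>

lemma curv_eq:
  assumes "x \<in> U"
  shows "curv G x u v w = vdd (\<lambda>y. gam G y u w) v x + gam G x v (gam G x u w)
     - (vdd (\<lambda>y. gam G y v w) u x + gam G x u (gam G x v w))"
  by (simp add: curv_def covd_eq[of G u "covd G (\<lambda>_. v) (\<lambda>_. w)"] covd_eq[of G v "covd G (\<lambda>_. u) (\<lambda>_. w)"])

text \<open>Tensoriality in the third argument: \<open>curv\<close> is defined with constant fields,
  and for a holomorphic field the extra second derivatives cancel by symmetry. The second Bianchi
  identity applies this to a covariant derivative of a constant field.\<close>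

lemma curv_field:
  assumes "vhol Y U" "x \<in> U"
  shows "curv G x u v (Y x) = covd G (\<lambda>_. v) (covd G (\<lambda>_. u) Y) x - covd G (\<lambda>_. u) (covd G (\<lambda>_. v) Y) x"
proof -
  have "vdd (vdd Y v) u x = vdd (vdd Y u) v x"
    using assms dirderiv_commute[OF _ open_U assms(2)] by (simp add: vec_eq_iff vhol_def)
  then show ?thesis
    by (simp add: covd_covd[OF assms] curv_eq[OF assms(2)])
qed

lemma vlin_vdd: "vhol Y U \<Longrightarrow> x \<in> U \<Longrightarrow> vlin (\<lambda>u. vdd Y u x)"
  by (auto simp: vlin_def vhol_def intro: clin_dirderiv)

lemma vlin_vdd_gam:
  assumes "x \<in> U"
  shows "vlin (\<lambda>u. vdd (\<lambda>y. gam G y u w) v x)" "vlin (\<lambda>w. vdd (\<lambda>y. gam G y u w) v x)"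
  using assms
  by (auto simp: vlin_def gam_simps dirderiv_add[OF vholD vholD, OF vhol_gam vhol_gam]
      dirderiv_cmult[OF vholD, OF vhol_gam] intro!: clinI)

lemma vlin_curv:
  assumes x: "x \<in> U"
  shows "vlin (\<lambda>u. curv G x u v w)" "vlin (\<lambda>v. curv G x u v w)" "vlin (\<lambda>w. curv G x u v w)"
  unfolding curv_eq[OF x]
  by (intro vlin_intros vlin_vdd_gam x vlin_vdd vhol_gam vlin_gam_left vlin_gam_right
      vlin_compose[OF vlin_gam_right vlin_gam_left] vlin_compose[OF vlin_gam_right vlin_gam_right])+

lemma vhol_curv: "vhol (\<lambda>y. curv G y u v w) U"
proof -
  have "vhol (\<lambda>y. curv G y u v w) U \<longleftrightarrow> vhol (\<lambda>y. covd G (\<lambda>_. v) (covd G (\<lambda>_. u) (\<lambda>_. w)) y - covd G (\<lambda>_. u) (covd G (\<lambda>_. v) (\<lambda>_. w)) y) U"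
    by (simp add: curv_def)
  then show ?thesis using vhol_covd[OF vhol_covd[OF vhol_const]]
    by (simp add: vhol_def hol_on_diff)
qed

lemma curv_skew: "curv G x u v w = - curv G x v u w"
  by (simp add: curv_def)

lemma curv_bianchi1:
  assumes x: "x \<in> U"
  shows "curv G x u v w + curv G x v w u + curv G x w u v = 0"
proof -
  have "vdd (\<lambda>y. gam G y a b) c x = vdd (\<lambda>y. gam G y b a) c x" for a b c
    unfolding vec_eq_iff vdd_nth by (intro allI dirderiv_cong[OF _ open_U x]) (simp add: gam_sym)
  from this[of v u w] this[of w u v] this[of w v u] show ?thesis
    unfolding curv_eq[OF x] using gam_sym[OF x, of v u] gam_sym[OF x, of w u] gam_sym[OF x, of w v]
    by simp
qed

text \<open>The second derivatives of \<open>g(w,z)\<close> in the directions \<open>u\<close> and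
  \<open>v\<close> commute. After expanding them by metric compatibility the mixed products cancel,
  and the commutators of covariant derivatives remain.\<close>

lemma curv_compat:
  assumes x: "x \<in> U"
  shows "bil (G x) (curv G x u v w) z + bil (G x) w (curv G x u v z) = 0"
proof -
  have 1: "dirderiv (\<lambda>y. bil (G y) w z) a y = bil (G y) (gam G y a w) z + bil (G y) w (gam G y a z)" if "y \<in> U" for a y
    using bil_covd(2)[OF vhol_const vhol_const that, of w z a] by simp
  have 2: "dirderiv (dirderiv (\<lambda>y. bil (G y) w z) a) b x =
     bil (G x) (covd G (\<lambda>_. b) (\<lambda>y. gam G y a w) x) z + bil (G x) (gam G x a w) (gam G x b z)
     + (bil (G x) (gam G x b w) (gam G x a z) + bil (G x) w (covd G (\<lambda>_. b) (\<lambda>y. gam G y a z) x))" for a b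
  proof -
    have "dirderiv (dirderiv (\<lambda>y. bil (G y) w z) a) b x
        = dirderiv (\<lambda>y. bil (G y) (gam G y a w) z + bil (G y) w (gam G y a z)) b x"
      by (rule dirderiv_cong[OF _ open_U x]) (rule 1)
    also have "\<dots> = dirderiv (\<lambda>y. bil (G y) (gam G y a w) z) b x + dirderiv (\<lambda>y. bil (G y) w (gam G y a z)) b x"
      by (rule dirderiv_add[OF bil_covd(1) bil_covd(1) x]) (use vhol_gam x in auto)
    finally show ?thesis
      by (simp add: bil_covd(2)[OF vhol_gam vhol_const x] bil_covd(2)[OF vhol_const vhol_gam x])
  qed
  have "dirderiv (dirderiv (\<lambda>y. bil (G y) w z) v) u x = dirderiv (dirderiv (\<lambda>y. bil (G y) w z) u) v x"
    by (rule dirderiv_commute[OF hol_bil open_U x])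
  then show ?thesis unfolding 2 curv_def by (simp add: bil_simps algebra_simps)
qed

lemma R4_clin:
  assumes x: "x \<in> U"
  shows "clin (\<lambda>u. R4 G x u v w t)" "clin (\<lambda>v. R4 G x u v w t)" "clin (\<lambda>w. R4 G x u v w t)" "clin (\<lambda>t. R4 G x u v w t)"
  by (intro clin_compose[OF clin_bil_left] vlin_curv x clin_bil_right)+

lemma R4_skew12: "R4 G x u v w t = - R4 G x v u w t"
  using curv_skew[of x u v w] by (simp add: bil_simps)

lemma R4_skew34: "x \<in> U \<Longrightarrow> R4 G x u v w t = - R4 G x u v t w"
  using curv_compat[of x u v w t] bil_commute[of x w] by (simp add: add_eq_0_iff)

lemma R4_bianchi1: "x \<in> U \<Longrightarrow> R4 G x u v w t + R4 G x v w u t + R4 G x w u v t = 0"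
  using curv_bianchi1[of x u v w] by (metis bil_add_left bil_zero_left)

text \<open>The octahedron argument: the cyclic identities obtained by rotating
  \<open>(u,v,w,t)\<close> are added up with the two skew symmetries.\<close>

lemma R4_pair:
  assumes x: "x \<in> U"
  shows "R4 G x u v w t = R4 G x w t u v"
proof -
  have "R4 G x v w t u = - R4 G x v w u t" "R4 G x w t v u = - R4 G x w t u v"
      "R4 G x t u w v = - R4 G x t u v w" "R4 G x u v t w = - R4 G x u v w t"
    by (rule R4_skew34[OF x])+
  moreover have "R4 G x t v w u = R4 G x v t u w" "R4 G x u w t v = R4 G x w u v t"
    by (metis R4_skew12 R4_skew34[OF x] minus_minus)+
  ultimately have "2 * R4 G x u v w t = 2 * R4 G x w t u v"
    using R4_bianchi1[OF x, of u v w t] R4_bianchi1[OF x, of v w t u]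
      R4_bianchi1[OF x, of w t u v] R4_bianchi1[OF x, of t u v w]
    by algebra
  then show ?thesis by simp
qed

definition covd_curv :: "complex^'n \<Rightarrow> complex^'n \<Rightarrow> complex^'n \<Rightarrow> complex^'n \<Rightarrow> complex^'n \<Rightarrow> complex^'n" where
  "covd_curv x u v w z = covd G (\<lambda>_. u) (\<lambda>y. curv G y v w z) x - curv G x (gam G x u v) w z
     - curv G x v (gam G x u w) z - curv G x v w (gam G x u z)"

lemma covd_diff:
  assumes "vhol Y U" "vhol Z U" "x \<in> U"
  shows "covd G (\<lambda>_. u) (\<lambda>y. Y y - Z y) x = covd G (\<lambda>_. u) Y x - covd G (\<lambda>_. u) Z x"
  by (simp add: covd_eq[of G u Y] covd_eq[of G u Z] covd_eq[of G u "\<lambda>y. Y y - Z y"] vdd_diff[OF assms] gam_simps)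

text \<open>For constant \<open>u, v, w\<close> this is the Jacobi identity for the operators \<open>\<nabla>\<^sub>u, \<nabla>\<^sub>v, \<nabla>\<^sub>w\<close>.\<close>

lemma curv_bianchi2:
  assumes x: "x \<in> U"
  shows "covd_curv x u v w z + covd_curv x v w u z + covd_curv x w u v z = 0"
proof -
  let ?N = "\<lambda>u. covd G (\<lambda>_. u)"
  have vh: "vhol (?N b (?N a (\<lambda>_. z))) U" "vhol (?N a (\<lambda>_. z)) U" for a b
    by (intro vhol_covd vhol_const)+
  have c: "?N a (\<lambda>y. curv G y b c z) x = ?N a (?N c (?N b (\<lambda>_. z))) x - ?N a (?N b (?N c (\<lambda>_. z))) x" for a b c
  proof -
    have "(\<lambda>y. curv G y b c z) = (\<lambda>y. ?N c (?N b (\<lambda>_. z)) y - ?N b (?N c (\<lambda>_. z)) y)"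
      by (simp add: curv_def fun_eq_iff)
    then show ?thesis by (simp add: covd_diff[OF vh(1) vh(1) x])
  qed
  have d: "curv G x b c (gam G x a z) = ?N c (?N b (?N a (\<lambda>_. z))) x - ?N b (?N c (?N a (\<lambda>_. z))) x" for a b c
    by (rule curv_field[OF vh(2) x])
  have s: "curv G x (gam G x a b) c z = - curv G x c (gam G x b a) z" for a b c
    by (metis curv_skew gam_sym[OF x])
  show ?thesis
    unfolding covd_curv_def c d s by simp
qed

lemma covd_curv_R4:
  assumes x: "x \<in> U"
  shows "bil (G x) (covd_curv x u v w z) t = dirderiv (\<lambda>y. R4 G y v w z t) u x - R4 G x (gam G x u v) w z t
    - R4 G x v (gam G x u w) z t - R4 G x v w (gam G x u z) t - R4 G x v w z (gam G x u t)"
  using bil_covd(2)[OF vhol_curv vhol_const x, of v w z t u]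
  by (simp add: covd_curv_def bil_simps)

lemma hol_R4: "hol_on (\<lambda>y. R4 G y u v w t) U"
  using hol_on_clin[OF open_U clin_bil_left hol_bil vhol_curv] .

end

section \<open>Traces in orthonormal frames\<close>

text \<open>If \<open>E\<close> has the columns \<open>e k\<close>, orthonormality reads
  \<open>transpose E ** G ** E = mat 1\<close>. One-sided inverses of square matrices are two-sided,
  so \<open>E ** transpose E\<close> is the inverse of \<open>G\<close>.\<close>

lemma
  assumes "orthonormal G e"
  shows onb_expand: "(v :: complex^'n) = (\<Sum>k\<in>UNIV. bil G (e k) v *s e k)"
    and onb_inv: "matrix_inv G $ i $ j = (\<Sum>k\<in>UNIV. e k $ i * e k $ j)"
proof -
  define E :: "complex^'n^'n" where "E = (\<chi> i k. e k $ i)"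
  have Ek: "E *v axis k 1 = e k" for k
    by (simp add: vec_eq_iff matrix_vector_axis E_def)
  have "(transpose E ** G ** E) $ k $ l = mat 1 $ k $ l" for k l
    using assms bil_congruence[of E G "axis k 1" "axis l 1"]
    by (simp add: bil_axis Ek orthonormal_def mat_def)
  then have "transpose E ** G ** E = mat 1" by (simp add: vec_eq_iff)
  then have 1: "E ** (transpose E ** G) = mat 1" by (rule iffD1[OF matrix_left_right_inverse])
  have "v = E *v (transpose E *v (G *v v))"
    using 1 by (metis matrix_vector_mul_assoc matrix_vector_mul_lid)
  also have "\<dots> = (\<Sum>k\<in>UNIV. bil G (e k) v *s e k)"
  proof -
    have "(E *v (transpose E *v w)) $ i = (\<Sum>k\<in>UNIV. (\<Sum>j\<in>UNIV. e k $ j * w $ j) * e k $ i)" for w i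
      unfolding E_def matrix_vector_mult_def transpose_def by (simp add: mult.commute)
    then show ?thesis by (simp add: vec_eq_iff bil_matrix)
  qed
  finally show "v = (\<Sum>k\<in>UNIV. bil G (e k) v *s e k)" .
  have "(E ** transpose E) ** G = mat 1" using 1 by (simp only: matrix_mul_assoc)
  then have "G ** (E ** transpose E) = mat 1" by (rule iffD1[OF matrix_left_right_inverse])
  then have "matrix_inv G = E ** transpose E" by (rule matrix_inv_unique)
  then show "matrix_inv G $ i $ j = (\<Sum>k\<in>UNIV. e k $ i * e k $ j)"
    by (simp add: matrix_matrix_mult_def transpose_def E_def)
qed

lemma onb_sum_left:
  assumes "orthonormal G e" "clin f"
  shows "(\<Sum>k\<in>UNIV. bil G (e k) v * f (e k)) = f v"
proof -
  have "f v = f (\<Sum>k\<in>UNIV. bil G (e k) v *s e k)" using onb_expand[OF assms(1), of v] by simp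
  also have "\<dots> = (\<Sum>k\<in>UNIV. bil G (e k) v * f (e k))"
    by (simp add: clin_sum[OF assms(2)] clin_scale[OF assms(2)])
  finally show ?thesis ..
qed

lemma onb_trace_bilinear:
  assumes "orthonormal G e" "\<And>v. clin (\<lambda>u. F u v)" "\<And>u. clin (F u)"
  shows "(\<Sum>i\<in>UNIV. \<Sum>j\<in>UNIV. matrix_inv G $ i $ j * F (axis i 1) (axis j 1)) = (\<Sum>k\<in>UNIV. F (e k) (e k))"
proof -
  have "F u v = (\<Sum>i\<in>UNIV. \<Sum>j\<in>UNIV. u $ i * v $ j * F (axis i 1) (axis j 1))" for u v
  proof -
    have "F u v = (\<Sum>i\<in>UNIV. u $ i * F (axis i 1) v)" by (rule clin_expand[OF assms(2)])
    also have "\<dots> = (\<Sum>i\<in>UNIV. u $ i * (\<Sum>j\<in>UNIV. v $ j * F (axis i 1) (axis j 1)))"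
      by (subst clin_expand[OF assms(3), of _ v]) (rule refl)
    finally show ?thesis by (simp add: sum_distrib_left mult.assoc)
  qed
  from this[of "e _" "e _"] have "(\<Sum>k\<in>UNIV. F (e k) (e k)) = (\<Sum>k\<in>UNIV. \<Sum>i\<in>UNIV. \<Sum>j\<in>UNIV. e k $ i * e k $ j * F (axis i 1) (axis j 1))"
    by (rule sum.cong[OF refl])
  also have "\<dots> = (\<Sum>i\<in>UNIV. \<Sum>j\<in>UNIV. \<Sum>k\<in>UNIV. e k $ i * e k $ j * F (axis i 1) (axis j 1))"
    by (rule sum_rotate3[symmetric])
  finally show ?thesis by (simp add: onb_inv[OF assms(1)] sum_distrib_right)
qed

lemma onb_trace:
  assumes "orthonormal G e" "transpose G = G" "vlin f"
  shows "(\<Sum>i\<in>UNIV. f (axis i 1) $ i) = (\<Sum>k\<in>UNIV. bil G (f (e k)) (e k))"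
proof -
  have "(\<Sum>k\<in>UNIV. bil G (f (e k)) (e k)) = (\<Sum>k\<in>UNIV. \<Sum>i\<in>UNIV. f (e k) $ i * bil G (e k) (axis i 1))"
  proof -
    have "bil G (f (e k)) (e k) = (\<Sum>i\<in>UNIV. f (e k) $ i * bil G (e k) (axis i 1))" for k
      unfolding bil_matrix[of G "f (e k)"] bil_axis_left[symmetric] by (simp only: bil_sym[OF assms(2)])
    then show ?thesis by simp
  qed
  also have "\<dots> = (\<Sum>i\<in>UNIV. \<Sum>k\<in>UNIV. bil G (e k) (axis i 1) * f (e k) $ i)"
    by (subst sum.swap) (simp add: mult.commute)
  also have "\<dots> = (\<Sum>i\<in>UNIV. f (axis i 1) $ i)"
    by (simp add: onb_sum_left[OF assms(1) vlin_nth[OF assms(3)]])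
  finally show ?thesis ..
qed

section \<open>The Weyl tensor\<close>

text \<open>Frames are required at single points only, with no dependence on the point. In dimension
  4 they are supplied by the Hodge operator, on the hypersurface by the tangent part of an adapted
  frame. The bound on the dimension keeps the denominators in \<open>nricci\<close> away from
  zero.\<close>

locale framed_metric = hol_metric U G for U :: "(complex^'n::finite) set" and G +
  assumes frame: "x \<in> U \<Longrightarrow> \<exists>e. orthonormal (G x) e"
    and dim_ge_3: "CARD('n) \<ge> 3"
begin

lemma ricci_frame:
  assumes "x \<in> U" "orthonormal (G x) e"
  shows "ricci G x u w = (\<Sum>k\<in>UNIV. R4 G x u (e k) w (e k))"
  unfolding ricci_def by (rule onb_trace[OF assms(2) sym_G vlin_curv(2)]) (use assms in auto)

lemma ricci_clin: "x \<in> U \<Longrightarrow> clin (\<lambda>u. ricci G x u w)" "x \<in> U \<Longrightarrow> clin (ricci G x u)"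
  unfolding ricci_def by (intro clin_sum_fun vlin_nth vlin_curv; assumption)+

lemma ricci_sym: "x \<in> U \<Longrightarrow> ricci G x u w = ricci G x w u"
  using frame[of x] by (metis (no_types, lifting) R4_pair ricci_frame sum.cong)

lemma scal_frame:
  assumes "x \<in> U" "orthonormal (G x) e"
  shows "scal G x = (\<Sum>k\<in>UNIV. ricci G x (e k) (e k))"
  unfolding scal_def by (rule onb_trace_bilinear[OF assms(2)]) (use ricci_clin assms in auto)

lemma hol_ricci: "hol_on (\<lambda>y. ricci G y u w) U"
  unfolding ricci_def by (intro hol_on_sum vholD[OF vhol_curv])

lemma hol_scal: "hol_on (scal G) U"
  unfolding scal_def[abs_def] by (intro hol_on_sum hol_on_mult hol_inv hol_ricci)

lemma nricci_sym: "x \<in> U \<Longrightarrow> nricci G x u w = nricci G x w u"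
  by (simp add: nricci_def ricci0_def ricci_sym[of x u w] bil_commute[of x u w])

lemma nricci_clin:
  assumes "x \<in> U"
  shows "clin (\<lambda>u. nricci G x u w)" "clin (nricci G x u)"
  unfolding nricci_def ricci0_def
  by (intro clin_intros ricci_clin assms clin_bil_left clin_bil_right)+

lemma hol_nricci: "hol_on (\<lambda>y. nricci G y u w) U"
  unfolding nricci_def ricci0_def
  by (intro hol_on_add hol_on_diff hol_on_mult hol_on_const hol_scal hol_bil hol_ricci hol_on_divide) auto

lemma hol_susp: "hol_on (\<lambda>y. susp G y X Y Z T) U"
  unfolding susp_def by (intro hol_on_add hol_on_diff hol_on_mult hol_nricci hol_bil)

lemma hol_weyl: "hol_on (\<lambda>y. weyl G y X Y Z T) U"
  unfolding weyl_def by (intro hol_on_diff hol_R4 hol_susp)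

lemma weyl_clin:
  assumes "x \<in> U"
  shows "clin (\<lambda>X. weyl G x X Y Z T)" "clin (\<lambda>Y. weyl G x X Y Z T)"
    "clin (\<lambda>Z. weyl G x X Y Z T)" "clin (\<lambda>T. weyl G x X Y Z T)"
  unfolding weyl_def susp_def
  by (intro clin_intros R4_clin nricci_clin assms clin_bil_left clin_bil_right)+

lemma weyl_skew12: "weyl G x X Y Z T = - weyl G x Y X Z T"
  using R4_skew12[of x X Y Z T] by (simp add: weyl_def susp_def)

lemma weyl_skew34: "x \<in> U \<Longrightarrow> weyl G x X Y Z T = - weyl G x X Y T Z"
  using R4_skew34[of x X Y Z T] by (simp add: weyl_def susp_def)

lemma weyl_pair: "x \<in> U \<Longrightarrow> weyl G x X Y Z T = weyl G x Z T X Y"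
  using R4_pair[of x X Y Z T] nricci_sym[of x] bil_commute[of x] by (simp add: weyl_def susp_def)

lemma weyl_bianchi: "x \<in> U \<Longrightarrow> weyl G x X Y Z T + weyl G x Y Z X T + weyl G x Z X Y T = 0"
  using R4_bianchi1[of x X Y Z T] nricci_sym[of x] bil_commute[of x]
  by (simp add: weyl_def susp_def algebra_simps)

text \<open>The contraction of \<open>h \<and> I\<close> is \<open>(n - 2) h + tr(h) g\<close> with
  \<open>tr(h) = Scal / (2 (n - 1))\<close>; the coefficients in \<open>nricci\<close> are those for
  which this is the Ricci tensor.\<close>

lemma weyl_trace:
  assumes x: "x \<in> U" and e: "orthonormal (G x) e"
  shows "(\<Sum>k\<in>UNIV. weyl G x X (e k) Z (e k)) = 0"
proof -
  define n where "n = (of_nat CARD('n) :: complex)"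
  have n: "n \<noteq> 0" "n - 1 \<noteq> 0" "n - 2 \<noteq> 0"
  proof -
    have "real CARD('n) \<ge> 3" using dim_ge_3 by simp
    then show "n \<noteq> 0" "n - 1 \<noteq> 0" "n - 2 \<noteq> 0"
      unfolding n_def by (auto simp: complex_eq_iff)
  qed
  let ?h = "nricci G x" and ?g = "bil (G x)"
  have e1: "?g (e k) (e k) = 1" for k using e by (simp add: orthonormal_def)
  have "(\<Sum>k\<in>UNIV. susp G x X (e k) Z (e k))
      = n * ?h X Z + (\<Sum>k\<in>UNIV. ?h (e k) (e k)) * ?g X Z
        - (\<Sum>k\<in>UNIV. ?g (e k) Z * ?h X (e k)) - (\<Sum>k\<in>UNIV. ?g (e k) X * ?h (e k) Z)"
    by (simp add: susp_def e1 sum.distrib sum_subtractf sum_distrib_left sum_distrib_right n_def bil_commute[OF x, of X] mult.commute)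
  also have "(\<Sum>k\<in>UNIV. ?g (e k) Z * ?h X (e k)) = ?h X Z"
    by (rule onb_sum_left[OF e nricci_clin(2)[OF x]])
  also have "(\<Sum>k\<in>UNIV. ?g (e k) X * ?h (e k) Z) = ?h X Z"
    by (rule onb_sum_left[OF e nricci_clin(1)[OF x]])
  also have "(\<Sum>k\<in>UNIV. ?h (e k) (e k)) = scal G x / (2 * (n - 1))"
  proof -
    have "(\<Sum>k\<in>UNIV. ?h (e k) (e k)) = n * (1 / (2 * n * (n - 1)) * scal G x)
        + 1 / (n - 2) * (scal G x - n * (scal G x / n))"
      by (simp add: nricci_def ricci0_def e1 sum.distrib sum_subtractf sum_distrib_left[symmetric]
          sum_divide_distrib[symmetric] scal_frame[OF x e] n_def[symmetric])
    then show ?thesis using n by simp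
  qed
  also have "n * ?h X Z + scal G x / (2 * (n - 1)) * ?g X Z - ?h X Z - ?h X Z = ricci G x X Z"
  proof -
    have "(n - 2) * ?h X Z = (n - 2) * (1 / (2 * n * (n - 1)) * scal G x * ?g X Z) + ricci G x X Z - scal G x / n * ?g X Z"
      using n by (simp add: nricci_def ricci0_def n_def[symmetric] distrib_left)
    moreover have "(n - 2) * (1 / (2 * n * (n - 1)) * s * g) - s / n * g + s / (2 * (n - 1)) * g = 0" for s g
      using n by (simp add: divide_simps) (simp add: algebra_simps)
    moreover have "n * h + c - h - h = r" if "(n - 2) * h = a + r - b" "a - b + c = 0" for a b c h r
      using that by algebra
    ultimately show ?thesis by blast
  qed
  finally show ?thesis
    by (simp add: weyl_def sum_subtractf ricci_frame[OF x e])
qed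

text \<open>The covariant derivative of \<open>h \<and> I\<close>; as the metric is parallel, only
  \<open>h\<close> is differentiated.\<close>

definition dsusp :: "complex^'n \<Rightarrow> complex^'n \<Rightarrow> complex^'n \<Rightarrow> complex^'n \<Rightarrow> complex^'n \<Rightarrow> complex^'n \<Rightarrow> complex" where
  "dsusp x u X Y Z T = covd_nricci G x u X Z * bil (G x) Y T + covd_nricci G x u Y T * bil (G x) X Z
    - covd_nricci G x u X T * bil (G x) Y Z - covd_nricci G x u Y Z * bil (G x) X T"

lemma dirderiv_bil:
  "x \<in> U \<Longrightarrow> dirderiv (\<lambda>y. bil (G y) v w) u x = bil (G x) (gam G x u v) w + bil (G x) v (gam G x u w)"
  using bil_covd(2)[OF vhol_const vhol_const, of x v w u] .

lemma dirderiv_susp: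
  assumes x: "x \<in> U"
  shows "dirderiv (\<lambda>y. susp G y X Y Z T) u x = dsusp x u X Y Z T + susp G x (gam G x u X) Y Z T
    + susp G x X (gam G x u Y) Z T + susp G x X Y (gam G x u Z) T + susp G x X Y Z (gam G x u T)"
proof -
  have p: "hol_on (\<lambda>y. nricci G y A B * bil (G y) C D) U" for A B C D
    by (intro hol_on_mult hol_nricci hol_bil)
  have d: "dirderiv (\<lambda>y. nricci G y A B * bil (G y) C D) u x
     = (covd_nricci G x u A B + nricci G x (gam G x u A) B + nricci G x A (gam G x u B)) * bil (G x) C D
       + nricci G x A B * (bil (G x) (gam G x u C) D + bil (G x) C (gam G x u D))" for A B C D
    by (simp add: dirderiv_mult[OF hol_nricci hol_bil x] dirderiv_bil[OF x] covd_nricci_def)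
  have "dirderiv (\<lambda>y. susp G y X Y Z T) u x
     = dirderiv (\<lambda>y. nricci G y X Z * bil (G y) Y T) u x + dirderiv (\<lambda>y. nricci G y Y T * bil (G y) X Z) u x
     - dirderiv (\<lambda>y. nricci G y X T * bil (G y) Y Z) u x - dirderiv (\<lambda>y. nricci G y Y Z * bil (G y) X T) u x"
    unfolding susp_def
    by (simp add: dirderiv_add[OF p p x] dirderiv_diff[OF hol_on_diff[OF hol_on_add[OF p p] p] p x]
        dirderiv_diff[OF hol_on_add[OF p p] p x])
  also have "\<dots> = dsusp x u X Y Z T + susp G x (gam G x u X) Y Z T
    + susp G x X (gam G x u Y) Z T + susp G x X Y (gam G x u Z) T + susp G x X Y Z (gam G x u T)"
    unfolding d dsusp_def susp_def by (simp add: algebra_simps)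
  finally show ?thesis .
qed

text \<open>Where \<open>W = 0\<close> the Christoffel corrections in \<open>\<nabla>W\<close>
  vanish, so \<open>B\<close> consists of the components of \<open>\<nabla>R\<close> and the second
  Bianchi identity applies.\<close>

lemma bianchi2_weyl_zero:
  assumes x: "x \<in> U" and W0: "\<And>X Y Z T. weyl G x X Y Z T = 0"
  defines "B \<equiv> \<lambda>u X Y Z T. dirderiv (\<lambda>y. weyl G y X Y Z T) u x + dsusp x u X Y Z T"
  shows "B u X Y Z T + B X Y u Z T + B Y u X Z T = 0"
proof -
  have R: "R4 G x X Y Z T = susp G x X Y Z T" for X Y Z T using W0[of X Y Z T] by (simp add: weyl_def)
  have "dirderiv (\<lambda>y. weyl G y X Y Z T) u x = dirderiv (\<lambda>y. R4 G y X Y Z T) u x - dirderiv (\<lambda>y. susp G y X Y Z T) u x" for u X Y Z T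
    unfolding weyl_def by (rule dirderiv_diff[OF hol_R4 hol_susp x])
  then have "B u X Y Z T = bil (G x) (covd_curv x u X Y Z) T" for u X Y Z T
    unfolding covd_curv_R4[OF x] B_def R by (simp add: dirderiv_susp[OF x])
  then show ?thesis
    using curv_bianchi2[OF x, of u X Y Z] by (metis bil_add_left bil_zero_left)
qed

end

section \<open>Change of coordinates\<close>

text \<open>Here \<open>\<phi>\<close> is a local isometry. The vanishing of \<open>W\<close> is
  obtained in slice charts but claimed in every chart of the atlas, and this setting carries it
  over.\<close>

locale coordinate_change = M: framed_metric U G + M': framed_metric U' G'
  for U U' :: "(complex^'n::finite) set" and G G' +
  fixes \<phi> :: "complex^'n \<Rightarrow> complex^'n"
  assumes hol_\<phi>: "vhol \<phi> U'"
    and map_\<phi>: "y \<in> U' \<Longrightarrow> \<phi> y \<in> U"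
    and pullback: "y \<in> U' \<Longrightarrow> bil (G' y) u v = bil (G (\<phi> y)) (vdd \<phi> u y) (vdd \<phi> v y)"
begin

abbreviation "D2 x u v \<equiv> vdd (vdd \<phi> v) u x"

lemma vlin_d\<phi>: "y \<in> U' \<Longrightarrow> vlin (\<lambda>u. vdd \<phi> u y)"
  by (rule M'.vlin_vdd[OF hol_\<phi>])

lemma vhol_d\<phi>: "vhol (vdd \<phi> u) U'"
  by (rule vhol_vdd[OF hol_\<phi> M'.open_U])

lemma D2_sym: "x \<in> U' \<Longrightarrow> D2 x u v = D2 x v u"
  using hol_\<phi> dirderiv_commute[OF _ M'.open_U] by (simp add: vec_eq_iff vhol_def)

lemma inj_d\<phi>:
  assumes "y \<in> U'" "vdd \<phi> u y = vdd \<phi> v y"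
  shows "u = v"
  by (rule nondegenerate_eqI'[OF M'.nondeg_G[OF assms(1)] M'.sym_G[OF assms(1)]])
     (simp add: pullback assms)

lemma surj_d\<phi>:
  assumes "y \<in> U'"
  shows "\<exists>u. vdd \<phi> u y = v"
proof -
  define E :: "complex^'n^'n" where "E = (\<chi> i j. vdd \<phi> (axis j 1) y $ i)"
  have J: "E *v u = vdd \<phi> u y" for u
    using clin_expand[OF vlin_nth[OF vlin_d\<phi>[OF assms]], of u]
    by (simp add: E_def vec_eq_iff matrix_vector_mult_def mult.commute)
  have "inj ((*v) E)" using inj_d\<phi>[OF assms] by (auto simp: J inj_def)
  then obtain B where "B ** E = mat 1" using matrix_left_invertible_injective by blast
  then have "E ** B = mat 1" by (rule iffD1[OF matrix_left_right_inverse])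
  then have "E *v (B *v v) = v" by (simp add: matrix_vector_mul_assoc)
  then show ?thesis unfolding J by blast
qed

text \<open>Comparison of the two Koszul formulas, tested against the vectors
  \<open>vdd \<phi> w x\<close>, which exhaust the space. The second derivative of
  \<open>\<phi>\<close> is the usual inhomogeneous term.\<close>

lemma gam_transform:
  assumes x: "x \<in> U'"
  shows "vdd \<phi> (gam G' x u v) x = D2 x u v + gam G (\<phi> x) (vdd \<phi> u x) (vdd \<phi> v x)"
proof (rule nondegenerate_eqI'[OF M.nondeg_G[OF map_\<phi>[OF x]] M.sym_G[OF map_\<phi>[OF x]]])
  note px = map_\<phi>[OF x]
  have hb: "hol_on (\<lambda>y. bil (G (\<phi> y)) a b) U'"
    "dirderiv (\<lambda>y. bil (G (\<phi> y)) a b) w x = dirderiv (\<lambda>y. bil (G y) a b) (vdd \<phi> w x) (\<phi> x)" for a b w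
    by (rule hol_on_compose(1)[OF M.hol_bil hol_\<phi> map_\<phi>], assumption)
       (rule hol_on_compose(2)[OF M.hol_bil hol_\<phi> map_\<phi> x], assumption)
  have d: "dirderiv (\<lambda>y. bil (G' y) a b) w x = dirderiv (\<lambda>y. bil (G y) (vdd \<phi> a x) (vdd \<phi> b x)) (vdd \<phi> w x) (\<phi> x)
     + bil (G (\<phi> x)) (D2 x w a) (vdd \<phi> b x) + bil (G (\<phi> x)) (vdd \<phi> a x) (D2 x w b)" for a b w
  proof -
    have "dirderiv (\<lambda>y. bil (G' y) a b) w x = dirderiv (\<lambda>y. bil (G (\<phi> y)) (vdd \<phi> a y) (vdd \<phi> b y)) w x"
      by (rule dirderiv_cong[OF _ M'.open_U x]) (rule pullback)
    also have "\<dots> = dirderiv (\<lambda>y. bil (G (\<phi> y)) (vdd \<phi> a x) (vdd \<phi> b x)) w x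
      + bil (G (\<phi> x)) (D2 x w a) (vdd \<phi> b x) + bil (G (\<phi> x)) (vdd \<phi> a x) (D2 x w b)"
      by (rule dirderiv_bilinear[OF M'.open_U clin_bil_left clin_bil_right hb(1) vhol_d\<phi> vhol_d\<phi> x])
    finally show ?thesis by (simp add: hb(2))
  qed
  fix t
  obtain w where w: "t = vdd \<phi> w x" using surj_d\<phi>[OF x] by metis
  have "bil (G (\<phi> x)) (vdd \<phi> (gam G' x u v) x) t = bil (G' x) (gam G' x u v) w"
    by (simp add: pullback[OF x] w)
  also have "\<dots> = bil (G (\<phi> x)) (gam G (\<phi> x) (vdd \<phi> u x) (vdd \<phi> v x)) t + bil (G (\<phi> x)) (D2 x u v) t"
    unfolding M'.koszul[OF x] M.koszul[OF px] d w
    using D2_sym[OF x, of w u] D2_sym[OF x, of w v] D2_sym[OF x, of v u]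
    by (simp add: M.bil_commute[OF px] field_simps)
  finally show "bil (G (\<phi> x)) (vdd \<phi> (gam G' x u v) x) t
      = bil (G (\<phi> x)) (D2 x u v + gam G (\<phi> x) (vdd \<phi> u x) (vdd \<phi> v x)) t"
    by (simp add: bil_simps)
qed

text \<open>This is \<open>gam_transform\<close> differentiated in the direction
  \<open>u\<close>.\<close>

lemma vdd_gam_transform:
  assumes x: "x \<in> U'"
  shows "D2 x u (gam G' x v w) + vdd \<phi> (vdd (\<lambda>y. gam G' y v w) u x) x
    = vdd (vdd (vdd \<phi> w) v) u x + vdd (\<lambda>y. gam G y (vdd \<phi> v x) (vdd \<phi> w x)) (vdd \<phi> u x) (\<phi> x)
      + gam G (\<phi> x) (D2 x u v) (vdd \<phi> w x) + gam G (\<phi> x) (vdd \<phi> v x) (D2 x u w)"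
  unfolding vec_eq_iff
proof
  fix k
  have hg: "hol_on (\<lambda>y. gam G (\<phi> y) a b $ k) U'"
    "dirderiv (\<lambda>y. gam G (\<phi> y) a b $ k) u x = dirderiv (\<lambda>y. gam G y a b $ k) (vdd \<phi> u x) (\<phi> x)" for a b
    by (rule hol_on_compose(1)[OF vholD[OF M.vhol_gam] hol_\<phi> map_\<phi>], assumption)
       (rule hol_on_compose(2)[OF vholD[OF M.vhol_gam] hol_\<phi> map_\<phi> x], assumption)
  note bi = M'.open_U vlin_nth[OF vlin_gam_left] vlin_nth[OF vlin_gam_right] hg(1) vhol_d\<phi> vhol_d\<phi>
  have 1: "dirderiv (\<lambda>y. vdd \<phi> (gam G' y v w) y $ k) u x
      = dirderiv (\<lambda>y. vdd \<phi> (gam G' x v w) y $ k) u x + vdd \<phi> (vdd (\<lambda>y. gam G' y v w) u x) x $ k"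
    by (rule dirderiv_clin[OF M'.open_U vlin_nth[OF vlin_d\<phi>] vholD[OF vhol_d\<phi>] M'.vhol_gam x])
  have "dirderiv (\<lambda>y. vdd \<phi> (gam G' y v w) y $ k) u x
      = dirderiv (\<lambda>y. D2 y v w $ k + gam G (\<phi> y) (vdd \<phi> v y) (vdd \<phi> w y) $ k) u x"
    by (rule dirderiv_cong[OF _ M'.open_U x]) (simp add: gam_transform del: vdd_nth)
  also have "\<dots> = dirderiv (\<lambda>y. D2 y v w $ k) u x + dirderiv (\<lambda>y. gam G (\<phi> y) (vdd \<phi> v y) (vdd \<phi> w y) $ k) u x"
    by (rule dirderiv_add[OF vholD[OF vhol_vdd[OF vhol_d\<phi> M'.open_U]] hol_on_bilinear[OF bi] x])
  also have "dirderiv (\<lambda>y. gam G (\<phi> y) (vdd \<phi> v y) (vdd \<phi> w y) $ k) u x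
    = dirderiv (\<lambda>y. gam G (\<phi> y) (vdd \<phi> v x) (vdd \<phi> w x) $ k) u x
      + gam G (\<phi> x) (D2 x u v) (vdd \<phi> w x) $ k + gam G (\<phi> x) (vdd \<phi> v x) (D2 x u w) $ k"
    by (rule dirderiv_bilinear[OF bi x])
  finally show "(D2 x u (gam G' x v w) + vdd \<phi> (vdd (\<lambda>y. gam G' y v w) u x) x) $ k
    = (vdd (vdd (vdd \<phi> w) v) u x + vdd (\<lambda>y. gam G y (vdd \<phi> v x) (vdd \<phi> w x)) (vdd \<phi> u x) (\<phi> x)
      + gam G (\<phi> x) (D2 x u v) (vdd \<phi> w x) + gam G (\<phi> x) (vdd \<phi> v x) (D2 x u w)) $ k"
    unfolding 1 hg(2) by (simp add: algebra_simps)
qed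

lemma curv_transform:
  assumes x: "x \<in> U'"
  shows "vdd \<phi> (curv G' x u v w) x = curv G (\<phi> x) (vdd \<phi> u x) (vdd \<phi> v x) (vdd \<phi> w x)"
proof -
  let ?J = "\<lambda>u. vdd \<phi> u x" and ?\<Gamma> = "gam G (\<phi> x)" and ?\<Gamma>' = "gam G' x"
  have J: "?J (a + b) = ?J a + ?J b" "?J (a - b) = ?J a - ?J b" for a b
    by (rule vlin_add[OF vlin_d\<phi>[OF x]] vlin_diff[OF vlin_d\<phi>[OF x]])+
  have D3: "vdd (vdd (vdd \<phi> w) u) v x = vdd (vdd (vdd \<phi> w) v) u x"
    using vhol_d\<phi>[of w] dirderiv_commute[OF _ M'.open_U x] by (simp add: vec_eq_iff vhol_def)
  \<comment> \<open>All terms containing second or third derivatives of \<open>\<phi>\<close> are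
    symmetric in \<open>u\<close> and \<open>v\<close>, taken together, so they drop out of the
    difference that forms the curvature.\<close>
  have e: "?J (vdd (\<lambda>y. gam G' y v w) u x) + ?J (?\<Gamma>' u (?\<Gamma>' v w))
     = vdd (vdd (vdd \<phi> w) v) u x + vdd (\<lambda>y. gam G y (?J v) (?J w)) (?J u) (\<phi> x) + ?\<Gamma> (D2 x u v) (?J w)
       + ?\<Gamma> (?J v) (D2 x u w) + ?\<Gamma> (?J u) (D2 x v w) + ?\<Gamma> (?J u) (?\<Gamma> (?J v) (?J w))" for u v
    using vdd_gam_transform[OF x, where u = u and v = v and w = w]
    by (simp add: gam_transform[OF x] gam_simps algebra_simps)
  show ?thesis
    unfolding M.curv_eq[OF map_\<phi>[OF x]] M'.curv_eq[OF x] J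
    unfolding add_diff_eq e[of u v] e[of v u] D3 D2_sym[OF x, of u v] by (simp add: algebra_simps)
qed

lemma R4_transform:
  "x \<in> U' \<Longrightarrow> R4 G' x u v w t = R4 G (\<phi> x) (vdd \<phi> u x) (vdd \<phi> v x) (vdd \<phi> w x) (vdd \<phi> t x)"
  by (simp add: pullback curv_transform)

text \<open>The differential of \<open>\<phi>\<close> maps an orthonormal frame to an orthonormal
  frame; the traces defining Ricci tensor and scalar curvature then agree term by term.\<close>

lemma weyl_transform:
  assumes x: "x \<in> U'"
  shows "weyl G' x u v w t = weyl G (\<phi> x) (vdd \<phi> u x) (vdd \<phi> v x) (vdd \<phi> w x) (vdd \<phi> t x)"
proof -
  note px = map_\<phi>[OF x]
  obtain e where e: "orthonormal (G' x) e" using M'.frame[OF x] by blast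
  then have e': "orthonormal (G (\<phi> x)) (\<lambda>k. vdd \<phi> (e k) x)"
    by (simp add: orthonormal_def pullback[OF x])
  have ric: "ricci G' x u w = ricci G (\<phi> x) (vdd \<phi> u x) (vdd \<phi> w x)" for u w
    by (simp add: M'.ricci_frame[OF x e] M.ricci_frame[OF px e'] R4_transform[OF x])
  have "scal G' x = scal G (\<phi> x)"
    by (simp add: M'.scal_frame[OF x e] M.scal_frame[OF px e'] ric)
  then have "nricci G' x u w = nricci G (\<phi> x) (vdd \<phi> u x) (vdd \<phi> w x)" for u w
    by (simp add: nricci_def ricci0_def ric pullback[OF x])
  then show ?thesis
    by (simp add: weyl_def susp_def R4_transform[OF x]) (simp add: pullback[OF x])
qed

end

section \<open>Bivectors\<close>

text \<open>Linearity is only required on the bivectors, since a Hodge operator is unspecified on all other matrices.\<close>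

definition blin :: "(complex^'n^'n \<Rightarrow> complex) \<Rightarrow> bool" where
  "blin f \<longleftrightarrow> (\<forall>A\<in>bivectors. \<forall>B\<in>bivectors. f (A + B) = f A + f B) \<and>
     (\<forall>c. \<forall>A\<in>bivectors. f (cscale c A) = c * f A)"

lemma blinI:
  assumes "\<And>A B. A \<in> bivectors \<Longrightarrow> B \<in> bivectors \<Longrightarrow> f (A + B) = f A + f B"
    "\<And>c A. A \<in> bivectors \<Longrightarrow> f (cscale c A) = c * f A"
  shows "blin f"
  using assms by (simp add: blin_def)

lemma blin_add: "blin f \<Longrightarrow> A \<in> bivectors \<Longrightarrow> B \<in> bivectors \<Longrightarrow> f (A + B) = f A + f B"
  and blin_scale: "blin f \<Longrightarrow> A \<in> bivectors \<Longrightarrow> f (cscale c A) = c * f A"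
  by (simp_all add: blin_def)

lemma bivectors_iff: "A \<in> bivectors \<longleftrightarrow> (\<forall>i j. A $ i $ j + A $ j $ i = 0)"
  unfolding bivectors_def by (simp add: vec_eq_iff transpose_def add_eq_0_iff)

lemma bivectors_nth: "A \<in> bivectors \<Longrightarrow> A $ j $ i = - A $ i $ j"
  unfolding bivectors_iff by (metis add_eq_0_iff)

lemma cscale_nth [simp]: "cscale c A $ i $ j = c * A $ i $ j"
  by (simp add: cscale_def)

lemma wedge_nth [simp]: "wedge X Y $ i $ j = X $ i * Y $ j - X $ j * Y $ i"
  by (simp add: wedge_def)

lemma bivectors_add: "A \<in> bivectors \<Longrightarrow> B \<in> bivectors \<Longrightarrow> A + B \<in> bivectors"
  and bivectors_scale: "A \<in> bivectors \<Longrightarrow> cscale c A \<in> bivectors"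
  and bivectors_zero: "0 \<in> bivectors"
  and bivectors_wedge: "wedge X Y \<in> bivectors"
  by (auto simp: bivectors_iff add.assoc add.left_commute[of "B $ _ $ _"] simp flip: distrib_left)

lemma wedge_skew: "wedge Y X = cscale (-1) (wedge X Y)"
  by (simp add: vec_eq_iff)

lemma wedge_self: "wedge X X = 0"
  by (simp add: vec_eq_iff)

lemma wedge_simps:
  "wedge (X + X') Y = wedge X Y + wedge X' Y" "wedge X (Y + Y') = wedge X Y + wedge X Y'"
  "wedge (c *s X) Y = cscale c (wedge X Y)" "wedge X (c *s Y) = cscale c (wedge X Y)"
  by (simp_all add: vec_eq_iff algebra_simps)

lemma blin_wedge:
  assumes "blin f"
  shows "clin (\<lambda>X. f (wedge X Y))" "clin (\<lambda>Y. f (wedge X Y))"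
  by (auto intro!: clinI simp: wedge_simps blin_add[OF assms] blin_scale[OF assms] bivectors_wedge)

lemma blin_wedge_skew: "blin f \<Longrightarrow> f (wedge Y X) = - f (wedge X Y)"
  unfolding wedge_skew[of Y X] by (simp add: blin_scale bivectors_wedge)

lemma blin_zero: "blin f \<Longrightarrow> f 0 = 0"
  using blin_scale[OF _ bivectors_zero, of f 0] by (simp add: cscale_def vec_eq_iff zero_vec_def)

lemma blin_sum:
  assumes "blin f" "\<And>i. g i \<in> bivectors"
  shows "(\<Sum>i\<in>I. g i) \<in> bivectors" "f (\<Sum>i\<in>I. g i) = (\<Sum>i\<in>I. f (g i))"
proof -
  have "(\<Sum>i\<in>I. g i) \<in> bivectors \<and> f (\<Sum>i\<in>I. g i) = (\<Sum>i\<in>I. f (g i))"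
    by (induction I rule: infinite_finite_induct)
       (auto simp: blin_zero[OF assms(1)] blin_add[OF assms(1)] bivectors_zero bivectors_add assms(2))
  then show "(\<Sum>i\<in>I. g i) \<in> bivectors" "f (\<Sum>i\<in>I. g i) = (\<Sum>i\<in>I. f (g i))" by auto
qed

lemma sum_axis_index: "(\<Sum>i\<in>UNIV. axis i (1::complex) $ k * f i) = f k"
proof -
  have "axis i (1::complex) $ k * f i = (if i = k then f i else 0)" for i by (auto simp: axis_def)
  then show ?thesis by simp
qed

lemma bivector_expand:
  assumes "A \<in> bivectors"
  shows "A = (\<Sum>i\<in>UNIV. \<Sum>j\<in>UNIV. cscale (A $ i $ j / 2) (wedge (axis i 1) (axis j 1)))"
proof -
  have "(\<Sum>i\<in>UNIV. \<Sum>j\<in>UNIV. cscale (A $ i $ j / 2) (wedge (axis i 1) (axis j 1))) $ a $ b = A $ a $ b" for a b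
  proof -
    have "(\<Sum>i\<in>UNIV. \<Sum>j\<in>UNIV. cscale (A $ i $ j / 2) (wedge (axis i 1) (axis j 1))) $ a $ b
       = (\<Sum>i\<in>UNIV. axis i (1::complex) $ a * (\<Sum>j\<in>UNIV. axis j (1::complex) $ b * (A $ i $ j / 2)))
       - (\<Sum>i\<in>UNIV. axis i (1::complex) $ b * (\<Sum>j\<in>UNIV. axis j (1::complex) $ a * (A $ i $ j / 2)))"
      by (simp add: sum_subtractf[symmetric] sum_distrib_left algebra_simps diff_divide_distrib del: sum_subtractf)
    also have "\<dots> = A $ a $ b / 2 - A $ b $ a / 2" by (simp only: sum_axis_index)
    also have "\<dots> = A $ a $ b" by (simp add: bivectors_nth[OF assms, of b a])
    finally show ?thesis .
  qed
  then show ?thesis by (simp add: vec_eq_iff)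
qed

lemma blin_expand:
  assumes f: "blin f" and A: "A \<in> bivectors"
  shows "f A = (\<Sum>i\<in>UNIV. \<Sum>j\<in>UNIV. A $ i $ j / 2 * f (wedge (axis i 1) (axis j 1)))"
proof -
  have b: "(\<Sum>j\<in>UNIV. cscale (A $ i $ j / 2) (wedge (axis i 1) (axis j 1))) \<in> bivectors" for i
    by (rule blin_sum(1)[OF f]) (intro bivectors_scale bivectors_wedge)
  have "f A = f (\<Sum>i\<in>UNIV. \<Sum>j\<in>UNIV. cscale (A $ i $ j / 2) (wedge (axis i 1) (axis j 1)))"
    using bivector_expand[OF A] by simp
  also have "\<dots> = (\<Sum>i\<in>UNIV. \<Sum>j\<in>UNIV. A $ i $ j / 2 * f (wedge (axis i 1) (axis j 1)))"
    by (simp add: blin_sum(2)[OF f b] blin_sum(2)[OF f] bivectors_scale bivectors_wedge blin_scale[OF f])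
  finally show ?thesis .
qed

lemma blin_ext:
  assumes e: "orthonormal G e" and f: "blin f" "blin g"
    and eq: "\<And>k l. f (wedge (e k) (e l)) = g (wedge (e k) (e l))" and A: "A \<in> bivectors"
  shows "f A = g A"
proof -
  have "f (wedge X Y) = g (wedge X Y)" for X Y
  proof -
    have *: "h (wedge X Y) = (\<Sum>k\<in>UNIV. bil G (e k) X * (\<Sum>l\<in>UNIV. bil G (e l) Y * h (wedge (e k) (e l))))"
      if "blin h" for h :: "complex^'a^'a \<Rightarrow> complex"
      by (simp add: onb_sum_left[OF e blin_wedge(1)[OF that]] onb_sum_left[OF e blin_wedge(2)[OF that]])
    show ?thesis by (simp add: *[OF f(1)] *[OF f(2)] eq)
  qed
  then show ?thesis by (simp add: blin_expand[OF f(1) A] blin_expand[OF f(2) A])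
qed

lemma blin_ext4:
  fixes e :: "4 \<Rightarrow> complex^4"
  assumes e: "orthonormal G e" and f: "blin f" "blin g"
    and eq: "f (wedge (e 1) (e 2)) = g (wedge (e 1) (e 2))" "f (wedge (e 1) (e 3)) = g (wedge (e 1) (e 3))"
      "f (wedge (e 1) (e 4)) = g (wedge (e 1) (e 4))" "f (wedge (e 2) (e 3)) = g (wedge (e 2) (e 3))"
      "f (wedge (e 2) (e 4)) = g (wedge (e 2) (e 4))" "f (wedge (e 3) (e 4)) = g (wedge (e 3) (e 4))"
    and A: "A \<in> bivectors"
  shows "f A = g A"
proof (rule blin_ext[OF e f _ A])
  have "\<forall>k l. f (wedge (e k) (e l)) = g (wedge (e k) (e l))"
    unfolding forall_4
    using eq blin_wedge_skew[OF f(1), of "e 2" "e 1"] blin_wedge_skew[OF f(2), of "e 2" "e 1"]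
      blin_wedge_skew[OF f(1), of "e 3" "e 1"] blin_wedge_skew[OF f(2), of "e 3" "e 1"]
      blin_wedge_skew[OF f(1), of "e 4" "e 1"] blin_wedge_skew[OF f(2), of "e 4" "e 1"]
      blin_wedge_skew[OF f(1), of "e 3" "e 2"] blin_wedge_skew[OF f(2), of "e 3" "e 2"]
      blin_wedge_skew[OF f(1), of "e 4" "e 2"] blin_wedge_skew[OF f(2), of "e 4" "e 2"]
      blin_wedge_skew[OF f(1), of "e 4" "e 3"] blin_wedge_skew[OF f(2), of "e 4" "e 3"]
      blin_zero[OF f(1)] blin_zero[OF f(2)]
    by (simp add: wedge_self)
  then show "f (wedge (e k) (e l)) = g (wedge (e k) (e l))" for k l by blast
qed

text \<open>The bilinear form on bivectors belonging to a 4-tensor of curvature type. The halves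
  compensate for counting each pair of indices in both orders.\<close>

definition biform :: "(complex^'n \<Rightarrow> complex^'n \<Rightarrow> complex^'n \<Rightarrow> complex^'n \<Rightarrow> complex) \<Rightarrow>
    complex^'n^'n \<Rightarrow> complex^'n^'n \<Rightarrow> complex" where
  "biform F A B = (\<Sum>i\<in>UNIV. \<Sum>j\<in>UNIV. A $ i $ j / 2 *
      (\<Sum>k\<in>UNIV. \<Sum>l\<in>UNIV. B $ k $ l / 2 * F (axis i 1) (axis j 1) (axis k 1) (axis l 1)))"

lemma blin_biform: "blin (\<lambda>A. biform F A B)" "blin (biform F A)"
  unfolding biform_def
  by (auto intro!: blinI simp: add_divide_distrib algebra_simps sum.distrib sum_distrib_left)

lemma wedge_contract:
  assumes "\<And>Y. clin (\<lambda>X. F X Y)" "\<And>X. clin (F X)" "\<And>X Y. F X Y = - F Y X"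
  shows "(\<Sum>i\<in>UNIV. \<Sum>j\<in>UNIV. wedge X Y $ i $ j / 2 * F (axis i 1) (axis j 1)) = F X Y"
proof -
  have F: "(\<Sum>i\<in>UNIV. X $ i * (\<Sum>j\<in>UNIV. Y $ j * F (axis i 1) (axis j 1))) = F X Y" for X Y
    by (simp only: clin_expand[OF assms(2), symmetric] clin_expand[OF assms(1), of X Y, symmetric])
  have "(\<Sum>i\<in>UNIV. \<Sum>j\<in>UNIV. wedge X Y $ i $ j / 2 * F (axis i 1) (axis j 1))
     = ((\<Sum>i\<in>UNIV. X $ i * (\<Sum>j\<in>UNIV. Y $ j * F (axis i 1) (axis j 1)))
       - (\<Sum>i\<in>UNIV. Y $ i * (\<Sum>j\<in>UNIV. X $ j * F (axis i 1) (axis j 1)))) / 2"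
    by (simp add: sum_distrib_left sum_subtractf[symmetric] sum_divide_distrib diff_divide_distrib algebra_simps del: sum_subtractf)
  then show ?thesis using assms(3)[of Y X] by (simp add: F)
qed

lemma biform_wedge:
  assumes "\<And>Y Z T. clin (\<lambda>X. F X Y Z T)" "\<And>X Z T. clin (\<lambda>Y. F X Y Z T)"
    "\<And>X Y T. clin (\<lambda>Z. F X Y Z T)" "\<And>X Y Z. clin (\<lambda>T. F X Y Z T)"
    "\<And>X Y Z T. F X Y Z T = - F Y X Z T" "\<And>X Y Z T. F X Y Z T = - F X Y T Z"
  shows "biform F (wedge X Y) (wedge Z T) = F X Y Z T"
  unfolding biform_def
  by (subst wedge_contract[of "F _ _"]; (rule assms)?)
     (rule wedge_contract[where F = "\<lambda>X Y. F X Y Z T"]; rule assms)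

lemma blin_bil2: "blin (\<lambda>A. bil2 G A B)" "blin (bil2 G A)"
  unfolding bil2_def
  by (auto intro!: blinI simp: algebra_simps sum.distrib sum_distrib_left add_divide_distrib)

lemma bil2_wedge:
  assumes "A \<in> bivectors"
  shows "bil2 G A (wedge X Y) = (\<Sum>i\<in>UNIV. \<Sum>j\<in>UNIV. A $ i $ j * (G *v X) $ i * (G *v Y) $ j)"
proof -
  have p: "(\<Sum>c\<in>UNIV. \<Sum>d\<in>UNIV. Z $ c * T $ d * G $ a $ c * G $ b $ d) = (G *v Z) $ a * (G *v T) $ b" for Z T a b
    unfolding matrix_vector_mult_def vec_lambda_beta sum_product
    by (intro sum.cong refl) (simp add: mult_ac)
  have "bil2 G A (wedge X Y) = (1/2) * (\<Sum>a\<in>UNIV. \<Sum>b\<in>UNIV. A $ a $ b *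
      ((\<Sum>c\<in>UNIV. \<Sum>d\<in>UNIV. X $ c * Y $ d * G $ a $ c * G $ b $ d) - (\<Sum>c\<in>UNIV. \<Sum>d\<in>UNIV. Y $ c * X $ d * G $ a $ c * G $ b $ d)))"
    unfolding bil2_def by (simp add: sum_subtractf[symmetric] sum_distrib_left algebra_simps del: sum_subtractf)
  also have "\<dots> = (1/2) * ((\<Sum>a\<in>UNIV. \<Sum>b\<in>UNIV. A $ a $ b * (G *v X) $ a * (G *v Y) $ b)
      - (\<Sum>a\<in>UNIV. \<Sum>b\<in>UNIV. A $ a $ b * (G *v Y) $ a * (G *v X) $ b))"
    unfolding p by (simp add: sum_subtractf algebra_simps)
  also have "(\<Sum>a\<in>UNIV. \<Sum>b\<in>UNIV. A $ a $ b * (G *v Y) $ a * (G *v X) $ b)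
     = (\<Sum>b\<in>UNIV. \<Sum>a\<in>UNIV. - A $ b $ a * (G *v Y) $ a * (G *v X) $ b)"
    by (subst sum.swap) (simp only: bivectors_nth[OF assms, symmetric])
  also have "\<dots> = - (\<Sum>a\<in>UNIV. \<Sum>b\<in>UNIV. A $ a $ b * (G *v X) $ a * (G *v Y) $ b)"
    by (simp add: sum_negf mult_ac)
  finally show ?thesis by simp
qed

lemma bil2_wedge_wedge: "bil2 G (wedge X Y) (wedge Z T) = bil G X Z * bil G Y T - bil G X T * bil G Y Z"
  unfolding bil2_wedge[OF bivectors_wedge] bil_matrix
  by (simp add: sum_product sum_subtractf algebra_simps) (subst sum.swap, simp add: mult_ac)

lemma blin_ext_wedge:
  assumes "blin f" "blin g" "\<And>X Y. f (wedge X Y) = g (wedge X Y)" "A \<in> bivectors"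
  shows "f A = g A"
  by (simp add: blin_expand[OF assms(1,4)] blin_expand[OF assms(2,4)] assms(3))

lemma bil2_sym:
  assumes "transpose G = G" "A \<in> bivectors" "B \<in> bivectors"
  shows "bil2 G A B = bil2 G B A"
proof (rule blin_ext_wedge[OF blin_bil2 _ assms(2)])
  fix X Y
  show "bil2 G (wedge X Y) B = bil2 G B (wedge X Y)"
    by (rule blin_ext_wedge[OF blin_bil2(2,1) _ assms(3)])
       (simp add: bil2_wedge_wedge bil_sym[OF assms(1)] mult.commute)
qed

text \<open>The vectors \<open>matrix_inv G *v axis i 1\<close> form the dual basis, so pairing with
  their wedge products reads off components.\<close>

lemma bil2_component:
  fixes A :: "complex^'n^'n"
  assumes G: "nondegenerate G" and A: "A \<in> bivectors"
  shows "A $ i $ j = bil2 G A (wedge (matrix_inv G *v axis i 1) (matrix_inv G *v axis j 1))"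
proof -
  have ax: "G *v (matrix_inv G *v axis i 1) = axis i 1" for i
    using matrix_inv_right[of G] G by (simp add: nondegenerate_def matrix_vector_mul_assoc)
  have "(\<Sum>k\<in>UNIV. \<Sum>l\<in>UNIV. A $ k $ l * axis i 1 $ k * axis j 1 $ l)
    = (\<Sum>k\<in>UNIV. axis i 1 $ k * (\<Sum>l\<in>UNIV. axis j 1 $ l * A $ k $ l))"
    by (simp add: sum_distrib_left mult_ac)
  also have "\<dots> = A $ i $ j" by (simp only: sum_axis)
  finally show ?thesis by (simp only: bil2_wedge[OF A] ax)
qed

lemma bil2_eqI:
  assumes G: "nondegenerate G" and A: "A \<in> bivectors" and B: "B \<in> bivectors"
    and eq: "\<And>X Y. bil2 G A (wedge X Y) = bil2 G B (wedge X Y)"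
  shows "A = B"
  unfolding vec_eq_iff by (intro allI) (simp only: bil2_component[OF G A] bil2_component[OF G B] eq)

section \<open>The curvature operator\<close>

context framed_metric
begin

lemma inv_commute: "x \<in> U \<Longrightarrow> matrix_inv (G x) $ i $ j = matrix_inv (G x) $ j $ i"
  using frame[of x] onb_inv by (metis (no_types, lifting) mult.commute sum.cong)

lemma curvop_wedge:
  assumes x: "x \<in> U"
  shows "curvop G x (wedge X Y) $ a $ b
    = R4 G x X Y (matrix_inv (G x) *v axis a 1) (matrix_inv (G x) *v axis b 1)"
proof -
  let ?F = "\<lambda>X Y. \<Sum>c\<in>UNIV. matrix_inv (G x) $ a $ c * curv G x X Y (axis c 1) $ b"
  have F: "?F X Y = curv G x X Y (matrix_inv (G x) *v axis a 1) $ b" for X Y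
  proof -
    have "?F X Y = (\<Sum>c\<in>UNIV. (matrix_inv (G x) *v axis a 1) $ c * curv G x X Y (axis c 1) $ b)"
      unfolding matrix_vector_axis by (intro sum.cong refl arg_cong2[where f = "(*)"] inv_commute x)
    then show ?thesis by (simp only: clin_expand[OF vlin_nth[OF vlin_curv(3)[OF x]], symmetric])
  qed
  have "curvop G x (wedge X Y) $ a $ b = (\<Sum>i\<in>UNIV. \<Sum>j\<in>UNIV. wedge X Y $ i $ j / 2 * ?F (axis i 1) (axis j 1))"
    by (simp add: curvop_def sum_distrib_left)
  also have "\<dots> = curv G x X Y (matrix_inv (G x) *v axis a 1) $ b"
    unfolding F
  proof (rule wedge_contract)
    show "clin (\<lambda>X. curv G x X Y Z $ b)" "clin (\<lambda>Y. curv G x X Y Z $ b)" for X Y Z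
      by (intro vlin_nth vlin_curv x)+
    show "curv G x X Y Z $ b = - curv G x Y X Z $ b" for X Y Z
      using curv_skew[of x X Y Z] by simp
  qed
  finally show ?thesis by (simp add: bil_inv_axis[OF x])
qed

lemma blin_curvop: "blin (\<lambda>A. curvop G x A $ a $ b)"
  unfolding curvop_def vec_lambda_beta
  by (rule blinI) (simp_all add: distrib_right distrib_left sum.distrib sum_distrib_left mult_ac)

lemma curvop_bivector:
  assumes x: "x \<in> U" and A: "A \<in> bivectors"
  shows "curvop G x A \<in> bivectors"
  unfolding bivectors_iff
proof (intro allI)
  fix a b
  have "curvop G x A $ a $ b + curvop G x A $ b $ a = (\<lambda>_. 0) A"
  proof (rule blin_ext_wedge[OF _ _ _ A, where f = "\<lambda>A. curvop G x A $ a $ b + curvop G x A $ b $ a"])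
    show "blin (\<lambda>A. curvop G x A $ a $ b + curvop G x A $ b $ a)"
      by (rule blinI) (simp_all add: blin_add[OF blin_curvop] blin_scale[OF blin_curvop] distrib_left)
    show "blin (\<lambda>_. 0)" by (simp add: blin_def)
    show "curvop G x (wedge X Y) $ a $ b + curvop G x (wedge X Y) $ b $ a = 0" for X Y
      unfolding curvop_wedge[OF x] by (subst R4_skew34[OF x]) simp
  qed
  then show "curvop G x A $ a $ b + curvop G x A $ b $ a = 0" by simp
qed

text \<open>\<open>curvop\<close> raises an index with the inverse metric, hence
  \<open>curvop_wedge\<close> is this identity for \<open>Z\<close> and \<open>T\<close> among the
  vectors \<open>matrix_inv (G x) *v axis a 1\<close>. These span because the metric is
  nondegenerate.\<close>

lemma bil2_curvop_wedge:
  assumes x: "x \<in> U"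
  shows "bil2 (G x) (curvop G x (wedge X Y)) (wedge Z T) = R4 G x X Y Z T"
proof -
  let ?M = "matrix_inv (G x)"
  have ext: "f V = g V" if f: "clin f" and g: "clin g"
    and eq: "\<And>a. f (?M *v axis a 1) = g (?M *v axis a 1)" for f g V
  proof -
    have M: "vlin (\<lambda>v. ?M *v v)"
      by (auto simp: vlin_def clin_def matrix_vector_mult_def distrib_left sum.distrib sum_distrib_left mult_ac)
    have "f (?M *v (G x *v V)) = g (?M *v (G x *v V))"
      by (rule clin_ext[OF clin_compose[OF f M] clin_compose[OF g M] eq])
    then show ?thesis
      using matrix_inv_left[of "G x"] nondeg_G[OF x] by (simp add: nondegenerate_def matrix_vector_mul_assoc)
  qed
  note K = curvop_bivector[OF x bivectors_wedge, of X Y] and bl = blin_wedge[OF blin_bil2(2)]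
  have 1: "bil2 (G x) (curvop G x (wedge X Y)) (wedge (?M *v axis a 1) (?M *v axis b 1))
      = R4 G x X Y (?M *v axis a 1) (?M *v axis b 1)" for a b
    by (simp only: bil2_component[OF nondeg_G[OF x] K, symmetric] curvop_wedge[OF x])
  have 2: "bil2 (G x) (curvop G x (wedge X Y)) (wedge (?M *v axis a 1) T) = R4 G x X Y (?M *v axis a 1) T" for a
    by (rule ext[OF bl(2) R4_clin(4)[OF x] 1])
  show ?thesis by (rule ext[OF bl(1) R4_clin(3)[OF x] 2])
qed

lemma biform_R4_wedge: "x \<in> U \<Longrightarrow> biform (R4 G x) (wedge X Y) (wedge Z T) = R4 G x X Y Z T"
  by (rule biform_wedge) (rule R4_clin R4_skew12 R4_skew34; assumption)+

lemma bil2_curvop: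
  assumes x: "x \<in> U" and A: "A \<in> bivectors" and B: "B \<in> bivectors"
  shows "bil2 (G x) (curvop G x A) B = biform (R4 G x) A B"
proof (rule blin_ext_wedge[OF _ blin_biform(1) _ A])
  show "blin (\<lambda>A. bil2 (G x) (curvop G x A) B)"
    unfolding bil2_def
    by (rule blinI) (simp_all add: blin_add[OF blin_curvop] blin_scale[OF blin_curvop]
        distrib_right distrib_left sum.distrib sum_distrib_left add_divide_distrib mult_ac)
  fix X Y
  show "bil2 (G x) (curvop G x (wedge X Y)) B = biform (R4 G x) (wedge X Y) B"
    by (rule blin_ext_wedge[OF blin_bil2(2) blin_biform(2) _ B])
       (simp add: bil2_curvop_wedge[OF x] biform_R4_wedge[OF x])
qed

lemma biform_weyl_wedge: "x \<in> U \<Longrightarrow> biform (weyl G x) (wedge X Y) (wedge Z T) = weyl G x X Y Z T"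
  by (rule biform_wedge) (rule weyl_clin weyl_skew12 weyl_skew34; assumption)+

lemma biform_susp_wedge:
  assumes "x \<in> U"
  shows "biform (susp G x) (wedge X Y) (wedge Z T) = susp G x X Y Z T"
proof (rule biform_wedge)
  show "susp G x X Y Z T = - susp G x Y X Z T" "susp G x X Y Z T = - susp G x X Y T Z" for X Y Z T
    by (simp_all add: susp_def)
  show "clin (\<lambda>X. susp G x X Y Z T)" "clin (\<lambda>Y. susp G x X Y Z T)"
    "clin (\<lambda>Z. susp G x X Y Z T)" "clin (\<lambda>T. susp G x X Y Z T)" for X Y Z T
    unfolding susp_def by (intro clin_intros nricci_clin assms clin_bil_left clin_bil_right)+
qed

lemma biform_R4: "biform (R4 G x) A B = biform (susp G x) A B + biform (weyl G x) A B"
proof -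
  have "R4 G x = (\<lambda>X Y Z T. susp G x X Y Z T + weyl G x X Y Z T)" by (simp add: weyl_def fun_eq_iff)
  then show ?thesis by (simp only: biform_def distrib_left sum.distrib)
qed

end

lemma trace2_frame:
  fixes K :: "complex^'n^'n \<Rightarrow> complex^'n^'n"
  assumes e: "orthonormal G e" and G: "transpose G = G"
    and K: "\<And>A. A \<in> bivectors \<Longrightarrow> K A \<in> bivectors" "\<And>a b. blin (\<lambda>A. K A $ a $ b)"
  shows "trace2 K = (1/2) * (\<Sum>k\<in>UNIV. \<Sum>l\<in>UNIV. bil2 G (K (wedge (e k) (e l))) (wedge (e k) (e l)))"
proof -
  define F where "F X Y i j = K (wedge X Y) $ i $ j" for X Y i j
  have Ge: "(G *v e k) $ i = bil G (e k) (axis i 1)" for k i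
    by (simp only: bil_axis_left[symmetric] bil_sym[OF G])
  have F: "clin (\<lambda>X. F X Y i j)" "clin (\<lambda>Y. F X Y i j)" for X Y i j
    unfolding F_def by (rule blin_wedge[OF K(2)])+
  have "(\<Sum>k\<in>UNIV. \<Sum>l\<in>UNIV. bil2 G (K (wedge (e k) (e l))) (wedge (e k) (e l)))
    = (\<Sum>k\<in>UNIV. \<Sum>l\<in>UNIV. \<Sum>i\<in>UNIV. \<Sum>j\<in>UNIV. (G *v e k) $ i * ((G *v e l) $ j * F (e k) (e l) i j))"
    by (simp add: bil2_wedge[OF K(1)[OF bivectors_wedge]] F_def mult_ac)
  also have "\<dots> = (\<Sum>i\<in>UNIV. \<Sum>k\<in>UNIV. \<Sum>l\<in>UNIV. \<Sum>j\<in>UNIV. (G *v e k) $ i * ((G *v e l) $ j * F (e k) (e l) i j))"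
    by (rule sum_rotate3)
  also have "\<dots> = (\<Sum>i\<in>UNIV. \<Sum>j\<in>UNIV. \<Sum>k\<in>UNIV. \<Sum>l\<in>UNIV. (G *v e k) $ i * ((G *v e l) $ j * F (e k) (e l) i j))"
    by (intro sum.cong refl sum_rotate3)
  also have "\<dots> = (\<Sum>i\<in>UNIV. \<Sum>j\<in>UNIV. F (axis i 1) (axis j 1) i j)"
    by (simp only: sum_distrib_left[symmetric] Ge onb_sum_left[OF e F(2)] onb_sum_left[OF e F(1)])
  finally show ?thesis by (simp add: trace2_def F_def)
qed

section \<open>The Hodge operator in dimension four\<close>

text \<open>The conditions that \<open>is_hodge\<close> imposes on its existential witness, named so
  that they can be established for other frames.\<close>

definition hodge_frame :: "complex^4^4 \<Rightarrow> (complex^4^4 \<Rightarrow> complex^4^4) \<Rightarrow> (4 \<Rightarrow> complex^4) \<Rightarrow> bool" where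
  "hodge_frame G S e \<longleftrightarrow> orthonormal G e \<and>
     S (wedge (e 1) (e 2)) = wedge (e 3) (e 4) \<and> S (wedge (e 3) (e 4)) = wedge (e 1) (e 2) \<and>
     S (wedge (e 1) (e 3)) = wedge (e 4) (e 2) \<and> S (wedge (e 4) (e 2)) = wedge (e 1) (e 3) \<and>
     S (wedge (e 1) (e 4)) = wedge (e 2) (e 3) \<and> S (wedge (e 2) (e 3)) = wedge (e 1) (e 4)"

lemma bil2_onb:
  "orthonormal G e \<Longrightarrow> bil2 G (wedge (e i) (e j)) (wedge (e k) (e l))
     = (if i = k then 1 else 0) * (if j = l then 1 else 0) - (if i = l then 1 else 0) * (if j = k then 1 else 0)"
  by (simp add: bil2_wedge_wedge orthonormal_def)

text \<open>\<open>A \<and> B\<close> as a multiple of the coordinate volume element. As \<open>g(A, *B)\<close> is a constant multiple of it, it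
  detects whether an orthonormal basis is oriented.\<close>

definition vol :: "complex^4^4 \<Rightarrow> complex^4^4 \<Rightarrow> complex" where
  "vol A B = A $ 1 $ 2 * B $ 3 $ 4 - A $ 1 $ 3 * B $ 2 $ 4 + A $ 1 $ 4 * B $ 2 $ 3
     + A $ 2 $ 3 * B $ 1 $ 4 - A $ 2 $ 4 * B $ 1 $ 3 + A $ 3 $ 4 * B $ 1 $ 2"

lemma blin_vol: "blin (\<lambda>A. vol A B)" "blin (vol A)"
  unfolding vol_def by (rule blinI; (simp only: vector_add_component cscale_nth)?, algebra)+

lemma vol_commute: "vol A B = vol B A"
  unfolding vol_def by algebra

text \<open>\<open>vol (wedge a b) (wedge c d)\<close> is the Laplace expansion of the determinant
  with columns \<open>a\<close>, \<open>b\<close>, \<open>c\<close>, \<open>d\<close>. Exchanging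
  the middle columns, together with skewness of \<open>wedge\<close>, produces all
  permutations.\<close>

lemma vol_wedge_exchange: "vol (wedge a c) (wedge b d) = - vol (wedge a b) (wedge c d)"
proof -
  have "(a1*c2-a2*c1)*(b3*d4-b4*d3) - (a1*c3-a3*c1)*(b2*d4-b4*d2) + (a1*c4-a4*c1)*(b2*d3-b3*d2)
   + (a2*c3-a3*c2)*(b1*d4-b4*d1) - (a2*c4-a4*c2)*(b1*d3-b3*d1) + (a3*c4-a4*c3)*(b1*d2-b2*d1)
   = - ((a1*b2-a2*b1)*(c3*d4-c4*d3) - (a1*b3-a3*b1)*(c2*d4-c4*d2) + (a1*b4-a4*b1)*(c2*d3-c3*d2)
   + (a2*b3-a3*b2)*(c1*d4-c4*d1) - (a2*b4-a4*b2)*(c1*d3-c3*d1) + (a3*b4-a4*b3)*(c1*d2-c2*d1))"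
    for a1 a2 a3 a4 b1 b2 b3 b4 c1 c2 c3 c4 d1 d2 d3 d4 :: complex
    by (simp add: algebra_simps)
  then show ?thesis unfolding vol_def wedge_nth .
qed

lemma vol_wedge_self: "vol (wedge a b) (wedge a c) = 0"
proof -
  have "vol (wedge a a) (wedge b c) = 0" unfolding wedge_self by (rule blin_zero[OF blin_vol(1)])
  then show ?thesis using vol_wedge_exchange[of a b a c] by simp
qed

lemma vol_alternating:
  "vol (wedge a b) (wedge a c) = 0" "vol (wedge a b) (wedge c b) = 0"
  "vol (wedge a b) (wedge c a) = 0" "vol (wedge a b) (wedge b c) = 0"
  "vol (wedge a c) (wedge b d) = - vol (wedge a b) (wedge c d)"
  "vol (wedge a d) (wedge b c) = vol (wedge a b) (wedge c d)"
proof -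
  have sk: "vol (wedge a b) B = - vol (wedge b a) B" "vol A (wedge a b) = - vol A (wedge b a)" for a b A B
    by (rule blin_wedge_skew[OF blin_vol(1)] blin_wedge_skew[OF blin_vol(2)])+
  show "vol (wedge a b) (wedge a c) = 0" by (rule vol_wedge_self)
  show "vol (wedge a b) (wedge c b) = 0" using vol_wedge_self[of b a c] sk(1)[of a b] sk(2)[of _ c b] by simp
  show "vol (wedge a b) (wedge c a) = 0" using vol_wedge_self[of a b c] sk(2)[of _ c a] by simp
  show "vol (wedge a b) (wedge b c) = 0" using vol_wedge_self[of b a c] sk(1)[of a b] by simp
  show "vol (wedge a c) (wedge b d) = - vol (wedge a b) (wedge c d)" by (rule vol_wedge_exchange)
  show "vol (wedge a d) (wedge b c) = vol (wedge a b) (wedge c d)"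
    using vol_wedge_exchange[of a d b c] sk(2)[of _ d c] by simp
qed

lemma vol_frame:
  fixes e :: "4 \<Rightarrow> complex^4"
  defines "v \<equiv> vol (wedge (e 1) (e 2)) (wedge (e 3) (e 4))"
  shows "vol (wedge (e 3) (e 4)) (wedge (e 1) (e 2)) = v"
     "vol (wedge (e 1) (e 3)) (wedge (e 2) (e 4)) = - v" "vol (wedge (e 2) (e 4)) (wedge (e 1) (e 3)) = - v"
     "vol (wedge (e 1) (e 4)) (wedge (e 2) (e 3)) = v" "vol (wedge (e 2) (e 3)) (wedge (e 1) (e 4)) = v"
  unfolding v_def
  by (rule vol_commute vol_alternating(5) vol_alternating(6)
      trans[OF vol_commute vol_alternating(5)] trans[OF vol_commute vol_alternating(6)])+

locale hodge_operator =
  fixes G :: "complex^4^4" and S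
  assumes sym: "transpose G = G" and nondeg: "nondegenerate G" and hodge: "is_hodge G S"
begin

lemma S_add: "A \<in> bivectors \<Longrightarrow> B \<in> bivectors \<Longrightarrow> S (A + B) = S A + S B"
  and S_scale: "A \<in> bivectors \<Longrightarrow> S (cscale c A) = cscale c (S A)"
  using hodge by (simp_all add: is_hodge_def)

lemma ex_hodge_frame: "\<exists>e. hodge_frame G S e"
  using hodge by (simp add: is_hodge_def hodge_frame_def)

lemma blin_S_nth: "blin (\<lambda>A. S A $ i $ j)"
  by (rule blinI) (simp_all add: S_add S_scale)

lemma hodge_frame_table:
  assumes "hodge_frame G S e"
  shows "S (wedge (e 1) (e 2)) = wedge (e 3) (e 4)" "S (wedge (e 3) (e 4)) = wedge (e 1) (e 2)"
    "S (wedge (e 1) (e 4)) = wedge (e 2) (e 3)" "S (wedge (e 2) (e 3)) = wedge (e 1) (e 4)"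
    "S (wedge (e 1) (e 3)) = cscale (-1) (wedge (e 2) (e 4))" "S (wedge (e 2) (e 4)) = cscale (-1) (wedge (e 1) (e 3))"
  using assms S_scale[OF bivectors_wedge, of "-1" "e 4" "e 2"]
  by (simp_all add: hodge_frame_def flip: wedge_skew)

lemma S_bivector:
  assumes "A \<in> bivectors"
  shows "S A \<in> bivectors"
  unfolding bivectors_iff
proof (intro allI)
  fix i j
  obtain e where e: "hodge_frame G S e" using ex_hodge_frame by blast
  have "S A $ i $ j + S A $ j $ i = (\<lambda>_. 0) A"
  proof (rule blin_ext4[where G = G and e = e and f = "\<lambda>A. S A $ i $ j + S A $ j $ i"])
    show "orthonormal G e" using e by (simp add: hodge_frame_def)
    show "blin (\<lambda>A. S A $ i $ j + S A $ j $ i)"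
      by (rule blinI) (simp_all add: blin_add[OF blin_S_nth] blin_scale[OF blin_S_nth] distrib_left)
    show "blin (\<lambda>_. 0)" by (simp add: blin_def)
  qed (simp_all add: hodge_frame_table[OF e] assms)
  then show "S A $ i $ j + S A $ j $ i = 0" by simp
qed

lemma blin_S: "blin f \<Longrightarrow> blin (\<lambda>A. f (S A))"
  by (rule blinI) (simp_all add: S_add S_scale S_bivector blin_add blin_scale)

lemma S_S:
  assumes "A \<in> bivectors"
  shows "S (S A) = A"
proof -
  obtain e where e: "hodge_frame G S e" using ex_hodge_frame by blast
  have "S (S A) $ i $ j = A $ i $ j" for i j
  proof (rule blin_ext4[where G = G and e = e and f = "\<lambda>A. S (S A) $ i $ j"])
    show "orthonormal G e" using e by (simp add: hodge_frame_def)
    show "blin (\<lambda>A. S (S A) $ i $ j)" by (rule blin_S[OF blin_S_nth])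
    show "blin (\<lambda>A. A $ i $ j)" by (simp add: blin_def)
  qed (simp_all add: hodge_frame_table[OF e] S_scale bivectors_wedge assms)
  then show ?thesis by (simp add: vec_eq_iff)
qed

lemma bil2_S_left:
  assumes A: "A \<in> bivectors" and B: "B \<in> bivectors"
  shows "bil2 G (S A) B = bil2 G A (S B)"
proof -
  obtain e where e: "hodge_frame G S e" using ex_hodge_frame by blast
  then have o: "orthonormal G e" by (simp add: hodge_frame_def)
  note sc = blin_scale[OF blin_bil2(1) bivectors_wedge] blin_scale[OF blin_bil2(2) bivectors_wedge]
  show ?thesis
    by (rule blin_ext4[where f = "\<lambda>A. bil2 G (S A) B", OF o blin_S[OF blin_bil2(1)] blin_bil2(1) _ _ _ _ _ _ A];
        rule blin_ext4[OF o blin_bil2(2) blin_S[OF blin_bil2(2)] _ _ _ _ _ _ B])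
       (simp_all add: hodge_frame_table[OF e] sc bil2_onb[OF o])
qed

text \<open>Here \<open>\<delta>\<close> is the inverse determinant of the frame; both bilinear
  forms are compared on all pairs of basis bivectors of the frame.\<close>

lemma hodge_vol:
  assumes e: "hodge_frame G S e"
  obtains \<delta> where "\<delta> * vol (wedge (e 1) (e 2)) (wedge (e 3) (e 4)) = 1"
    "\<And>A B. A \<in> bivectors \<Longrightarrow> B \<in> bivectors \<Longrightarrow> bil2 G A (S B) = \<delta> * vol A B"
proof -
  have o: "orthonormal G e" using e by (simp add: hodge_frame_def)
  define v where "v = vol (wedge (e 1) (e 2)) (wedge (e 3) (e 4))"
  note sc = blin_scale[OF blin_bil2(2) bivectors_wedge]
  note t = v_def[symmetric] vol_frame[of e, folded v_def]
  have eq: "v * bil2 G A (S B) = vol A B" if A: "A \<in> bivectors" and B: "B \<in> bivectors" for A B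
  proof -
    have bl: "blin (\<lambda>A. v * bil2 G A (S B))" "blin (\<lambda>B. v * bil2 G A (S B))" for A B
      using blin_bil2(1)[of G "S B"] blin_S[OF blin_bil2(2)[of G A]]
      by (simp_all add: blin_def distrib_left mult.left_commute)
    show ?thesis
      by (rule blin_ext4[where f = "\<lambda>A. v * bil2 G A (S B)", OF o bl(1) blin_vol(1) _ _ _ _ _ _ A];
          rule blin_ext4[OF o bl(2) blin_vol(2) _ _ _ _ _ _ B])
         (simp_all add: hodge_frame_table[OF e] sc bil2_onb[OF o] t vol_alternating(1-4))
  qed
  \<comment> \<open>By \<open>eq\<close>, \<open>v = 0\<close> would make \<open>vol\<close> vanish
    on all bivectors, but on the coordinate basis it has the value 1.\<close>
  have "v \<noteq> 0"
  proof
    assume "v = 0"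
    then have "vol (wedge (axis 1 1) (axis 2 1)) (wedge (axis 3 1) (axis 4 1)) = 0"
      using eq[OF bivectors_wedge bivectors_wedge, of "axis 1 1" "axis 2 1" "axis 3 1" "axis 4 1"] by simp
    then show False by (simp add: vol_def axis_def)
  qed
  show ?thesis
  proof (rule that[of "1 / v"])
    show "1 / v * vol (wedge (e 1) (e 2)) (wedge (e 3) (e 4)) = 1"
      using \<open>v \<noteq> 0\<close> unfolding v_def[symmetric] by simp
    show "bil2 G A (S B) = 1 / v * vol A B" if "A \<in> bivectors" "B \<in> bivectors" for A B
      using \<open>v \<noteq> 0\<close> eq[OF that, symmetric] by simp
  qed
qed

text \<open>The relation between the Hodge operator and \<open>vol\<close> mentions no frame, so
  \<open>S B\<close> can be computed in an orthonormal basis \<open>f\<close> with no given link to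
  the frame in \<open>is_hodge\<close>.\<close>

lemma S_eqI:
  assumes \<delta>: "\<And>A B. A \<in> bivectors \<Longrightarrow> B \<in> bivectors \<Longrightarrow> bil2 G A (S B) = \<delta> * vol A B"
    and o: "orthonormal G f" and BC: "B \<in> bivectors" "C \<in> bivectors"
    and eq: "bil2 G (wedge (f 1) (f 2)) C = \<delta> * vol (wedge (f 1) (f 2)) B"
       "bil2 G (wedge (f 1) (f 3)) C = \<delta> * vol (wedge (f 1) (f 3)) B"
       "bil2 G (wedge (f 1) (f 4)) C = \<delta> * vol (wedge (f 1) (f 4)) B"
       "bil2 G (wedge (f 2) (f 3)) C = \<delta> * vol (wedge (f 2) (f 3)) B"
       "bil2 G (wedge (f 2) (f 4)) C = \<delta> * vol (wedge (f 2) (f 4)) B"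
       "bil2 G (wedge (f 3) (f 4)) C = \<delta> * vol (wedge (f 3) (f 4)) B"
  shows "S B = C"
proof (rule bil2_eqI[OF nondeg S_bivector[OF BC(1)] BC(2)])
  fix X Y
  have "bil2 G (wedge X Y) (S B) = bil2 G (wedge X Y) C"
    by (rule blin_ext4[OF o blin_bil2(1) blin_bil2(1) _ _ _ _ _ _ bivectors_wedge])
       (simp_all add: \<delta> BC bivectors_wedge eq)
  then show "bil2 G (S B) (wedge X Y) = bil2 G C (wedge X Y)"
    by (simp add: bil2_sym[OF sym] S_bivector BC bivectors_wedge)
qed

text \<open>\<open>oriented_onb\<close> records only the value on \<open>wedge (f 1) (f 2)\<close>.
  That value fixes \<open>\<delta>\<close> times the determinant of \<open>f\<close> to be 1, which
  determines all the others.\<close>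

lemma hodge_frameI:
  assumes f: "oriented_onb G S f"
  shows "hodge_frame G S f"
proof -
  obtain e where e: "hodge_frame G S e" using ex_hodge_frame by blast
  then obtain \<delta> where \<delta>: "\<And>A B. A \<in> bivectors \<Longrightarrow> B \<in> bivectors \<Longrightarrow> bil2 G A (S B) = \<delta> * vol A B"
    using hodge_vol by metis
  have o: "orthonormal G f" and S12: "S (wedge (f 1) (f 2)) = wedge (f 3) (f 4)"
    using f by (simp_all add: oriented_onb_def)
  have v: "\<delta> * vol (wedge (f 3) (f 4)) (wedge (f 1) (f 2)) = 1"
    using \<delta>[OF bivectors_wedge bivectors_wedge, of "f 3" "f 4" "f 1" "f 2"] by (simp add: S12 bil2_onb[OF o])
  define v where "v = vol (wedge (f 1) (f 2)) (wedge (f 3) (f 4))"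
  note t = v_def[symmetric] vol_frame[of f, folded v_def]
  have dv: "\<delta> * v = 1" using v by (simp add: t)
  have bw: "wedge a b \<in> bivectors" "cscale (-1) (wedge a b) \<in> bivectors" for a b
    by (intro bivectors_scale bivectors_wedge)+
  have w42: "wedge (f 4) (f 2) = cscale (-1) (wedge (f 2) (f 4))" by (rule wedge_skew)
  note sc = blin_scale[OF blin_bil2(2) bivectors_wedge] blin_scale[OF blin_vol(2) bivectors_wedge]
  show ?thesis
    unfolding hodge_frame_def w42
    by (intro conjI o S12 S_eqI[OF \<delta> o] bw)
       (simp_all add: sc bil2_onb[OF o] t dv vol_alternating(1-4))
qed

text \<open>The required basis is the image of \<open>e\<close> under the reflection that exchanges \<open>e 4\<close> and \<open>s \<nu>\<close>; the sign
  \<open>s\<close> makes \<open>e 4 - s \<nu>\<close> non-isotropic.\<close>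

lemma ex_onb_with_last:
  assumes \<nu>: "bil G \<nu> \<nu> = 1" and o: "orthonormal G (e :: 4 \<Rightarrow> complex^4)"
  shows "\<exists>f. orthonormal G f \<and> f 4 = \<nu>"
proof -
  define b where "b = bil G (e 4) \<nu>"
  define s :: complex where "s = (if b = 1 then - 1 else 1)"
  define a where "a = e 4 - s *s \<nu>"
  define f where "f i = s *s (e i - (2 * bil G (e i) a / bil G a a) *s a)" for i
  have s: "s * s = 1" by (simp add: s_def)
  have e4: "bil G (e 4) (e 4) = 1" using o by (simp add: orthonormal_def)
  have q: "bil G a a = 2 - 2 * s * b" "bil G (e 4) a = 1 - s * b"
    using s bil_sym[OF sym, of \<nu> "e 4"] by (simp_all add: a_def bil_simps e4 \<nu> b_def[symmetric] algebra_simps)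
  have q0: "bil G a a \<noteq> 0" unfolding q by (simp add: s_def)
  have "2 * bil G (e 4) a / bil G a a = 1"
    using q0 unfolding q by (simp add: divide_simps)
  then have "f 4 = \<nu>" using s by (simp add: f_def a_def)
  moreover have "bil G (f i) (f j) = bil G (e i) (e j)" for i j
  proof -
    have "bil G (f i) (f j) = (s * s) * (bil G (e i) (e j) - 4 * bil G (e i) a * bil G (e j) a / bil G a a
       + 4 * bil G (e i) a * bil G (e j) a / bil G a a)"
      unfolding f_def using q0 bil_sym[OF sym, of a "e j"]
      by (simp add: bil_simps field_simps)
    then show ?thesis by (simp add: s)
  qed
  ultimately show ?thesis using o by (intro exI[of _ f]) (simp add: orthonormal_def)
qed

text \<open>For an orthonormal \<open>f\<close> ending in \<open>\<nu>\<close>, the operator maps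
  \<open>wedge (f 1) (f 2)\<close> to a multiple \<open>c\<close> of
  \<open>wedge (f 3) (f 4)\<close>, and \<open>c * c = 1\<close> because it is an involution. If
  \<open>c = - 1\<close>, changing the sign of \<open>f 1\<close> reverses the orientation and keeps
  \<open>f 4\<close>.\<close>

lemma ex_adapted_frame:
  assumes \<nu>: "bil G \<nu> \<nu> = 1"
  shows "\<exists>f. hodge_frame G S f \<and> f 4 = \<nu>"
proof -
  obtain e where e: "hodge_frame G S e" using ex_hodge_frame by blast
  then obtain \<delta> where \<delta>: "\<And>A B. A \<in> bivectors \<Longrightarrow> B \<in> bivectors \<Longrightarrow> bil2 G A (S B) = \<delta> * vol A B"
    using hodge_vol by metis
  obtain f where o: "orthonormal G f" and f4: "f 4 = \<nu>"
    using ex_onb_with_last[OF \<nu>] e by (auto simp: hodge_frame_def)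
  define v where "v = vol (wedge (f 1) (f 2)) (wedge (f 3) (f 4))"
  define c where "c = \<delta> * v"
  note t = v_def[symmetric] vol_frame[of f, folded v_def]
  note sc = blin_scale[OF blin_bil2(2) bivectors_wedge] blin_scale[OF blin_vol(2) bivectors_wedge]
  have S12: "S (wedge (f 1) (f 2)) = cscale c (wedge (f 3) (f 4))"
    and S34: "S (wedge (f 3) (f 4)) = cscale c (wedge (f 1) (f 2))"
    by (rule S_eqI[OF \<delta> o], assumption, assumption;
        simp add: sc bil2_onb[OF o] t vol_alternating(1-4) c_def bivectors_scale bivectors_wedge)+
  have "wedge (f 1) (f 2) = cscale c (cscale c (wedge (f 1) (f 2)))"
    using S_S[OF bivectors_wedge, of "f 1" "f 2"] by (simp add: S12 S34 S_scale bivectors_wedge)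
  then have "bil2 G (wedge (f 1) (f 2)) (wedge (f 1) (f 2)) = bil2 G (wedge (f 1) (f 2)) (cscale c (cscale c (wedge (f 1) (f 2))))"
    by simp
  then have "c * c = 1"
    by (simp add: blin_scale[OF blin_bil2(2)] bivectors_scale bivectors_wedge bil2_onb[OF o])
  then consider "c = 1" | "c = - 1" by (metis square_eq_1_iff)
  then show ?thesis
  proof cases
    case 1
    then have "oriented_onb G S f" using o S12 by (simp add: oriented_onb_def cscale_def vec_eq_iff)
    then show ?thesis using hodge_frameI f4 by blast
  next
    case 2
    have "S (wedge (- f 1) (f 2)) = S (cscale (-1) (wedge (f 1) (f 2)))"
      by (rule arg_cong[where f = S]) (simp add: vec_eq_iff)
    also have "\<dots> = wedge (f 3) (f 4)"
      unfolding S_scale[OF bivectors_wedge] S12 2 by (simp add: vec_eq_iff)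
    finally have "oriented_onb G S (f(1 := - f 1))"
      using o by (auto simp: oriented_onb_def orthonormal_def bil_simps)
    then show ?thesis using hodge_frameI f4 by (intro exI[of _ "f(1 := - f 1)"]) auto
  qed
qed

end

section \<open>The half Weyl tensors\<close>

text \<open>In dimension 4 each off-diagonal contraction has just two nonzero terms, so it equates
  two components up to sign. The diagonal contractions are four linear equations in the six
  components \<open>w i j i j\<close>; they force the values on complementary planes to be
  equal.\<close>

lemma weyl_duality_relations:
  fixes w :: "4 \<Rightarrow> 4 \<Rightarrow> 4 \<Rightarrow> 4 \<Rightarrow> complex"
  assumes s12: "\<And>i j k l. w i j k l = - w j i k l" and s34: "\<And>i j k l. w i j k l = - w i j l k"
    and tr: "\<And>i k. (\<Sum>j\<in>UNIV. w i j k j) = 0"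
  shows "w 3 4 3 4 = w 1 2 1 2" "w 2 4 3 4 = - w 1 2 1 3" "w 2 3 3 4 = w 1 2 1 4" "w 1 4 3 4 = w 1 2 2 3"
    "w 1 3 3 4 = - w 1 2 2 4" "w 2 4 2 4 = w 1 3 1 3" "w 2 3 2 4 = - w 1 3 1 4" "w 1 4 2 4 = - w 1 3 2 3"
    "w 2 3 2 3 = w 1 4 1 4"
    "w 1 2 1 2 + w 1 3 1 3 + w 1 4 1 4 = 0"
proof -
  have z: "w i i k l = 0" "w k l i i = 0" for i k l
    using s12[of i i k l] s34[of k l i i] by simp_all
  have t: "w i 1 k 1 + w i 2 k 2 + w i 3 k 3 + w i 4 k 4 = 0" for i k
    using tr[of i k] by (simp add: sum_4)
  have d: "w j i j i = w i j i j" for i j using s12[of j i j i] s34[of i j j i] by simp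
  have "w 1 2 1 2 + w 1 3 1 3 + w 1 4 1 4 = 0" "w 1 2 1 2 + w 2 3 2 3 + w 2 4 2 4 = 0"
     "w 1 3 1 3 + w 2 3 2 3 + w 3 4 3 4 = 0" "w 1 4 1 4 + w 2 4 2 4 + w 3 4 3 4 = 0"
    using t[of 1 1] t[of 2 2] t[of 3 3] t[of 4 4]
    by (simp_all add: z d[of 2 1] d[of 3 1] d[of 4 1] d[of 3 2] d[of 4 2] d[of 4 3])
  then show "w 3 4 3 4 = w 1 2 1 2" "w 2 4 2 4 = w 1 3 1 3" "w 2 3 2 3 = w 1 4 1 4"
    "w 1 2 1 2 + w 1 3 1 3 + w 1 4 1 4 = 0"
    by algebra+
  show "w 2 4 3 4 = - w 1 2 1 3" using t[of 2 3] s12[of 2 1 3 1] s34[of 1 2 3 1] by (simp add: z add_eq_0_iff)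
  show "w 2 3 3 4 = w 1 2 1 4" using t[of 2 4] s12[of 2 1 4 1] s34[of 1 2 4 1] s34[of 2 3 4 3] by (simp add: z add_eq_0_iff)
  show "w 1 4 3 4 = w 1 2 2 3" using t[of 1 3] s34[of 1 2 3 2] by (simp add: z add_eq_0_iff)
  show "w 1 3 3 4 = - w 1 2 2 4" using t[of 1 4] s34[of 1 2 4 2] s34[of 1 3 4 3] by (simp add: z add_eq_0_iff)
  show "w 2 3 2 4 = - w 1 3 1 4" using t[of 3 4] s12[of 3 1 4 1] s34[of 1 3 4 1] s12[of 3 2 4 2] s34[of 2 3 4 2]
    by (simp add: z add_eq_0_iff)
  show "w 1 4 2 4 = - w 1 3 2 3" using t[of 1 2] by (simp add: z add_eq_0_iff)
qed

locale oriented_metric = framed_metric U G for U :: "(complex^4) set" and G +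
  fixes S :: "complex^4 \<Rightarrow> complex^4^4 \<Rightarrow> complex^4^4"
  assumes hodge: "x \<in> U \<Longrightarrow> is_hodge (G x) (S x)"
begin

lemma hodge_at: "x \<in> U \<Longrightarrow> hodge_operator (G x) (S x)"
  by unfold_locales (simp_all add: sym_G nondeg_G hodge)

abbreviation "Wf x \<equiv> biform (weyl G x)"
abbreviation "Hf x \<equiv> biform (susp G x)"

text \<open>The Hodge operator permutes the basis bivectors of a frame up to sign; on them the claim
  becomes the relations above combined with pair symmetry.\<close>

lemma weyl_S_S:
  assumes x: "x \<in> U" and A: "A \<in> bivectors" and B: "B \<in> bivectors"
  shows "Wf x (S x A) (S x B) = Wf x A B"
proof -
  interpret hodge_operator "G x" "S x" by (rule hodge_at[OF x])
  obtain e where e: "hodge_frame (G x) (S x) e" using ex_hodge_frame by blast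
  then have o: "orthonormal (G x) e" by (simp add: hodge_frame_def)
  define w where "w i j k l = weyl G x (e i) (e j) (e k) (e l)" for i j k l
  have W: "Wf x (wedge (e i) (e j)) (wedge (e k) (e l)) = w i j k l" for i j k l
    by (simp add: biform_weyl_wedge[OF x] w_def)
  have pair: "w i j k l = w k l i j" for i j k l unfolding w_def by (rule weyl_pair[OF x])
  note pairs = pair[of 1 3 1 2] pair[of 1 4 1 2] pair[of 1 4 1 3] pair[of 2 3 1 2] pair[of 2 3 1 3] pair[of 2 3 1 4]
    pair[of 2 4 1 2] pair[of 2 4 1 3] pair[of 2 4 1 4] pair[of 2 4 2 3] pair[of 3 4 1 2] pair[of 3 4 1 3]
    pair[of 3 4 1 4] pair[of 3 4 2 3] pair[of 3 4 2 4]
  note rel = weyl_duality_relations[of w, unfolded w_def, OF weyl_skew12 weyl_skew34[OF x] weyl_trace[OF x o], folded w_def]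
  note sc = blin_scale[OF blin_biform(1) bivectors_wedge] blin_scale[OF blin_biform(2) bivectors_wedge]
  show ?thesis
    by (rule blin_ext4[where f = "\<lambda>A. Wf x (S x A) (S x B)", OF o blin_S[OF blin_biform(1)] blin_biform(1) _ _ _ _ _ _ A];
        rule blin_ext4[OF o blin_S[OF blin_biform(2)] blin_biform(2) _ _ _ _ _ _ B])
       (simp_all add: hodge_frame_table[OF e] sc W rel pairs)
qed

text \<open>\<open>\<sigma>\<close> is the trace of \<open>h\<close>. On the diagonal,
  \<open>h 1 1 + h 2 2\<close> is exchanged with
  \<open>h 3 3 + h 4 4 = \<sigma> - (h 1 1 + h 2 2)\<close>; the off-diagonal components change
  sign.\<close>

lemma susp_S_S:
  assumes x: "x \<in> U"
  obtains \<sigma> where "\<And>A B. A \<in> bivectors \<Longrightarrow> B \<in> bivectors \<Longrightarrow>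
    Hf x (S x A) (S x B) = \<sigma> * bil2 (G x) A B - Hf x A B"
proof -
  interpret hodge_operator "G x" "S x" by (rule hodge_at[OF x])
  obtain e where e: "hodge_frame (G x) (S x) e" using ex_hodge_frame by blast
  then have o: "orthonormal (G x) e" by (simp add: hodge_frame_def)
  define h where "h i j = nricci G x (e i) (e j)" for i j
  have H: "Hf x (wedge (e i) (e j)) (wedge (e k) (e l))
      = h i k * (if j = l then 1 else 0) + h j l * (if i = k then 1 else 0)
        - h i l * (if j = k then 1 else 0) - h j k * (if i = l then 1 else 0)" for i j k l
    using o by (simp add: biform_susp_wedge[OF x] susp_def h_def orthonormal_def)
  have sym: "h i j = h j i" for i j unfolding h_def by (rule nricci_sym[OF x])
  define \<sigma> where "\<sigma> = h 1 1 + h 2 2 + h 3 3 + h 4 4"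
  note sc = blin_scale[OF blin_biform(1) bivectors_wedge] blin_scale[OF blin_biform(2) bivectors_wedge]
  have bl: "blin (\<lambda>A. \<sigma> * bil2 (G x) A B - Hf x A B)" "blin (\<lambda>B. \<sigma> * bil2 (G x) A B - Hf x A B)" for A B
    using blin_bil2(1)[of "G x" B] blin_bil2(2)[of "G x" A] blin_biform(1)[of "susp G x" B] blin_biform(2)[of "susp G x" A]
    by (simp_all add: blin_def algebra_simps)
  show ?thesis
  proof (rule that)
    fix A B :: "complex^4^4" assume A: "A \<in> bivectors" and B: "B \<in> bivectors"
    show "Hf x (S x A) (S x B) = \<sigma> * bil2 (G x) A B - Hf x A B"
      by (rule blin_ext4[where f = "\<lambda>A. Hf x (S x A) (S x B)", OF o blin_S[OF blin_biform(1)] bl(1) _ _ _ _ _ _ A];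
          rule blin_ext4[OF o blin_S[OF blin_biform(2)] bl(2) _ _ _ _ _ _ B])
         (simp_all add: hodge_frame_table[OF e] sc H bil2_onb[OF o] \<sigma>_def sym[of 2 1] sym[of 3 1] sym[of 4 1]
           sym[of 3 2] sym[of 4 2] sym[of 4 3])
  qed
qed

end

lemma onb_pair_sum:
  fixes e :: "4 \<Rightarrow> complex^4"
  assumes "\<And>B. blin (\<lambda>A. F A B)" "\<And>A. blin (F A)"
  shows "(\<Sum>k\<in>UNIV. \<Sum>l\<in>UNIV. F (wedge (e k) (e l)) (wedge (e k) (e l)))
    = 2 * (F (wedge (e 1) (e 2)) (wedge (e 1) (e 2)) + F (wedge (e 1) (e 3)) (wedge (e 1) (e 3))
      + F (wedge (e 1) (e 4)) (wedge (e 1) (e 4)) + F (wedge (e 2) (e 3)) (wedge (e 2) (e 3))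
      + F (wedge (e 2) (e 4)) (wedge (e 2) (e 4)) + F (wedge (e 3) (e 4)) (wedge (e 3) (e 4)))"
proof -
  have sw: "F (wedge X Y) (wedge X Y) = F (wedge Y X) (wedge Y X)" for X Y
    using blin_wedge_skew[OF assms(1), of Y X "wedge X Y"] blin_wedge_skew[OF assms(2), of "wedge Y X" X Y]
    by simp
  have z: "F (wedge X X) (wedge X X) = 0" for X
    by (simp add: wedge_self blin_zero[OF assms(2)])
  show ?thesis
    unfolding sum_4 z sw[of "e 2" "e 1"] sw[of "e 3" "e 1"] sw[of "e 4" "e 1"] sw[of "e 3" "e 2"]
      sw[of "e 4" "e 2"] sw[of "e 4" "e 3"] by simp
qed

definition blmap :: "(complex^'n^'n \<Rightarrow> complex^'n^'n) \<Rightarrow> bool" where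
  "blmap g \<longleftrightarrow> (\<forall>A\<in>bivectors. g A \<in> bivectors) \<and> (\<forall>a b. blin (\<lambda>A. g A $ a $ b))"

lemma blmap_mem: "blmap g \<Longrightarrow> A \<in> bivectors \<Longrightarrow> g A \<in> bivectors"
  by (simp add: blmap_def)

lemma blmap_add: "blmap g \<Longrightarrow> A \<in> bivectors \<Longrightarrow> B \<in> bivectors \<Longrightarrow> g (A + B) = g A + g B"
  and blmap_scale: "blmap g \<Longrightarrow> A \<in> bivectors \<Longrightarrow> g (cscale c A) = cscale c (g A)"
  by (simp_all add: blmap_def blin_def vec_eq_iff)

lemma blin_blmap: "blin f \<Longrightarrow> blmap g \<Longrightarrow> blin (\<lambda>A. f (g A))"
  by (rule blinI) (simp_all add: blmap_add blmap_scale blmap_mem blin_add blin_scale)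

lemma blmap_blmap:
  fixes f :: "complex^'n^'n \<Rightarrow> complex^'n^'n"
  assumes "blmap f" "blmap g"
  shows "blmap (\<lambda>A. f (g A))"
  unfolding blmap_def
proof (intro conjI allI ballI)
  show "f (g A) \<in> bivectors" if "A \<in> bivectors" for A using assms that by (simp add: blmap_mem)
  show "blin (\<lambda>A. f (g A) $ a $ b)" for a b
    by (rule blin_blmap[OF _ assms(2)]) (use assms(1) in \<open>simp add: blmap_def\<close>)
qed

context oriented_metric
begin

lemma blmap_eproj: "x \<in> U \<Longrightarrow> blmap (eproj s (S x))"
proof -
  assume x: "x \<in> U"
  interpret hodge_operator "G x" "S x" by (rule hodge_at[OF x])
  have "eproj s (S x) A \<in> bivectors" if "A \<in> bivectors" for A
    unfolding eproj_def by (intro bivectors_scale bivectors_add S_bivector that)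
  moreover have "blin (\<lambda>A. eproj s (S x) A $ a $ b)" for a b
    using blin_S_nth[of a b] by (simp add: eproj_def blin_def algebra_simps add_divide_distrib)
  ultimately show ?thesis by (simp add: blmap_def)
qed

lemma blin_eproj:
  assumes x: "x \<in> U" and f: "blin f" and A: "A \<in> bivectors"
  shows "f (eproj s (S x) A) = (f A + s * f (S x A)) / 2"
proof -
  interpret hodge_operator "G x" "S x" by (rule hodge_at[OF x])
  show ?thesis
    by (simp add: eproj_def blin_scale[OF f] blin_add[OF f] bivectors_add bivectors_scale S_bivector A)
qed

text \<open>\<open>W\<close> commutes with the Hodge operator while the trace-free part of \<open>h \<and> I\<close> anticommutes with it, hence only
  \<open>W\<close> and a trace remain after compression to an eigenbundle.\<close>

lemma bil2_half_weyl:
  assumes x: "x \<in> U" and s: "s * s = 1" and A: "A \<in> bivectors" and B: "B \<in> bivectors"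
  shows "bil2 (G x) (half_weyl s G S x A) B = Wf x A (eproj s (S x) B)"
proof -
  interpret hodge_operator "G x" "S x" by (rule hodge_at[OF x])
  obtain e where e: "hodge_frame (G x) (S x) e" using ex_hodge_frame by blast
  then have o: "orthonormal (G x) e" by (simp add: hodge_frame_def)
  obtain \<sigma> where \<sigma>: "\<And>A B. A \<in> bivectors \<Longrightarrow> B \<in> bivectors \<Longrightarrow>
    Hf x (S x A) (S x B) = \<sigma> * bil2 (G x) A B - Hf x A B"
    using susp_S_S[OF x] by blast
  let ?P = "eproj s (S x)"
  define K where "K B = ?P (curvop G x (?P B))" for B
  note P = blmap_mem[OF blmap_eproj[OF x]]
  have K: "blmap K"
    unfolding K_def
    by (intro blmap_blmap[OF blmap_eproj[OF x] blmap_blmap[OF _ blmap_eproj[OF x]]])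
       (simp add: blmap_def curvop_bivector[OF x] blin_curvop)
  have Psym: "bil2 (G x) (?P A) B = bil2 (G x) A (?P B)" if "A \<in> bivectors" "B \<in> bivectors" for A B
    using that by (simp add: blin_eproj[OF x blin_bil2(1)] blin_eproj[OF x blin_bil2(2)] bil2_S_left)
  have W1: "Wf x (S x A) B = Wf x A (S x B)" if "A \<in> bivectors" "B \<in> bivectors" for A B
    using weyl_S_S[OF x that(1) S_bivector[OF that(2)]] that by (simp add: S_S)
  have H1: "Hf x (S x A) B = \<sigma> * bil2 (G x) A (S x B) - Hf x A (S x B)" if "A \<in> bivectors" "B \<in> bivectors" for A B
    using \<sigma>[OF that(1) S_bivector[OF that(2)]] that by (simp add: S_S)
  have core: "bil2 (G x) (K A) B = Wf x A (?P B) + \<sigma> / 2 * bil2 (G x) A (?P B)"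
    if A: "A \<in> bivectors" and B: "B \<in> bivectors" for A B
  proof -
    have "bil2 (G x) (K A) B = biform (R4 G x) (?P A) (?P B)"
      unfolding K_def using A B by (simp add: Psym P curvop_bivector[OF x] bil2_curvop[OF x])
    also have "\<dots> = Hf x (?P A) (?P B) + Wf x (?P A) (?P B)" by (rule biform_R4)
    also have "Wf x (?P A) (?P B) = Wf x A (?P B)"
    proof -
      have "Wf x (?P A) (?P B) = ((Wf x A B + s * Wf x A (S x B)) + s * (Wf x A (S x B) + s * Wf x A B)) / 4"
        by (simp add: blin_eproj[OF x blin_biform(1)] blin_eproj[OF x blin_biform(2)] A B P
            W1 weyl_S_S[OF x A B] S_bivector S_S distrib_left add_divide_distrib)
      also have "\<dots> = (Wf x A B + s * Wf x A (S x B)) / 2"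
        using s by (simp add: distrib_left mult.assoc[symmetric])
      finally show ?thesis by (simp add: blin_eproj[OF x blin_biform(2)] B)
    qed
    also have "Hf x (?P A) (?P B) = \<sigma> / 2 * bil2 (G x) A (?P B)"
    proof -
      have "Hf x (?P A) (?P B) = ((Hf x A B + s * Hf x A (S x B))
          + s * ((\<sigma> * bil2 (G x) A (S x B) - Hf x A (S x B)) + s * (\<sigma> * bil2 (G x) A B - Hf x A B))) / 4"
        by (simp add: blin_eproj[OF x blin_biform(1)] blin_eproj[OF x blin_biform(2)] A B P
            H1 \<sigma>[OF A B] S_bivector S_S distrib_left add_divide_distrib diff_divide_distrib)
      also have "\<dots> = \<sigma> / 2 * ((bil2 (G x) A B + s * bil2 (G x) A (S x B)) / 2)"
        using s by (simp add: distrib_left right_diff_distrib mult.assoc[symmetric])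
      finally show ?thesis by (simp add: blin_eproj[OF x blin_bil2(2)] B)
    qed
    finally show ?thesis by simp
  qed
  \<comment> \<open>The part of \<open>W\<close> on the eigenbundle has trace zero by trace-freeness
    and the first Bianchi identity. What remains is \<open>\<sigma> / 2\<close> times the
    projection, whose rank is 3, so the trace part to be removed is the \<open>\<sigma>\<close> term
    of \<open>core\<close>.\<close>
  have tr: "trace2 K / 3 = \<sigma> / 2"
  proof -
    define w where "w i j k l = weyl G x (e i) (e j) (e k) (e l)" for i j k l
    have W: "Wf x (wedge (e i) (e j)) (wedge (e k) (e l)) = w i j k l" for i j k l
      by (simp add: biform_weyl_wedge[OF x] w_def)
    note sc = blin_scale[OF blin_biform(2) bivectors_wedge] blin_scale[OF blin_bil2(2) bivectors_wedge]
    note rel = weyl_duality_relations[of w, unfolded w_def, OF weyl_skew12 weyl_skew34[OF x] weyl_trace[OF x o], folded w_def]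
    have d: "w 1 2 1 2 + (w 1 3 1 3 + w 1 4 1 4) = 0" using rel(10) by (simp add: add.assoc)
    have b: "w 1 2 3 4 + w 1 4 2 3 - w 1 3 2 4 = 0"
      using weyl_bianchi[OF x, of "e 1" "e 2" "e 3" "e 4"] weyl_pair[OF x, of "e 2" "e 3" "e 1" "e 4"]
        weyl_skew12[of x "e 3" "e 1" "e 2" "e 4"] by (simp add: w_def)
    have pr: "w 3 4 1 2 = w 1 2 3 4" "w 2 3 1 4 = w 1 4 2 3" "w 2 4 1 3 = w 1 3 2 4"
      unfolding w_def by (rule weyl_pair[OF x])+
    have "trace2 K = (1/2) * (\<Sum>k\<in>UNIV. \<Sum>l\<in>UNIV. bil2 (G x) (K (wedge (e k) (e l))) (wedge (e k) (e l)))"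
      by (rule trace2_frame[OF o sym_G[OF x]]) (use K in \<open>auto simp: blmap_def\<close>)
    also have "\<dots> = (\<Sum>p\<leftarrow>[(1,2),(1,3),(1,4),(2,3),(2,4),(3,4)].
        bil2 (G x) (K (wedge (e (fst p)) (e (snd p)))) (wedge (e (fst p)) (e (snd p))))"
      by (subst onb_pair_sum[where F = "\<lambda>A B. bil2 (G x) (K A) B", OF blin_blmap[OF blin_bil2(1) K] blin_bil2(2)])
         simp
    also have "\<dots> = (w 1 2 1 2 + w 1 3 1 3 + w 1 4 1 4) + s * (w 1 2 3 4 + w 1 4 2 3 - w 1 3 2 4) + 3 * (\<sigma> / 2)"
      by (simp add: core bivectors_wedge blin_eproj[OF x blin_biform(2)] blin_eproj[OF x blin_bil2(2)]
          hodge_frame_table[OF e] sc W rel pr bil2_onb[OF o]) (simp add: field_simps d)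
    also have "\<dots> = 3 * (\<sigma> / 2)" unfolding b rel(10) by simp
    finally show ?thesis by simp
  qed
  have "half_weyl s G S x A = K A + cscale (- (\<sigma> / 2)) (?P A)"
    by (simp add: half_weyl_def Let_def K_def[symmetric] K_def[abs_def, symmetric] tr vec_eq_iff)
  then show ?thesis
    by (simp add: blin_add[OF blin_bil2(1)] blin_scale[OF blin_bil2(1)] A B P blmap_mem[OF K] bivectors_scale core Psym)
qed

end

locale self_dual_metric = oriented_metric +
  assumes self_dual: "x \<in> U \<Longrightarrow> A \<in> bivectors \<Longrightarrow> weyl_minus G S x A = 0"
    and hol_S: "A \<in> bivectors \<Longrightarrow> hol_on (\<lambda>y. S y A $ i $ j) U"
begin

text \<open>By \<open>bil2_half_weyl\<close> the anti-self-dual part pairs as \<open>W\<close> with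
  its second argument projected to the eigenvalue -1; its vanishing is the claim.\<close>

lemma weyl_S_right:
  assumes x: "x \<in> U" and A: "A \<in> bivectors" and B: "B \<in> bivectors"
  shows "Wf x A (S x B) = Wf x A B"
proof -
  have "bil2 (G x) 0 B = Wf x A (eproj (- 1) (S x) B)"
    using bil2_half_weyl[OF x _ A B, of "-1"] self_dual[OF x A] by simp
  then show ?thesis
    by (simp add: blin_eproj[OF x blin_biform(2) B] blin_zero[OF blin_bil2(1)])
qed

lemma bil2_weyl_plus:
  assumes x: "x \<in> U" and A: "A \<in> bivectors" and B: "B \<in> bivectors"
  shows "bil2 (G x) (weyl_plus G S x A) B = Wf x A B"
  using bil2_half_weyl[OF x _ A B, of 1]
  by (simp add: blin_eproj[OF x blin_biform(2) B] weyl_S_right[OF x A B])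

end

section \<open>Umbilic hypersurfaces\<close>

lemma incl_nth [simp]: "incl u $ 1 = u $ 1" "incl u $ 2 = u $ 2" "incl u $ 3 = u $ 3" "incl u $ 4 = 0"
  by (simp_all add: incl_def vector_def)

lemma slice_coord_nth [simp]: "slice_coord y $ 1 = y $ 1" "slice_coord y $ 2 = y $ 2" "slice_coord y $ 3 = y $ 3"
  by (simp_all add: slice_coord_def)

lemma vec4_eqI: "a $ 1 = b $ 1 \<Longrightarrow> a $ 2 = b $ 2 \<Longrightarrow> a $ 3 = b $ 3 \<Longrightarrow> a $ 4 = b $ 4 \<Longrightarrow> a = (b :: complex^4)"
  by (simp add: vec_eq_iff forall_4)

lemma incl_simps: "incl (u + v) = incl u + incl v" "incl (c *s u) = c *s incl u" "incl (- u) = - incl u"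
  "incl (u - v) = incl u - incl v" "incl 0 = 0"
  by (rule vec4_eqI; simp)+

lemma slice_coord_incl [simp]: "slice_coord (incl u) = u"
  by (simp add: vec_eq_iff forall_3)

lemma incl_slice_coord: "y $ 4 = 0 \<Longrightarrow> incl (slice_coord y) = y"
  by (rule vec4_eqI) simp_all

lemma vlin_incl: "vlin incl"
  by (simp add: vlin_def clin_def incl_simps)

lemma hol_on_nth: "hol_on (\<lambda>y. y $ i) (S :: (complex^'n) set)"
proof (rule hol_onI)
  show "((\<lambda>y. y $ i) has_derivative (\<lambda>v. v $ i)) (at x)" for x :: "complex^'n"
    by (rule bounded_linear_imp_has_derivative) (rule bounded_linear_vec_nth)
qed simp

lemma hol_on_clin_fun:
  assumes "clin f"
  shows "hol_on f S"
proof -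
  have "f = (\<lambda>y. \<Sum>i\<in>UNIV. y $ i * f (axis i 1))" using clin_expand[OF assms] by blast
  moreover have "hol_on (\<lambda>y. \<Sum>i\<in>UNIV. y $ i * f (axis i 1)) S"
    by (intro hol_on_sum hol_on_mult hol_on_nth hol_on_const)
  ultimately show ?thesis by simp
qed

lemma vhol_incl: "vhol incl S"
  by (simp add: vhol_def hol_on_clin_fun vlin_nth[OF vlin_incl])

lemma dirderiv_incl: "dirderiv (\<lambda>u. f (incl u)) X u = dirderiv f (incl X) (incl u)"
  by (simp add: dirderiv_def incl_simps)

lemma hol_on_incl: "hol_on f U \<Longrightarrow> hol_on (\<lambda>u. f (incl u)) {u. incl u \<in> U}"
  by (rule hol_on_compose(1)[OF _ vhol_incl]) auto

lemma open_slice: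
  assumes "open U"
  shows "open {u. incl u \<in> U}"
proof -
  have "continuous_on UNIV (\<lambda>u. \<chi> k. incl u $ k)"
    by (intro continuous_on_vec_lambda hol_on_continuous vholD[OF vhol_incl])
  then show ?thesis using assms open_vimage[of U incl] by (simp add: vimage_def vec_lambda_eta)
qed

lemma bil_induced: "bil (induced G u) X Y = bil (G (incl u)) (incl X) (incl Y)"
proof -
  have "bil (G (incl u)) (incl X) (incl Y) = (\<Sum>i\<in>UNIV. X $ i * bil (G (incl u)) (incl (axis i 1)) (incl Y))"
    by (rule clin_expand[OF clin_compose[OF clin_bil_left vlin_incl]])
  also have "\<dots> = (\<Sum>i\<in>UNIV. X $ i * (\<Sum>j\<in>UNIV. Y $ j * bil (G (incl u)) (incl (axis i 1)) (incl (axis j 1))))"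
    by (subst clin_expand[OF clin_compose[OF clin_bil_right vlin_incl], of _ _ Y]) (rule refl)
  finally have e: "bil (G (incl u)) (incl X) (incl Y)
    = (\<Sum>i\<in>UNIV. X $ i * (\<Sum>j\<in>UNIV. Y $ j * bil (G (incl u)) (incl (axis i 1)) (incl (axis j 1))))" .
  have "induced G u $ i $ j = bil (G (incl u)) (incl (axis i 1)) (incl (axis j 1))" for i j
    by (simp add: induced_def)
  then show ?thesis
    unfolding e bil_def[of "induced G u"] by (simp add: sum_distrib_left mult_ac)
qed

text \<open>The hypotheses as seen in one slice chart, where the hypersurface is given by
  \<open>y $ 4 = 0\<close> and parametrized by \<open>incl\<close>.\<close>

locale umbilic_slice = self_dual_metric U G S for U G S +
  assumes nondeg_induced: "incl u \<in> U \<Longrightarrow> nondegenerate (induced G u)"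
    and umbilic: "incl u \<in> U \<Longrightarrow> unit_normal G (incl u) \<nu> \<Longrightarrow>
      second_ff G u \<nu> X Y = mean_curv G u \<nu> * bil (induced G u) X Y"
begin

definition Q where "Q = {u. incl u \<in> U}"

abbreviation "GQ \<equiv> induced G"
abbreviation "gQ u \<equiv> bil (induced G u)"

lemma Q_iff: "u \<in> Q \<longleftrightarrow> incl u \<in> U" by (simp add: Q_def)

lemma Q_metric: "hol_metric Q GQ"
proof
  show "open Q" unfolding Q_def by (rule open_slice[OF open_U])
  show "transpose (GQ u) = GQ u" if "u \<in> Q" for u
    using that by (simp add: vec_eq_iff transpose_def induced_def bil_commute Q_iff)
  show "nondegenerate (GQ u)" if "u \<in> Q" for u
    using that by (simp add: Q_iff nondeg_induced)
  show "hol_on (\<lambda>u. GQ u $ i $ j) Q" for i j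
    unfolding induced_def Q_def using hol_on_incl[OF hol_bil] by simp
qed

sublocale Q: hol_metric Q GQ by (rule Q_metric)

text \<open>The normal field is not normalized, so that no holomorphic square root is needed.\<close>

definition n where "n y = matrix_inv (G y) *v axis 4 1"

text \<open>By \<open>bil_n\<close> this fourth component is \<open>g(n,n)\<close>.\<close>

definition N where "N u = n (incl u) $ 4"

lemma bil_n: "y \<in> U \<Longrightarrow> bil (G y) v (n y) = v $ 4"
  by (simp add: n_def bil_inv_axis)

lemma vhol_n: "vhol n U"
  by (simp add: vhol_def n_def matrix_vector_axis hol_inv)

lemma bil_incl_n: "u \<in> Q \<Longrightarrow> bil (G (incl u)) (incl X) (n (incl u)) = 0"
  "u \<in> Q \<Longrightarrow> bil (G (incl u)) (n (incl u)) (incl X) = 0"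
  "u \<in> Q \<Longrightarrow> bil (G (incl u)) (n (incl u)) (n (incl u)) = N u"
  by (simp_all add: bil_n Q_iff bil_commute[of "incl u" "n (incl u)"] N_def)

lemma tangent_eq_0:
  assumes u: "u \<in> Q" and v: "v $ 4 = 0" "\<And>X. bil (G (incl u)) v (incl X) = 0"
  shows "v = 0"
proof -
  have "slice_coord v = 0"
  proof (rule nondegenerate_eqI'[OF Q.nondeg_G[OF u] Q.sym_G[OF u]])
    fix T
    show "gQ u (slice_coord v) T = gQ u 0 T"
      using v(2)[of T] by (simp add: bil_induced incl_slice_coord[OF v(1)] incl_simps bil_simps)
  qed
  then show ?thesis using incl_slice_coord[OF v(1)] by (simp add: incl_simps)
qed

text \<open>If \<open>g(n,n)\<close> were zero, \<open>n\<close> would be tangent and orthogonal to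
  all tangent vectors, hence zero since the induced metric is nondegenerate; but \<open>n\<close>
  pairs to 1 with the fourth coordinate vector.\<close>

lemma N_nonzero:
  assumes u: "u \<in> Q"
  shows "N u \<noteq> 0"
proof
  assume "N u = 0"
  then have "n (incl u) = 0"
    by (intro tangent_eq_0[OF u]) (simp_all add: bil_incl_n u N_def)
  then have "axis 4 (1::complex) $ (4::4) = 0"
    using bil_n[of "incl u" "axis 4 1"] u by (simp add: Q_iff bil_simps)
  then show False by (simp add: axis_def)
qed

lemma unit_normal_eq:
  assumes u: "u \<in> Q" and \<nu>: "unit_normal G (incl u) \<nu>"
  obtains s where "\<nu> = s *s n (incl u)" "s * s * N u = 1" "s \<noteq> 0"
proof -
  define s where "s = \<nu> $ 4 / N u"
  have "\<nu> - s *s n (incl u) = 0"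
  proof (rule tangent_eq_0[OF u])
    show "(\<nu> - s *s n (incl u)) $ 4 = 0" using N_nonzero[OF u] by (simp add: s_def N_def)
    fix X
    have "bil (G (incl u)) \<nu> (incl X) = 0"
      using \<nu> bil_commute[of "incl u" \<nu> "incl X"] u by (simp add: unit_normal_def Q_iff)
    then show "bil (G (incl u)) (\<nu> - s *s n (incl u)) (incl X) = 0"
      by (simp add: bil_simps bil_incl_n[OF u])
  qed
  then have e: "\<nu> = s *s n (incl u)" by simp
  moreover have "s * s * N u = 1"
    using \<nu> by (simp add: unit_normal_def e bil_simps bil_incl_n[OF u] mult.assoc)
  moreover from this have "s \<noteq> 0" by auto
  ultimately show ?thesis by (rule that)
qed

lemma ex_unit_normal:
  assumes u: "u \<in> Q"
  shows "\<exists>\<nu>. unit_normal G (incl u) \<nu>"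
proof -
  have "csqrt (N u) * csqrt (N u) = N u" using power2_csqrt[of "N u"] by (simp add: power2_eq_square)
  then have "unit_normal G (incl u) ((1 / csqrt (N u)) *s n (incl u))"
    using N_nonzero[OF u] by (simp add: unit_normal_def bil_simps bil_incl_n[OF u])
  then show ?thesis by blast
qed

text \<open>The mean curvature with \<open>n\<close> in place of a unit normal: the fourth component
  of a vector is its product with \<open>n\<close>.\<close>

definition lam where
  "lam u = (1/3) * (\<Sum>i\<in>UNIV. \<Sum>j\<in>UNIV. matrix_inv (GQ u) $ i $ j
      * gam G (incl u) (incl (axis i 1)) (incl (axis j 1)) $ 4)"

definition rho where "rho u = lam u / N u"

lemma hol_N: "hol_on N Q"
  unfolding N_def[abs_def] Q_def using hol_on_incl[OF vholD[OF vhol_n]] .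

lemma hol_rho: "hol_on rho Q"
  unfolding rho_def[abs_def] lam_def
  by (intro hol_on_divide hol_N N_nonzero hol_on_mult hol_on_const hol_on_sum Q.hol_inv
      hol_on_incl[OF vholD[OF vhol_gam], folded Q_def])

text \<open>The umbilic condition is homogeneous in the normal vector, so the factor
  \<open>s\<close> between \<open>\<nu>\<close> and \<open>n\<close> cancels.\<close>

lemma umbilic_lam:
  assumes u: "u \<in> Q"
  shows "gam G (incl u) (incl X) (incl Y) $ 4 = lam u * gQ u X Y"
proof -
  obtain \<nu> where \<nu>: "unit_normal G (incl u) \<nu>" using ex_unit_normal[OF u] by blast
  obtain s where s: "\<nu> = s *s n (incl u)" "s \<noteq> 0" using unit_normal_eq[OF u \<nu>] by metis
  have sf: "second_ff G u \<nu> X Y = s * gam G (incl u) (incl X) (incl Y) $ 4" for X Y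
    using u by (simp add: second_ff_def s(1) bil_simps bil_n Q_iff)
  have "mean_curv G u \<nu> = s * lam u"
    by (simp add: mean_curv_def lam_def sf sum_distrib_left mult_ac)
  then have "s * gam G (incl u) (incl X) (incl Y) $ 4 = s * (lam u * gQ u X Y)"
    using umbilic[of u \<nu> X Y] \<nu> u by (simp add: sf Q_iff)
  then show ?thesis using s(2) by simp
qed

text \<open>The Gauss formula. The Koszul formula for tangent vectors involves only derivatives of
  the induced metric along the slice, which settles the tangent part; \<open>umbilic_lam\<close>
  settles the normal part, divided by \<open>N\<close> because \<open>n\<close> is not a unit
  vector.\<close>

lemma gam_incl:
  assumes u: "u \<in> Q"
  shows "gam G (incl u) (incl X) (incl Y) = incl (gam GQ u X Y) + (rho u * gQ u X Y) *s n (incl u)"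
proof -
  let ?y = "incl u"
  have y: "?y \<in> U" using u by (simp add: Q_iff)
  have d: "dirderiv (\<lambda>y. bil (G y) (incl A) (incl B)) (incl C) ?y = dirderiv (\<lambda>u. gQ u A B) C u" for A B C
    by (simp add: dirderiv_incl[symmetric] bil_induced)
  have "gam G ?y (incl X) (incl Y) - incl (gam GQ u X Y) - (rho u * gQ u X Y) *s n ?y = 0"
  proof (rule tangent_eq_0[OF u])
    show "(gam G ?y (incl X) (incl Y) - incl (gam GQ u X Y) - (rho u * gQ u X Y) *s n ?y) $ 4 = 0"
      using N_nonzero[OF u] by (simp add: umbilic_lam[OF u] rho_def N_def)
    fix T
    have "bil (G ?y) (gam G ?y (incl X) (incl Y)) (incl T) = gQ u (gam GQ u X Y) T"
      by (simp add: koszul[OF y] Q.koszul[OF u] d)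
    then show "bil (G ?y) (gam G ?y (incl X) (incl Y) - incl (gam GQ u X Y) - (rho u * gQ u X Y) *s n ?y) (incl T) = 0"
      by (simp add: bil_simps bil_incl_n[OF u] bil_induced)
  qed
  then show ?thesis by (simp add: algebra_simps)
qed

lemma ex_tangent_frame:
  assumes u: "u \<in> Q" and \<nu>: "unit_normal G (incl u) \<nu>"
  obtains f where "hodge_frame (G (incl u)) (S (incl u)) f" "f 4 = \<nu>"
    "\<And>i. i \<noteq> 4 \<Longrightarrow> f i = incl (slice_coord (f i))"
proof -
  have y: "incl u \<in> U" using u by (simp add: Q_iff)
  interpret hodge_operator "G (incl u)" "S (incl u)" by (rule hodge_at[OF y])
  obtain f where f: "hodge_frame (G (incl u)) (S (incl u)) f" "f 4 = \<nu>"
    using ex_adapted_frame[of \<nu>] \<nu> by (auto simp: unit_normal_def)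
  obtain s where s: "\<nu> = s *s n (incl u)" "s \<noteq> 0" using unit_normal_eq[OF u \<nu>] by metis
  have "f i = incl (slice_coord (f i))" if "i \<noteq> 4" for i
  proof -
    have "bil (G (incl u)) (f i) (f 4) = 0" using f(1) that by (simp add: hodge_frame_def orthonormal_def)
    then have "f i $ 4 = 0" using s by (simp add: f(2) bil_simps bil_n[OF y])
    then show ?thesis by (simp add: incl_slice_coord)
  qed
  with f show ?thesis by (rule that)
qed

definition to4 :: "3 \<Rightarrow> 4" where "to4 i = (if i = 1 then 1 else if i = 2 then 2 else 3)"

lemma tangent_onb:
  assumes "orthonormal (G (incl u)) f" "\<And>i. i \<noteq> 4 \<Longrightarrow> f i = incl (slice_coord (f i))"
  shows "orthonormal (GQ u) (\<lambda>i. slice_coord (f (to4 i)))"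
proof -
  have "to4 i \<noteq> 4" for i by (simp add: to4_def)
  then have "gQ u (slice_coord (f (to4 i))) (slice_coord (f (to4 j))) = (if to4 i = to4 j then 1 else 0)" for i j
    using assms by (simp add: bil_induced orthonormal_def flip: assms(2))
  moreover have "to4 i = to4 j \<longleftrightarrow> i = j" for i j
    using exhaust_3[of i] exhaust_3[of j] by (auto simp: to4_def)
  ultimately show ?thesis by (simp add: orthonormal_def)
qed

lemma Q_framed: "framed_metric Q GQ"
proof
  fix u assume u: "u \<in> Q"
  obtain \<nu> where \<nu>: "unit_normal G (incl u) \<nu>" using ex_unit_normal[OF u] by blast
  obtain f where "hodge_frame (G (incl u)) (S (incl u)) f" "\<And>i. i \<noteq> 4 \<Longrightarrow> f i = incl (slice_coord (f i))"
    using ex_tangent_frame[OF u \<nu>] by metis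
  then show "\<exists>e. orthonormal (GQ u) e" using tangent_onb[of u f] by (auto simp: hodge_frame_def)
qed simp

sublocale Q: framed_metric Q GQ by (rule Q_framed)

end

section \<open>The Gauss and Codazzi equations\<close>

context umbilic_slice
begin

text \<open>The Weingarten map of \<open>n\<close>; it keeps a normal component because the length
  of \<open>n\<close> varies.\<close>

definition Dn where "Dn u X = covd G (\<lambda>_. incl X) n (incl u)"

text \<open>For a local square root of \<open>N\<close>, the mean curvature for the unit normal
  \<open>n / sqrt N\<close> is \<open>H = rho sqrt N\<close>. Then \<open>alpha = sqrt N dH\<close>
  and \<open>sigma = H\<^sup>2\<close>, written without roots; hence
  \<open>dirderiv_sigma\<close>.\<close>

definition alpha where "alpha u X = N u * dirderiv rho X u + rho u * dirderiv N X u / 2"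

definition sigma where "sigma u = rho u * rho u * N u"

text \<open>The product rule applied to \<open>gam_incl\<close> along the slice. The sum of three
  metric terms multiplied by \<open>rho u\<close> is symmetric in \<open>X\<close> and
  \<open>Y\<close>, so it will not contribute to the curvature.\<close>

lemma covd_gam_incl:
  assumes u: "u \<in> Q"
  shows "covd G (\<lambda>_. incl X) (\<lambda>y. gam G y (incl Y) (incl Z)) (incl u)
    = incl (covd GQ (\<lambda>_. X) (\<lambda>u. gam GQ u Y Z) u)
      + (dirderiv rho X u * gQ u Y Z + rho u * (gQ u (gam GQ u X Y) Z + gQ u Y (gam GQ u X Z) + gQ u X (gam GQ u Y Z)))
          *s n (incl u)
      + (rho u * gQ u Y Z) *s Dn u X"
proof -
  note Qo = Q.open_U
  let ?y = "incl u"
  have hn: "hol_on (\<lambda>u. n (incl u) $ k) Q" for k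
    unfolding Q_def by (rule hol_on_incl[OF vholD[OF vhol_n]])
  have inc: "hol_on (\<lambda>u. incl (gam GQ u Y Z) $ k) Q"
    "dirderiv (\<lambda>u. incl (gam GQ u Y Z) $ k) X u = incl (vdd (\<lambda>u. gam GQ u Y Z) X u) $ k" for k
    using hol_on_clin[where F = "\<lambda>_ a. incl a $ k", OF Qo vlin_nth[OF vlin_incl] hol_on_const Q.vhol_gam]
      dirderiv_clin[where F = "\<lambda>_ a. incl a $ k", OF Qo vlin_nth[OF vlin_incl] hol_on_const Q.vhol_gam u]
    by simp_all
  have "vdd (\<lambda>y. gam G y (incl Y) (incl Z)) (incl X) ?y
    = incl (vdd (\<lambda>u. gam GQ u Y Z) X u)
      + (dirderiv rho X u * gQ u Y Z + rho u * (gQ u (gam GQ u X Y) Z + gQ u Y (gam GQ u X Z))) *s n ?y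
      + (rho u * gQ u Y Z) *s vdd n (incl X) ?y"
    unfolding vec_eq_iff
  proof
    fix k
    have "dirderiv (\<lambda>y. gam G y (incl Y) (incl Z) $ k) (incl X) ?y
        = dirderiv (\<lambda>u. gam G (incl u) (incl Y) (incl Z) $ k) X u"
      by (rule dirderiv_incl[symmetric])
    also have "\<dots> = dirderiv (\<lambda>u. incl (gam GQ u Y Z) $ k + (rho u * gQ u Y Z) * n (incl u) $ k) X u"
      by (rule dirderiv_cong[OF _ Qo u]) (simp add: gam_incl)
    also have "\<dots> = incl (vdd (\<lambda>u. gam GQ u Y Z) X u) $ k
        + ((dirderiv rho X u * gQ u Y Z + rho u * dirderiv (\<lambda>u. gQ u Y Z) X u) * n ?y $ k
           + (rho u * gQ u Y Z) * dirderiv (\<lambda>u. n (incl u) $ k) X u)"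
      by (simp add: dirderiv_add[OF inc(1) hol_on_mult[OF hol_on_mult[OF hol_rho Q.hol_bil] hn] u] inc(2)
          dirderiv_mult[OF hol_on_mult[OF hol_rho Q.hol_bil] hn u] dirderiv_mult[OF hol_rho Q.hol_bil u])
    finally show "vdd (\<lambda>y. gam G y (incl Y) (incl Z)) (incl X) ?y $ k
      = (incl (vdd (\<lambda>u. gam GQ u Y Z) X u)
      + (dirderiv rho X u * gQ u Y Z + rho u * (gQ u (gam GQ u X Y) Z + gQ u Y (gam GQ u X Z))) *s n ?y
      + (rho u * gQ u Y Z) *s vdd n (incl X) ?y) $ k"
      by (simp add: Q.dirderiv_bil[OF u] dirderiv_incl[of "\<lambda>y. n y $ k"] algebra_simps)
  qed
  moreover have "gam G ?y (incl X) (gam G ?y (incl Y) (incl Z))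
     = incl (gam GQ u X (gam GQ u Y Z)) + (rho u * gQ u X (gam GQ u Y Z)) *s n ?y
       + (rho u * gQ u Y Z) *s gam G ?y (incl X) (n ?y)"
    by (simp add: gam_incl[OF u, of Y Z] gam_simps gam_incl[OF u])
  ultimately show ?thesis
    unfolding Dn_def covd_eq[of G "incl X" "\<lambda>y. gam G y (incl Y) (incl Z)"] covd_eq[of G "incl X" n]
      covd_eq[of GQ X "\<lambda>u. gam GQ u Y Z"]
    by (simp add: incl_simps vec_eq_iff algebra_simps)
qed

text \<open>Gauss and Codazzi in one vector equation: \<open>covd_gam_incl\<close> antisymmetrized
  in \<open>X\<close> and \<open>Y\<close>. Pairing with tangent vectors and with \<open>n\<close>
  separates the two.\<close>

lemma curv_incl:
  assumes u: "u \<in> Q"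
  shows "curv G (incl u) (incl X) (incl Y) (incl Z) = incl (curv GQ u X Y Z)
    + (dirderiv rho Y u * gQ u X Z - dirderiv rho X u * gQ u Y Z) *s n (incl u)
    + (rho u * gQ u X Z) *s Dn u Y - (rho u * gQ u Y Z) *s Dn u X"
proof -
  show ?thesis
    unfolding curv_def covd_gam_incl[OF u] Q.gam_sym[OF u, of Y X]
    by (simp add: incl_simps vec_eq_iff algebra_simps)
qed

text \<open>Obtained by differentiating \<open>g(n,T) = 0\<close> and \<open>g(n,n) = N\<close>
  along the slice.\<close>

lemma bil_Dn:
  assumes u: "u \<in> Q"
  shows "bil (G (incl u)) (Dn u X) (incl T) = - (rho u * N u * gQ u X T)"
    and "bil (G (incl u)) (Dn u X) (n (incl u)) = dirderiv N X u / 2"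
proof -
  let ?y = "incl u"
  have y: "?y \<in> U" using u by (simp add: Q_iff)
  have "dirderiv (\<lambda>y. bil (G y) (n y) (incl T)) (incl X) ?y = dirderiv (\<lambda>y. 0) (incl X) ?y"
    by (rule dirderiv_cong[OF _ open_U y]) (simp add: bil_commute[of _ "n _"] bil_n)
  moreover have "bil (G ?y) (n ?y) (gam G ?y (incl X) (incl T)) = lam u * gQ u X T"
    by (simp add: bil_commute[OF y, of "n ?y" "gam G ?y (incl X) (incl T)"] bil_n[OF y] umbilic_lam[OF u])
  ultimately have "bil (G ?y) (Dn u X) (incl T) + lam u * gQ u X T = 0"
    using bil_covd(2)[OF vhol_n vhol_const y, of "incl T" "incl X"] by (simp add: Dn_def)
  then show "bil (G ?y) (Dn u X) (incl T) = - (rho u * N u * gQ u X T)"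
    using N_nonzero[OF u] by (simp add: rho_def add_eq_0_iff2)
  have "dirderiv N X u = dirderiv (\<lambda>y. n y $ 4) (incl X) ?y"
    unfolding N_def[abs_def] by (rule dirderiv_incl)
  also have "\<dots> = dirderiv (\<lambda>y. bil (G y) (n y) (n y)) (incl X) ?y"
    by (rule dirderiv_cong[OF _ open_U y]) (simp add: bil_n)
  also have "\<dots> = 2 * bil (G ?y) (Dn u X) (n ?y)"
    using bil_covd(2)[OF vhol_n vhol_n y, of "incl X"] bil_commute[OF y, of "n ?y" "Dn u X"] by (simp add: Dn_def)
  finally show "bil (G ?y) (Dn u X) (n ?y) = dirderiv N X u / 2" by simp
qed

lemma gauss:
  assumes u: "u \<in> Q"
  shows "R4 G (incl u) (incl X) (incl Y) (incl Z) (incl T)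
    = R4 GQ u X Y Z T - sigma u * (gQ u X Z * gQ u Y T - gQ u Y Z * gQ u X T)"
  by (simp add: curv_incl[OF u] bil_simps bil_Dn[OF u] bil_incl_n[OF u] bil_induced[symmetric] sigma_def algebra_simps)

lemma codazzi:
  assumes u: "u \<in> Q"
  shows "R4 G (incl u) (incl X) (incl Y) (incl Z) (n (incl u)) = alpha u Y * gQ u X Z - alpha u X * gQ u Y Z"
  by (simp add: curv_incl[OF u] bil_simps bil_Dn[OF u] bil_incl_n[OF u] alpha_def algebra_simps)

lemma dirderiv_sigma: "u \<in> Q \<Longrightarrow> dirderiv sigma X u = 2 * rho u * alpha u X"
  unfolding sigma_def[abs_def] alpha_def
  by (simp only: dirderiv_mult[OF hol_on_mult[OF hol_rho hol_rho] hol_N] dirderiv_mult[OF hol_rho hol_rho])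
     (simp add: field_simps)

lemma clin_alpha: "u \<in> Q \<Longrightarrow> clin (alpha u)"
  unfolding alpha_def[abs_def] times_divide_eq_right[symmetric] divide_inverse
  by (intro clin_intros clin_dirderiv[OF hol_rho] clin_dirderiv[OF hol_N])

section \<open>Vanishing of the Weyl tensor along an umbilic hypersurface\<close>

text \<open>Both claims express that \<open>\<gamma>\<close> vanishes. The first identifies the
  mixed components of \<open>h\<close> with \<open>alpha\<close>; it is what later matches the
  normal terms in the covariant derivative of \<open>h\<close> with the derivative of
  \<open>sigma\<close>.\<close>

lemma weyl_normal:
  assumes u: "u \<in> Q"
  shows "nricci G (incl u) (incl X) (n (incl u)) = alpha u X"
    and "weyl G (incl u) (incl X) (incl Y) (incl Z) (n (incl u)) = 0"
proof -
  let ?y = "incl u"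
  have y: "?y \<in> U" using u by (simp add: Q_iff)
  define \<gamma> where "\<gamma> X = alpha u X - nricci G ?y (incl X) (n ?y)" for X
  have W: "weyl G ?y (incl X) (incl Y) (incl Z) (n ?y) = \<gamma> Y * gQ u X Z - \<gamma> X * gQ u Y Z" for X Y Z
    by (simp add: weyl_def codazzi[OF u] susp_def bil_incl_n[OF u] bil_induced[symmetric] \<gamma>_def algebra_simps)
  have cg: "clin \<gamma>"
    unfolding \<gamma>_def[abs_def] by (intro clin_intros clin_alpha u clin_compose[OF nricci_clin(1)[OF y] vlin_incl])
  obtain \<nu> where \<nu>: "unit_normal G ?y \<nu>" using ex_unit_normal[OF u] by blast
  obtain s where s: "\<nu> = s *s n ?y" using unit_normal_eq[OF u \<nu>] by metis
  obtain f where f: "hodge_frame (G ?y) (S ?y) f" "f 4 = \<nu>" "\<And>i. i \<noteq> 4 \<Longrightarrow> f i = incl (slice_coord (f i))"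
    using ex_tangent_frame[OF u \<nu>] by metis
  have o: "orthonormal (G ?y) f" using f(1) by (simp add: hodge_frame_def)
  define E where "E i = slice_coord (f (to4 i))" for i
  have oE: "orthonormal (GQ u) E" unfolding E_def[abs_def] by (rule tangent_onb[OF o f(3)])
  have fE: "f 1 = incl (E 1)" "f 2 = incl (E 2)" "f 3 = incl (E 3)"
    using f(3) by (simp_all add: E_def to4_def)
  have "\<gamma> Y = 0" for Y
  proof -
    have t: "weyl G ?y (n ?y) (incl V) (incl Y) (incl V) = \<gamma> Y * gQ u V V - \<gamma> V * gQ u V Y" for V
    proof -
      have "weyl G ?y (n ?y) (incl V) (incl Y) (incl V) = - weyl G ?y (incl Y) (incl V) (incl V) (n ?y)"
        using weyl_pair[OF y, of "n ?y" "incl V" "incl Y" "incl V"] weyl_skew34[OF y, of "incl Y" "incl V" "n ?y" "incl V"] by simp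
      then show ?thesis by (simp add: W Q.bil_commute[OF u, of Y V])
    qed
    have z: "weyl G ?y (n ?y) (f 4) (incl Y) (f 4) = 0"
      using weyl_skew12[of ?y "n ?y" "n ?y" "incl Y" \<nu>] by (simp add: f(2) s clin_scale[OF weyl_clin(2)[OF y]])
    have g1: "gQ u (E i) (E i) = 1" for i using oE by (simp add: orthonormal_def)
    have "(\<Sum>k\<in>UNIV. weyl G ?y (n ?y) (f k) (incl Y) (f k)) = 0" by (rule weyl_trace[OF y o])
    \<comment> \<open>The normal member of the frame contributes nothing to the trace, by skewness.
      The sum on the right is \<open>\<gamma> Y\<close>, so
      \<open>2 * \<gamma> Y = 0\<close>.\<close>
    then have "3 * \<gamma> Y - (\<Sum>i\<in>UNIV. gQ u (E i) Y * \<gamma> (E i)) = 0"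
      by (simp add: sum_4 z sum_3) (simp add: fE t g1 algebra_simps)
    then show ?thesis by (simp add: onb_sum_left[OF oE cg])
  qed
  then show "nricci G ?y (incl X) (n ?y) = alpha u X" "weyl G ?y (incl X) (incl Y) (incl Z) (n ?y) = 0"
    by (simp_all add: \<gamma>_def W)
qed

lemma weyl_zero:
  assumes u: "u \<in> Q"
  shows "weyl G (incl u) X Y Z T = 0"
proof -
  let ?y = "incl u"
  have y: "?y \<in> U" using u by (simp add: Q_iff)
  interpret hodge_operator "G ?y" "S ?y" by (rule hodge_at[OF y])
  obtain \<nu> where \<nu>: "unit_normal G ?y \<nu>" using ex_unit_normal[OF u] by blast
  obtain s where s: "\<nu> = s *s n ?y" using unit_normal_eq[OF u \<nu>] by metis
  obtain f where f: "hodge_frame (G ?y) (S ?y) f" "f 4 = \<nu>" "\<And>i. i \<noteq> 4 \<Longrightarrow> f i = incl (slice_coord (f i))"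
    using ex_tangent_frame[OF u \<nu>] by metis
  have o: "orthonormal (G ?y) f" using f(1) by (simp add: hodge_frame_def)
  define w where "w i j k l = weyl G ?y (f i) (f j) (f k) (f l)" for i j k l
  have W: "Wf ?y (wedge (f i) (f j)) (wedge (f k) (f l)) = w i j k l" for i j k l
    by (simp add: biform_weyl_wedge[OF y] w_def)
  have t: "w i j k 4 = 0" if "i \<noteq> 4" "j \<noteq> 4" "k \<noteq> 4" for i j k
  proof -
    have "w i j k 4 = s * weyl G ?y (incl (slice_coord (f i))) (incl (slice_coord (f j))) (incl (slice_coord (f k))) (n ?y)"
      using that by (simp add: w_def f(2) s clin_scale[OF weyl_clin(4)[OF y]] flip: f(3))
    then show ?thesis by (simp add: weyl_normal(2)[OF u])
  qed
  have t': "w k 4 i j = 0" if "i \<noteq> 4" "j \<noteq> 4" "k \<noteq> 4" for i j k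
    using t[OF that] weyl_pair[OF y] by (simp add: w_def)
  have r: "Wf ?y A (wedge (f 1) (f 2)) = Wf ?y A (wedge (f 3) (f 4))"
    "Wf ?y A (wedge (f 1) (f 3)) = - Wf ?y A (wedge (f 2) (f 4))"
    "Wf ?y A (wedge (f 2) (f 3)) = Wf ?y A (wedge (f 1) (f 4))" if "A \<in> bivectors" for A
    using weyl_S_right[OF y that bivectors_wedge, of "f 1" "f 2"] weyl_S_right[OF y that bivectors_wedge, of "f 1" "f 3"]
      weyl_S_right[OF y that bivectors_wedge, of "f 2" "f 3"]
    by (simp_all add: hodge_frame_table[OF f(1)] blin_scale[OF blin_biform(2)] bivectors_wedge)
  have wr: "w i j 1 2 = w i j 3 4" "w i j 1 3 = - w i j 2 4" "w i j 2 3 = w i j 1 4" for i j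
    using r[OF bivectors_wedge, of "f i" "f j"] by (simp_all add: W)
  have z: "blin (\<lambda>_. 0)" by (simp add: blin_def)
  \<comment> \<open>Self-duality trades the pair \<open>(j,4)\<close> for a pair of tangent indices
    up to sign, leaving a component with a single index 4.\<close>
  have n4: "w i 4 j 4 = 0" if "i \<noteq> 4" "j \<noteq> 4" for i j
  proof -
    have "w i 4 j 4 = 0" if "j = 1 \<or> j = 2 \<or> j = 3"
      using that r[OF bivectors_wedge, of "f i" "f 4"] t'[of _ _ i] \<open>i \<noteq> 4\<close> by (auto simp: W)
    then show ?thesis using exhaust_4[of j] that by auto
  qed
  have "Wf ?y A B = (\<lambda>_. 0) A" if A: "A \<in> bivectors" and B: "B \<in> bivectors" for A B
    by (rule blin_ext4[where f = "\<lambda>A. Wf ?y A B", OF o blin_biform(1) z _ _ _ _ _ _ A];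
        rule blin_ext4[where g = "\<lambda>_. 0", OF o blin_biform(2) z _ _ _ _ _ _ B])
       (simp_all add: W wr t t' n4)
  then show ?thesis using biform_weyl_wedge[OF y] bivectors_wedge by metis
qed

section \<open>The Cotton-York tensor of an umbilic hypersurface\<close>

text \<open>With \<open>W = 0\<close> the Gauss equation reads \<open>R = k \<and> I\<close> for the
  induced metric, where \<open>k\<close> is the right hand side. In dimension 3 its contractions are
  \<open>Ric = k + t g\<close> and \<open>Scal = 4 t\<close> with \<open>t\<close> the trace of
  \<open>k\<close>, and the normalization of \<open>nricci\<close> returns \<open>k\<close>.\<close>

lemma nricci_induced:
  assumes u: "u \<in> Q"
  shows "nricci GQ u X Z = nricci G (incl u) (incl X) (incl Z) + sigma u / 2 * gQ u X Z"
proof -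
  let ?y = "incl u"
  have y: "?y \<in> U" using u by (simp add: Q_iff)
  define k where "k X Z = nricci G ?y (incl X) (incl Z) + sigma u / 2 * gQ u X Z" for X Z
  have ck: "clin (\<lambda>X. k X Z)" "clin (k X)" for X Z
    unfolding k_def by (intro clin_intros clin_compose[OF nricci_clin(1)[OF y] vlin_incl]
        clin_compose[OF nricci_clin(2)[OF y] vlin_incl] clin_bil_left clin_bil_right)+
  have R: "R4 GQ u X Y Z T = k X Z * gQ u Y T + k Y T * gQ u X Z - k X T * gQ u Y Z - k Y Z * gQ u X T" for X Y Z T
  proof -
    have "R4 G ?y (incl X) (incl Y) (incl Z) (incl T) = susp G ?y (incl X) (incl Y) (incl Z) (incl T)"
      using weyl_zero[OF u, of "incl X" "incl Y" "incl Z" "incl T"] by (simp add: weyl_def)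
    then have "R4 GQ u X Y Z T = susp G ?y (incl X) (incl Y) (incl Z) (incl T)
        + sigma u * (gQ u X Z * gQ u Y T - gQ u Y Z * gQ u X T)"
      unfolding gauss[OF u] by (simp add: algebra_simps)
    then show ?thesis
      by (simp add: susp_def bil_induced[symmetric] k_def) (simp add: field_simps)
  qed
  obtain E where E: "orthonormal (GQ u) E" using Q.frame[OF u] by blast
  have g1: "gQ u (E i) (E i) = 1" for i using E by (simp add: orthonormal_def)
  define t where "t = (\<Sum>i\<in>UNIV. k (E i) (E i))"
  have ric: "ricci GQ u X Z = k X Z + t * gQ u X Z" for X Z
  proof -
    have "ricci GQ u X Z = 3 * k X Z + t * gQ u X Z - (\<Sum>i\<in>UNIV. gQ u (E i) Z * k X (E i)) - (\<Sum>i\<in>UNIV. gQ u (E i) X * k (E i) Z)"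
      by (simp add: Q.ricci_frame[OF u E] R g1 sum.distrib sum_subtractf sum_distrib_left sum_distrib_right t_def
          Q.bil_commute[OF u, of X "E _"] mult.commute)
    then show ?thesis by (simp add: onb_sum_left[OF E ck(1)] onb_sum_left[OF E ck(2)])
  qed
  have "scal GQ u = 4 * t"
    by (simp add: Q.scal_frame[OF u E] ric g1 sum.distrib t_def)
  then have "nricci GQ u X Z = k X Z"
    by (simp add: nricci_def ricci0_def ric field_simps)
  then show ?thesis by (simp add: k_def)
qed

lemma cotton_york_induced:
  assumes u: "u \<in> Q"
  shows "covd_nricci GQ u X Y Z - covd_nricci GQ u Y X Z
    = covd_nricci G (incl u) (incl X) (incl Y) (incl Z) - covd_nricci G (incl u) (incl Y) (incl X) (incl Z)"
proof -
  let ?y = "incl u"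
  have y: "?y \<in> U" using u by (simp add: Q_iff)
  have hs: "hol_on sigma Q" unfolding sigma_def[abs_def] by (intro hol_on_mult hol_rho hol_N)
  have hn: "hol_on (\<lambda>u. nricci G (incl u) (incl Y) (incl Z)) Q" for Y Z
    unfolding Q_def by (rule hol_on_incl[OF hol_nricci])
  \<comment> \<open>The term in \<open>alpha u X\<close> comes from the derivative of
    \<open>sigma / 2\<close>; the other two come from the normal parts of \<open>gam_incl\<close>,
    on which \<open>h\<close> takes the values \<open>alpha\<close>. Their sum is totally
    symmetric.\<close>
  have cov: "covd_nricci G ?y (incl X) (incl Y) (incl Z) = covd_nricci GQ u X Y Z
    - rho u * (alpha u X * gQ u Y Z + gQ u X Y * alpha u Z + gQ u X Z * alpha u Y)" for X Y Z
  proof -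
    have "dirderiv (\<lambda>u. nricci GQ u Y Z) X u
        = dirderiv (\<lambda>u. nricci G (incl u) (incl Y) (incl Z) + 1/2 * (sigma u * gQ u Y Z)) X u"
      by (rule dirderiv_cong[OF _ Q.open_U u]) (simp add: nricci_induced)
    also have "\<dots> = dirderiv (\<lambda>y. nricci G y (incl Y) (incl Z)) (incl X) ?y
        + 1/2 * (dirderiv sigma X u * gQ u Y Z + sigma u * (gQ u (gam GQ u X Y) Z + gQ u Y (gam GQ u X Z)))"
      by (simp only: dirderiv_add[OF hn hol_on_cmult[OF hol_on_mult[OF hs Q.hol_bil]] u]
        dirderiv_cmult[OF hol_on_mult[OF hs Q.hol_bil] u] dirderiv_mult[OF hs Q.hol_bil u]
        Q.dirderiv_bil[OF u] dirderiv_incl[of "\<lambda>y. nricci G y (incl Y) (incl Z)"])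
    finally have d: "dirderiv (\<lambda>y. nricci G y (incl Y) (incl Z)) (incl X) ?y = dirderiv (\<lambda>u. nricci GQ u Y Z) X u
        - (rho u * alpha u X * gQ u Y Z + sigma u / 2 * (gQ u (gam GQ u X Y) Z + gQ u Y (gam GQ u X Z)))"
      by (simp add: dirderiv_sigma[OF u] field_simps)
    note l = clin_add[OF nricci_clin(1)[OF y]] clin_add[OF nricci_clin(2)[OF y]]
      clin_scale[OF nricci_clin(1)[OF y]] clin_scale[OF nricci_clin(2)[OF y]]
    have nn: "nricci G ?y (n ?y) (incl Z) = alpha u Z" for Z
      using weyl_normal(1)[OF u] nricci_sym[OF y] by simp
    show ?thesis
      unfolding covd_nricci_def d gam_incl[OF u] l nn weyl_normal(1)[OF u] nricci_induced[OF u]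
      by (simp add: algebra_simps)
  qed
  show ?thesis unfolding cov by (simp add: Q.bil_commute[OF u, of Y X] algebra_simps)
qed

end

section \<open>The normal derivative of the Weyl tensor\<close>

lemma dirderiv_mult_zero:
  assumes "hol_on f S" "hol_on g S" "x \<in> S" "g x = 0"
  shows "dirderiv (\<lambda>y. f y * g y) v x = f x * dirderiv g v x"
  by (simp add: dirderiv_mult[OF assms(1-3)] assms(4))

context framed_metric
begin

text \<open>A plain derivative of components, not a tensor in general; at points where
  \<open>W\<close> vanishes it is \<open>\<nabla>W\<close>.\<close>

definition DW where "DW x v X Y Z T = dirderiv (\<lambda>y. weyl G y X Y Z T) v x"

lemma DW_clin:
  assumes x: "x \<in> U"
  shows "clin (\<lambda>v. DW x v X Y Z T)" "clin (\<lambda>X. DW x v X Y Z T)" "clin (\<lambda>Y. DW x v X Y Z T)"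
    "clin (\<lambda>Z. DW x v X Y Z T)" "clin (\<lambda>T. DW x v X Y Z T)"
  unfolding DW_def
  by (rule clin_dirderiv[OF hol_weyl x], (rule clin_dirderiv_family[OF open_U x _ hol_weyl], erule weyl_clin)+)

lemma DW_skew12: "x \<in> U \<Longrightarrow> DW x v X Y Z T = - DW x v Y X Z T"
  and DW_skew34: "x \<in> U \<Longrightarrow> DW x v X Y Z T = - DW x v X Y T Z"
proof -
  assume x: "x \<in> U"
  have "dirderiv (\<lambda>y. weyl G y X Y Z T) v x = dirderiv (\<lambda>y. - weyl G y Y X Z T) v x"
    "dirderiv (\<lambda>y. weyl G y X Y Z T) v x = dirderiv (\<lambda>y. - weyl G y X Y T Z) v x"
    by (rule dirderiv_cong[OF _ open_U x], (rule weyl_skew12 | erule weyl_skew34))+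
  then show "DW x v X Y Z T = - DW x v Y X Z T" "DW x v X Y Z T = - DW x v X Y T Z"
    by (simp_all add: DW_def dirderiv_uminus[OF hol_weyl x])
qed

text \<open>The trace identity is written with the inverse metric, which is holomorphic whereas
  frames are only given pointwise. Its derivative falls on \<open>W\<close> alone, as
  \<open>W\<close> is zero at the point.\<close>

lemma DW_trace:
  assumes x: "x \<in> U" and e: "orthonormal (G x) e" and W0: "\<And>X Y Z T. weyl G x X Y Z T = 0"
  shows "(\<Sum>k\<in>UNIV. DW x v X (e k) Z (e k)) = 0"
proof -
  let ?i = "\<lambda>y. matrix_inv (G y)"
  have "dirderiv (\<lambda>y. \<Sum>i\<in>UNIV. \<Sum>j\<in>UNIV. ?i y $ i $ j * weyl G y X (axis i 1) Z (axis j 1)) v x = dirderiv (\<lambda>y. 0) v x"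
  proof (rule dirderiv_cong[OF _ open_U x])
    fix y assume y: "y \<in> U"
    obtain e where e: "orthonormal (G y) e" using frame[OF y] by blast
    have "(\<Sum>i\<in>UNIV. \<Sum>j\<in>UNIV. ?i y $ i $ j * weyl G y X (axis i 1) Z (axis j 1)) = (\<Sum>k\<in>UNIV. weyl G y X (e k) Z (e k))"
      by (rule onb_trace_bilinear[where F = "\<lambda>a b. weyl G y X a Z b", OF e weyl_clin(2)[OF y] weyl_clin(4)[OF y]])
    then show "(\<Sum>i\<in>UNIV. \<Sum>j\<in>UNIV. ?i y $ i $ j * weyl G y X (axis i 1) Z (axis j 1)) = 0"
      by (simp add: weyl_trace[OF y e])
  qed
  then have "(\<Sum>i\<in>UNIV. \<Sum>j\<in>UNIV. ?i x $ i $ j * DW x v X (axis i 1) Z (axis j 1)) = 0"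
    by (simp add: dirderiv_sum[where S = U] hol_on_sum hol_on_mult[OF hol_inv hol_weyl] x
        dirderiv_mult_zero[OF hol_inv hol_weyl x W0] DW_def)
  then show ?thesis
    by (simp add: onb_trace_bilinear[where F = "\<lambda>a b. DW x v X a Z b", OF e DW_clin(3)[OF x] DW_clin(5)[OF x]])
qed

lemma covd_nricci_clin:
  assumes x: "x \<in> U"
  shows "clin (\<lambda>u. covd_nricci G x u v w)" "clin (\<lambda>v. covd_nricci G x u v w)" "clin (\<lambda>w. covd_nricci G x u v w)"
  unfolding covd_nricci_def
  by (intro clin_diff_fun clin_dirderiv[OF hol_nricci x] clin_dirderiv_family[OF open_U x _ hol_nricci]
      nricci_clin x clin_compose[OF nricci_clin(1)[OF x]] clin_compose[OF nricci_clin(2)[OF x]]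
      vlin_gam_left vlin_gam_right; assumption?)+

end

context umbilic_slice
begin

lemma DW_tangent:
  assumes u: "u \<in> Q"
  shows "DW (incl u) (incl V) X Y Z T = 0"
proof -
  have "DW (incl u) (incl V) X Y Z T = dirderiv (\<lambda>u. weyl G (incl u) X Y Z T) V u"
    unfolding DW_def by (rule dirderiv_incl[symmetric])
  also have "\<dots> = dirderiv (\<lambda>u. 0) V u"
    by (rule dirderiv_cong[OF _ Q.open_U u]) (rule weyl_zero)
  finally show ?thesis by simp
qed

text \<open>The Bianchi identity with \<open>\<nu>\<close> in front contains, besides the
  Cotton-York term \<open>C\<close>, the form \<open>\<beta> Y = C(\<nu>,Y)(\<nu>)\<close> of the
  ambient metric multiplied by the metric. The proof consists in showing \<open>\<beta> = 0\<close>
  by a trace.\<close>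

theorem DW_normal:
  assumes u: "u \<in> Q" and \<nu>: "unit_normal G (incl u) \<nu>"
  shows "DW (incl u) \<nu> (incl X) (incl Y) (incl Z) \<nu>
    = - (covd_nricci GQ u X Y Z - covd_nricci GQ u Y X Z)"
proof -
  let ?y = "incl u" and ?c = "covd_nricci G (incl u)"
  have y: "?y \<in> U" using u by (simp add: Q_iff)
  note B = bianchi2_weyl_zero[OF y weyl_zero[OF u], folded DW_def]
  define C where "C X Y Z = ?c (incl X) (incl Y) (incl Z) - ?c (incl Y) (incl X) (incl Z)" for X Y Z
  define \<beta> where "\<beta> Y = ?c \<nu> (incl Y) \<nu> - ?c (incl Y) \<nu> \<nu>" for Y
  have \<nu>1: "bil (G ?y) \<nu> \<nu> = 1" "bil (G ?y) (incl X) \<nu> = 0" "bil (G ?y) \<nu> (incl X) = 0" for X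
    using \<nu> bil_commute[OF y, of \<nu> "incl X"] by (simp_all add: unit_normal_def)
  have normal: "DW ?y \<nu> (incl X) (incl Y) (incl Z) \<nu> + C X Y Z + \<beta> Y * gQ u X Z - \<beta> X * gQ u Y Z = 0" for X Y Z
    using B[of \<nu> "incl X" "incl Y" "incl Z" \<nu>]
    by (simp add: DW_tangent[OF u] dsusp_def \<nu>1 bil_induced[symmetric] C_def \<beta>_def algebra_simps)
  \<comment> \<open>Tangential derivatives of \<open>W\<close> are zero, so the Bianchi identity
    constrains \<open>\<nabla>h\<close> alone; its trace says that \<open>C\<close> is trace-free on
    tangent vectors.\<close>
  have tangential: "dsusp ?y (incl V) (incl X) (incl Y) (incl Z) (incl T) + dsusp ?y (incl X) (incl Y) (incl V) (incl Z) (incl T)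
      + dsusp ?y (incl Y) (incl V) (incl X) (incl Z) (incl T) = 0" for V X Y Z T
    using B[of "incl V" "incl X" "incl Y" "incl Z" "incl T"] by (simp add: DW_tangent[OF u])
  obtain f where f: "hodge_frame (G ?y) (S ?y) f" "f 4 = \<nu>" "\<And>i. i \<noteq> 4 \<Longrightarrow> f i = incl (slice_coord (f i))"
    using ex_tangent_frame[OF u \<nu>] by metis
  have o: "orthonormal (G ?y) f" using f(1) by (simp add: hodge_frame_def)
  define E where "E i = slice_coord (f (to4 i))" for i
  have oE: "orthonormal (GQ u) E" unfolding E_def[abs_def] by (rule tangent_onb[OF o f(3)])
  have fE: "f 1 = incl (E 1)" "f 2 = incl (E 2)" "f 3 = incl (E 3)"
    using f(3) by (simp_all add: E_def to4_def)
  have g: "gQ u (E i) (E j) = (if i = j then 1 else 0)" for i j using oE by (simp add: orthonormal_def)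
  have tr: "DW ?y \<nu> (incl (E 1)) (incl R) (incl (E 1)) \<nu> + DW ?y \<nu> (incl (E 2)) (incl R) (incl (E 2)) \<nu>
      + DW ?y \<nu> (incl (E 3)) (incl R) (incl (E 3)) \<nu> = 0" for R
  proof -
    have fl: "DW ?y \<nu> (incl R) (f k) \<nu> (f k) = DW ?y \<nu> (f k) (incl R) (f k) \<nu>" for k
      using DW_skew12[OF y, of \<nu> "incl R" "f k" \<nu> "f k"] DW_skew34[OF y, of \<nu> "f k" "incl R" \<nu> "f k"] by simp
    have z: "DW ?y \<nu> (f 4) (incl R) (f 4) \<nu> = 0"
      using DW_skew34[OF y, of \<nu> \<nu> "incl R" \<nu> \<nu>] by (simp add: f(2))
    show ?thesis
      using DW_trace[OF y o weyl_zero[OF u], of \<nu> "incl R" \<nu>] by (simp add: fl sum_4 z) (simp add: fE)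
  qed
  \<comment> \<open>The identities \<open>normal\<close> for \<open>(E i, E j, E i)\<close> and
    \<open>(E k, E j, E k)\<close> are added. The derivatives of \<open>W\<close> cancel by
    \<open>tr\<close>, the terms \<open>C\<close> by \<open>tangential\<close>, and
    \<open>2 * \<beta> (E j)\<close> is left.\<close>
  have \<beta>0: "\<beta> (E j) = 0" if d: "i \<noteq> j" "i \<noteq> k" "j \<noteq> k" for i j k :: 3
  proof -
    have s: "DW ?y \<nu> (incl (E i)) (incl (E j)) (incl (E i)) \<nu> + DW ?y \<nu> (incl (E k)) (incl (E j)) (incl (E k)) \<nu> = 0"
    proof -
      have z: "DW ?y \<nu> (incl (E j)) (incl (E j)) W \<nu> = 0" for W
        using DW_skew12[OF y, of \<nu> "incl (E j)" "incl (E j)" W \<nu>] by simp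
      have "(i = 1 \<and> j = 2 \<and> k = 3) \<or> (i = 1 \<and> j = 3 \<and> k = 2) \<or> (i = 2 \<and> j = 1 \<and> k = 3)
        \<or> (i = 2 \<and> j = 3 \<and> k = 1) \<or> (i = 3 \<and> j = 1 \<and> k = 2) \<or> (i = 3 \<and> j = 2 \<and> k = 1)"
        using d exhaust_3[of i] exhaust_3[of j] exhaust_3[of k] by auto
      then show ?thesis using tr[of "E j"] z by (auto simp: add.commute)
    qed
    have c: "C (E i) (E j) (E i) + C (E k) (E j) (E k) = 0"
      using tangential[of "E i" "E j" "E k" "E i" "E k"] d
      by (simp add: dsusp_def bil_induced[symmetric] g C_def algebra_simps)
    have n: "DW ?y \<nu> (incl (E l)) (incl (E j)) (incl (E l)) \<nu> + C (E l) (E j) (E l) + \<beta> (E j) = 0" if "l \<noteq> j" for l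
      using normal[of "E l" "E j" "E l"] that by (simp add: g)
    have "2 * \<beta> (E j) = 0" using c n[OF d(1)] n[OF not_sym[OF d(3)]] s by algebra
    then show ?thesis by simp
  qed
  have c\<beta>: "clin \<beta>"
    unfolding \<beta>_def[abs_def]
    by (intro clin_diff_fun clin_compose[OF covd_nricci_clin(1)[OF y] vlin_incl] clin_compose[OF covd_nricci_clin(2)[OF y] vlin_incl])
  have "\<beta> (E j) = 0" for j
    using exhaust_3[of j] \<beta>0[of 2 1 3] \<beta>0[of 1 2 3] \<beta>0[of 1 3 2] by auto
  then have "\<beta> R = 0" for R using onb_sum_left[OF oE c\<beta>, of R] by simp
  then show ?thesis
    using normal[of X Y Z] by (simp add: C_def cotton_york_induced[OF u] add_eq_0_iff)
qed

section \<open>The covariant derivative of the self-dual Weyl tensor in components\<close>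

lemma half_weyl_bivector:
  assumes x: "x \<in> U" and A: "A \<in> bivectors"
  shows "half_weyl s G S x A \<in> bivectors"
proof -
  note P = blmap_mem[OF blmap_eproj[OF x]]
  have *: "\<And>X Y c. X \<in> bivectors \<Longrightarrow> Y \<in> bivectors \<Longrightarrow> X - cscale c Y \<in> bivectors"
    by (simp add: bivectors_iff) (metis add_diff_add diff_zero distrib_left mult_zero_right)
  show ?thesis unfolding half_weyl_def Let_def by (intro * P curvop_bivector x A)
qed

lemma biform_DW_wedge:
  assumes "x \<in> U"
  shows "biform (DW x v) (wedge X Y) (wedge Z T) = DW x v X Y Z T"
  by (rule biform_wedge) (rule DW_clin DW_skew12 DW_skew34; rule assms)+

text \<open>The argument \<open>B\<close> may vary with the point: its derivative meets the factor
  \<open>W\<close>, which is zero at \<open>x\<close>. This freedom is used for index raising by the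
  metric and for the Hodge operator.\<close>

lemma
  assumes x: "x \<in> U" and W0: "\<And>X Y Z T. weyl G x X Y Z T = 0" and B: "\<And>k l. hol_on (\<lambda>y. B y $ k $ l) U"
  shows hol_Wf: "hol_on (\<lambda>y. Wf y A (B y)) U"
    and dirderiv_Wf: "dirderiv (\<lambda>y. Wf y A (B y)) v x = biform (DW x v) A (B x)"
proof -
  have h: "hol_on (\<lambda>y. B y $ k $ l / 2 * weyl G y X Y Z T) U" for k l X Y Z T
    by (intro hol_on_mult hol_weyl hol_on_divide[OF B] hol_on_const) simp
  have h2: "hol_on (\<lambda>y. B y $ k $ l / 2) U" for k l
    by (rule hol_on_divide[OF B hol_on_const]) simp
  have h4: "hol_on (\<lambda>y. A $ i $ j / 2 * (\<Sum>k\<in>UNIV. \<Sum>l\<in>UNIV. B y $ k $ l / 2 * weyl G y (axis i 1) (axis j 1) (axis k 1) (axis l 1))) U" for i j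
    by (intro hol_on_cmult hol_on_sum h)
  show "hol_on (\<lambda>y. Wf y A (B y)) U" unfolding biform_def by (intro hol_on_sum h4)
  show "dirderiv (\<lambda>y. Wf y A (B y)) v x = biform (DW x v) A (B x)"
    unfolding biform_def
    by (simp add: dirderiv_sum[where S = U] x h4 hol_on_sum dirderiv_cmult[where S = U] h
        dirderiv_mult_zero[OF h2 hol_weyl x W0] DW_def del: times_divide_eq_left times_divide_eq_right)
qed

lemma weyl_plus_nth:
  assumes x: "x \<in> U" and A: "A \<in> bivectors"
  shows "weyl_plus G S x A $ a $ b = Wf x A (wedge (matrix_inv (G x) *v axis a 1) (matrix_inv (G x) *v axis b 1))"
  by (simp add: bil2_component[OF nondeg_G[OF x] half_weyl_bivector[OF x A]] bil2_weyl_plus[OF x A bivectors_wedge])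

text \<open>\<open>weyl_plus\<close> vanishes at the point, so neither the connection terms of
  \<open>covd_end2\<close> nor the derivative of the metric inside \<open>bil2\<close> contributes,
  and \<open>bil2_weyl_plus\<close> can be differentiated directly.\<close>

lemma bil2_covd_end2:
  assumes u: "u \<in> Q" and A: "A \<in> bivectors" and B: "B \<in> bivectors"
  shows "bil2 (G (incl u)) (covd_end2 G (weyl_plus G S) v (incl u) A) B = biform (DW (incl u) v) A B"
proof -
  let ?y = "incl u"
  have y: "?y \<in> U" using u by (simp add: Q_iff)
  note W0 = weyl_zero[OF u]
  have hK: "hol_on (\<lambda>y. weyl_plus G S y A $ a $ b) U" for a b
  proof (rule hol_on_cong[OF _ _ open_U])
    show "hol_on (\<lambda>y. Wf y A (wedge (matrix_inv (G y) *v axis a 1) (matrix_inv (G y) *v axis b 1))) U"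
      by (rule hol_Wf[OF y W0]) (simp add: matrix_vector_axis hol_on_diff hol_on_mult hol_inv)
  qed (simp add: weyl_plus_nth A)
  have K0: "weyl_plus G S ?y C = 0" if "C \<in> bivectors" for C
    by (simp add: vec_eq_iff weyl_plus_nth[OF y that]) (simp add: biform_def W0)
  \<comment> \<open>\<open>covd_end2\<close> applies \<open>weyl_plus\<close> to this matrix, and
    \<open>K0\<close> is available on bivectors only.\<close>
  have "conn2 G ?y v A \<in> bivectors"
  proof -
    define M where "M = (\<chi> k j. \<Sum>i\<in>UNIV. christoffel G ?y k i j * v $ i)"
    have "transpose (M ** A + A ** transpose M) = - (M ** A + A ** transpose M)"
    proof -
      have "transpose (X + Y) = transpose X + transpose Y" "(- X) ** Y = - (X ** Y)" "X ** (- Y) = - (X ** Y)"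
        for X Y :: "complex^4^4"
        by (simp_all add: vec_eq_iff transpose_def matrix_matrix_mult_def sum_negf)
      then show ?thesis using A by (simp add: bivectors_def matrix_transpose_mul)
    qed
    then show ?thesis by (simp add: conn2_def Let_def M_def[symmetric] bivectors_def)
  qed
  moreover have "conn2 G ?y v 0 = 0" by (simp add: conn2_def Let_def)
  ultimately have c: "covd_end2 G (weyl_plus G S) v ?y A $ a $ b = dirderiv (\<lambda>y. weyl_plus G S y A $ a $ b) v ?y" for a b
    by (simp add: covd_end2_def K0 A)
  have hg: "hol_on (\<lambda>y. B $ c $ d * G y $ a $ c * G y $ b $ d) U" for a b c d
    by (intro hol_on_mult hol_G hol_on_const)
  have hKg: "hol_on (\<lambda>y. (B $ c $ d * G y $ a $ c * G y $ b $ d) * weyl_plus G S y A $ a $ b) U" for a b c d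
    by (intro hol_on_mult hK hg)
  have e: "bil2 (G y) K B = (1/2) * (\<Sum>a\<in>UNIV. \<Sum>b\<in>UNIV. \<Sum>c\<in>UNIV. \<Sum>d\<in>UNIV.
      (B $ c $ d * G y $ a $ c * G y $ b $ d) * K $ a $ b)" for y K
    by (simp add: bil2_def mult_ac)
  have "biform (DW ?y v) A B = dirderiv (\<lambda>y. Wf y A B) v ?y"
    by (rule dirderiv_Wf[OF y W0, symmetric]) (rule hol_on_const)
  also have "\<dots> = dirderiv (\<lambda>y. bil2 (G y) (weyl_plus G S y A) B) v ?y"
    by (rule dirderiv_cong[OF _ open_U y]) (simp add: bil2_weyl_plus A B)
  also have "\<dots> = bil2 (G ?y) (covd_end2 G (weyl_plus G S) v ?y A) B"
    unfolding e c
    by (subst dirderiv_cmult[where S = U])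
       (simp_all add: dirderiv_sum[where S = U] hol_on_sum hKg y dirderiv_mult_zero[OF hg hK y] K0 A)
  finally show ?thesis ..
qed

text \<open>The derivative of the self-duality relation \<open>weyl_S_right\<close>; the derivative
  of the Hodge operator is multiplied by \<open>W = 0\<close>.\<close>

lemma biform_DW_S:
  assumes u: "u \<in> Q" and A: "A \<in> bivectors" and B: "B \<in> bivectors"
  shows "biform (DW (incl u) v) A (S (incl u) B) = biform (DW (incl u) v) A B"
proof -
  have y: "incl u \<in> U" using u by (simp add: Q_iff)
  have "biform (DW (incl u) v) A (S (incl u) B) = dirderiv (\<lambda>y. Wf y A (S y B)) v (incl u)"
    by (rule dirderiv_Wf[OF y weyl_zero[OF u], symmetric]) (rule hol_S[OF B])
  also have "\<dots> = dirderiv (\<lambda>y. Wf y A B) v (incl u)"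
    by (rule dirderiv_cong[OF _ open_U y]) (rule weyl_S_right[OF _ A B])
  also have "\<dots> = biform (DW (incl u) v) A B"
    by (rule dirderiv_Wf[OF y weyl_zero[OF u]]) (rule hol_on_const)
  finally show ?thesis .
qed

end

section \<open>The main formula\<close>

lemma incl2_nth: "incl2 A $ a $ b = (\<Sum>i\<in>UNIV. \<Sum>j\<in>UNIV. A $ i $ j * (incl (axis i 1) $ a * incl (axis j 1) $ b))"
proof -
  have "incl2 A $ a $ b = (\<Sum>j\<in>UNIV. (\<Sum>i\<in>UNIV. incl (axis i 1) $ a * A $ i $ j) * incl (axis j 1) $ b)"
    by (simp add: incl2_def matrix_matrix_mult_def transpose_def matrix_def)
  also have "\<dots> = (\<Sum>j\<in>UNIV. \<Sum>i\<in>UNIV. A $ i $ j * (incl (axis i 1) $ a * incl (axis j 1) $ b))"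
    by (simp add: sum_distrib_left sum_distrib_right mult_ac)
  finally show ?thesis by (subst sum.swap)
qed

lemma incl2_wedge: "incl2 (wedge X Y) = wedge (incl X) (incl Y)"
proof -
  have p: "(\<Sum>i\<in>UNIV. \<Sum>j\<in>UNIV. X $ i * Y $ j * (incl (axis i 1) $ a * incl (axis j 1) $ b)) = incl X $ a * incl Y $ b" for X Y a b
    unfolding clin_expand[OF vlin_nth[OF vlin_incl], of X a] clin_expand[OF vlin_nth[OF vlin_incl], of Y b] sum_product
    by (simp add: mult_ac)
  have "incl2 (wedge X Y) $ a $ b = incl X $ a * incl Y $ b - incl Y $ a * incl X $ b" for a b
    unfolding incl2_nth p[of X Y, symmetric] p[of Y X, symmetric] sum_subtractf[symmetric]
    by (simp add: algebra_simps)
  then show ?thesis by (simp add: vec_eq_iff mult.commute)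
qed

lemma incl2_bivector:
  assumes "A \<in> bivectors"
  shows "incl2 A \<in> bivectors"
proof -
  have t: "incl2 A $ b $ a = - incl2 A $ a $ b" for a b
    unfolding incl2_nth sum_negf[symmetric]
    by (subst sum.swap, intro sum.cong refl) (subst bivectors_nth[OF assms], simp)
  show ?thesis unfolding bivectors_iff by (intro allI) (subst t, simp)
qed

lemma incl2_linear: "incl2 (A + B) = incl2 A + incl2 B" "incl2 (cscale c A) = cscale c (incl2 A)"
  by (simp_all add: vec_eq_iff incl2_nth distrib_right sum.distrib sum_distrib_left mult.assoc)

lemma blin_incl2: "blin f \<Longrightarrow> blin (\<lambda>A. f (incl2 A))"
  by (rule blinI) (simp_all add: incl2_linear incl2_bivector blin_add blin_scale)

lemma blin_ext3:
  fixes e :: "3 \<Rightarrow> complex^3"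
  assumes e: "orthonormal G e" and f: "blin f" "blin g"
    and eq: "f (wedge (e 1) (e 2)) = g (wedge (e 1) (e 2))" "f (wedge (e 1) (e 3)) = g (wedge (e 1) (e 3))"
      "f (wedge (e 2) (e 3)) = g (wedge (e 2) (e 3))"
    and A: "A \<in> bivectors"
  shows "f A = g A"
proof (rule blin_ext[OF e f _ A])
  have "\<forall>k l. f (wedge (e k) (e l)) = g (wedge (e k) (e l))"
    unfolding forall_3
    using eq blin_wedge_skew[OF f(1), of "e 2" "e 1"] blin_wedge_skew[OF f(2), of "e 2" "e 1"]
      blin_wedge_skew[OF f(1), of "e 3" "e 1"] blin_wedge_skew[OF f(2), of "e 3" "e 1"]
      blin_wedge_skew[OF f(1), of "e 3" "e 2"] blin_wedge_skew[OF f(2), of "e 3" "e 2"]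
      blin_zero[OF f(1)] blin_zero[OF f(2)]
    by (simp add: wedge_self)
  then show "f (wedge (e k) (e l)) = g (wedge (e k) (e l))" for k l by blast
qed

lemma blin_cotton_york: "blin (\<lambda>A. cotton_york G x A Z)"
  unfolding cotton_york_def
  by (rule blinI) (simp_all add: distrib_right sum.distrib sum_distrib_left add_divide_distrib sum_divide_distrib mult_ac)

lemma (in framed_metric) cotton_york_wedge:
  assumes x: "x \<in> U"
  shows "cotton_york G x (wedge X Y) Z = covd_nricci G x X Y Z - covd_nricci G x Y X Z"
proof -
  let ?F = "\<lambda>X Y. covd_nricci G x X Y Z - covd_nricci G x Y X Z"
  have "(\<Sum>i\<in>UNIV. \<Sum>j\<in>UNIV. wedge X Y $ i $ j / 2 * ?F (axis i 1) (axis j 1)) = ?F X Y"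
    by (rule wedge_contract) (intro clin_diff_fun covd_nricci_clin x | simp)+
  then show ?thesis by (simp add: cotton_york_def sum_distrib_left)
qed

context umbilic_slice
begin

text \<open>In a frame adapted to the hypersurface the operator sends \<open>wedge X Y\<close> to
  \<open>wedge Z \<nu>\<close>, and cyclically: the Hodge operator of dimension 3 followed by the
  wedge product with \<open>\<nu>\<close>.\<close>

lemma S_incl2:
  assumes u: "u \<in> Q" and XYZ: "oriented_onb3 (G (incl u)) (S (incl u)) \<nu> X Y Z" and B: "B \<in> bivectors"
  shows "S (incl u) (incl2 B) = wedge (incl (bil2 (GQ u) B (wedge Y Z) *s X + bil2 (GQ u) B (wedge Z X) *s Y
      + bil2 (GQ u) B (wedge X Y) *s Z)) \<nu>"
proof -
  let ?y = "incl u"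
  have y: "?y \<in> U" using u by (simp add: Q_iff)
  interpret hodge_operator "G ?y" "S ?y" by (rule hodge_at[OF y])
  define f :: "4 \<Rightarrow> complex^4" where "f i = (if i = 1 then incl X else if i = 2 then incl Y else if i = 3 then incl Z else \<nu>)" for i
  have h: "hodge_frame (G ?y) (S ?y) f"
    by (rule hodge_frameI) (use XYZ in \<open>simp add: oriented_onb3_def f_def[abs_def]\<close>)
  have o: "orthonormal (G ?y) f" using h by (simp add: hodge_frame_def)
  have f: "f 1 = incl X" "f 2 = incl Y" "f 3 = incl Z" "f 4 = \<nu>" by (simp_all add: f_def)
  define E where "E i = slice_coord (f (to4 i))" for i
  have E: "E 1 = X" "E 2 = Y" "E 3 = Z" by (simp_all add: E_def to4_def f)
  have "f i = incl (slice_coord (f i))" if "i \<noteq> 4" for i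
    using that exhaust_4[of i] by (auto simp: f)
  then have oE: "orthonormal (GQ u) E" unfolding E_def[abs_def] by (intro tangent_onb[OF o])
  have g: "gQ u X X = 1" "gQ u Y Y = 1" "gQ u Z Z = 1" "gQ u X Y = 0" "gQ u X Z = 0" "gQ u Y Z = 0"
    "gQ u Y X = 0" "gQ u Z X = 0" "gQ u Z Y = 0"
    using oE by (simp_all add: orthonormal_def flip: E)
  define F where "F B = bil2 (GQ u) B (wedge Y Z) *s X + bil2 (GQ u) B (wedge Z X) *s Y + bil2 (GQ u) B (wedge X Y) *s Z" for B
  have bF: "blin (\<lambda>B. wedge (incl (F B)) \<nu> $ a $ b)" for a b
    by (rule blinI) (simp_all add: F_def blin_add[OF blin_bil2(1)] blin_scale[OF blin_bil2(1)] incl_simps algebra_simps)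
  have "S ?y (incl2 B) $ a $ b = wedge (incl (F B)) \<nu> $ a $ b" for a b
  proof (rule blin_ext3[OF oE blin_incl2[OF blin_S_nth] bF _ _ _ B])
    show "S ?y (incl2 (wedge (E 1) (E 2))) $ a $ b = wedge (incl (F (wedge (E 1) (E 2)))) \<nu> $ a $ b"
      using hodge_frame_table(1)[OF h] by (simp add: incl2_wedge E F_def bil2_wedge_wedge g incl_simps f)
    show "S ?y (incl2 (wedge (E 1) (E 3))) $ a $ b = wedge (incl (F (wedge (E 1) (E 3)))) \<nu> $ a $ b"
      using hodge_frame_table(5)[OF h] by (simp add: incl2_wedge E F_def bil2_wedge_wedge g incl_simps f)
    show "S ?y (incl2 (wedge (E 2) (E 3))) $ a $ b = wedge (incl (F (wedge (E 2) (E 3)))) \<nu> $ a $ b"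
      using hodge_frame_table(4)[OF h] by (simp add: incl2_wedge E F_def bil2_wedge_wedge g incl_simps f)
  qed
  then show ?thesis by (simp add: vec_eq_iff F_def)
qed

lemma wedge_normal_inj:
  assumes u: "u \<in> Q" and \<nu>: "unit_normal G (incl u) \<nu>" and eq: "wedge (incl v) \<nu> = wedge (incl v') \<nu>"
  shows "v = v'"
proof (rule nondegenerate_eqI'[OF Q.nondeg_G[OF u] Q.sym_G[OF u]])
  fix T
  have "bil2 (G (incl u)) (wedge (incl w) \<nu>) (wedge (incl T) \<nu>) = gQ u w T" for w
    using \<nu> by (simp add: bil2_wedge_wedge unit_normal_def bil_induced)
  then show "gQ u v T = gQ u v' T" by (metis eq)
qed

text \<open>The description in \<open>hodge3\<close> needs a vector common to all oriented frames.
  By \<open>S_incl2\<close> each frame gives a vector whose wedge with \<open>\<nu>\<close> is the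
  same bivector, and \<open>wedge_normal_inj\<close> makes these vectors equal; an adapted frame
  shows that the condition is not vacuous.\<close>

lemma hodge3_eq:
  assumes u: "u \<in> Q" and \<nu>: "unit_normal G (incl u) \<nu>" and B: "B \<in> bivectors"
  shows "S (incl u) (incl2 B) = wedge (incl (hodge3 (GQ u) (G (incl u)) (S (incl u)) \<nu> B)) \<nu>"
proof -
  let ?or = "oriented_onb3 (G (incl u)) (S (incl u)) \<nu>"
  let ?F = "\<lambda>X Y Z. bil2 (GQ u) B (wedge Y Z) *s X + bil2 (GQ u) B (wedge Z X) *s Y + bil2 (GQ u) B (wedge X Y) *s Z"
  obtain f where f: "hodge_frame (G (incl u)) (S (incl u)) f" "f 4 = \<nu>" "\<And>i. i \<noteq> 4 \<Longrightarrow> f i = incl (slice_coord (f i))"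
    using ex_tangent_frame[OF u \<nu>] by metis
  define X where "X = slice_coord (f 1)"
  define Y where "Y = slice_coord (f 2)"
  define Z where "Z = slice_coord (f 3)"
  have "(if i = 1 then incl X else if i = 2 then incl Y else if i = 3 then incl Z else \<nu>) = f i" for i
    using exhaust_4[of i] f(2) f(3)[of 1] f(3)[of 2] f(3)[of 3] by (auto simp: X_def Y_def Z_def)
  then have or: "?or X Y Z"
    using f(1) by (simp add: oriented_onb3_def oriented_onb_def hodge_frame_def)
  have "hodge3 (GQ u) (G (incl u)) (S (incl u)) \<nu> B = ?F X Y Z"
    unfolding hodge3_def
  proof (rule the_equality)
    show "\<forall>X' Y' Z'. ?or X' Y' Z' \<longrightarrow> ?F X Y Z = ?F X' Y' Z'"
      using S_incl2[OF u or B] S_incl2[OF u _ B] wedge_normal_inj[OF u \<nu>] by metis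
    show "v = ?F X Y Z" if "\<forall>X Y Z. ?or X Y Z \<longrightarrow> v = ?F X Y Z" for v
      using that or by blast
  qed
  then show ?thesis using S_incl2[OF u or B] by simp
qed

theorem normal_derivative_weyl_plus:
  assumes u: "u \<in> Q" and \<nu>: "unit_normal G (incl u) \<nu>" and A: "A \<in> bivectors" and B: "B \<in> bivectors"
  shows "bil2 (G (incl u)) (covd_end2 G (weyl_plus G S) \<nu> (incl u) (incl2 A)) (incl2 B)
    = - cotton_york GQ u A (hodge3 (GQ u) (G (incl u)) (S (incl u)) \<nu> B)"
proof -
  let ?v = "hodge3 (GQ u) (G (incl u)) (S (incl u)) \<nu> B"
  have y: "incl u \<in> U" using u by (simp add: Q_iff)
  have "bil2 (G (incl u)) (covd_end2 G (weyl_plus G S) \<nu> (incl u) (incl2 A)) (incl2 B)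
    = biform (DW (incl u) \<nu>) (incl2 A) (wedge (incl ?v) \<nu>)"
    by (simp add: bil2_covd_end2[OF u] incl2_bivector A B biform_DW_S[OF u, symmetric] hodge3_eq[OF u \<nu>, symmetric])
  also have "\<dots> = - cotton_york GQ u A ?v"
  proof (rule blin_ext_wedge[OF blin_incl2[OF blin_biform(1)] _ _ A])
    show "blin (\<lambda>A. - cotton_york GQ u A ?v)"
      using blin_cotton_york[of GQ u ?v] by (simp add: blin_def)
    show "biform (DW (incl u) \<nu>) (incl2 (wedge X Y)) (wedge (incl ?v) \<nu>) = - cotton_york GQ u (wedge X Y) ?v" for X Y
      by (simp add: incl2_wedge biform_DW_wedge[OF y] DW_normal[OF u \<nu>] Q.cotton_york_wedge[OF u])
  qed
  finally show ?thesis .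
qed

end

section \<open>Charts\<close>

lemma chart_inverse: "is_chart \<kappa> \<Longrightarrow> p \<in> fst \<kappa> \<Longrightarrow> inv_into (fst \<kappa>) (snd \<kappa>) (snd \<kappa> p) = p"
  by (auto simp: is_chart_def intro: homeomorphism_apply1)

lemma chart_inj: "is_chart \<kappa> \<Longrightarrow> p \<in> fst \<kappa> \<Longrightarrow> q \<in> fst \<kappa> \<Longrightarrow> snd \<kappa> p = snd \<kappa> q \<Longrightarrow> p = q"
  using chart_inverse by metis

lemma coord_chart: "is_chart \<kappa> \<Longrightarrow> p \<in> fst \<kappa> \<Longrightarrow> coord \<kappa> f (snd \<kappa> p) = f \<kappa> p"
  by (simp add: coord_def chart_inverse)

lemma open_chart_image:
  assumes "is_chart \<kappa>" "open W" "W \<subseteq> fst \<kappa>"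
  shows "open (snd \<kappa> ` W)"
proof -
  have "openin (top_of_set (fst \<kappa>)) W"
    using assms openin_open_eq unfolding is_chart_def by blast
  then have "openin (top_of_set (snd \<kappa> ` fst \<kappa>)) (snd \<kappa> ` W)"
    using assms(1) homeomorphism_imp_open_map unfolding is_chart_def by blast
  then show ?thesis using assms(1) openin_open_trans unfolding is_chart_def by blast
qed

lemma
  assumes "local_metric \<A> V g" "\<kappa> \<in> \<A>"
  shows local_metric_sym: "p \<in> V \<inter> fst \<kappa> \<Longrightarrow> transpose (g \<kappa> p) = g \<kappa> p"
    and local_metric_nondegenerate: "p \<in> V \<inter> fst \<kappa> \<Longrightarrow> nondegenerate (g \<kappa> p)"
    and local_metric_hol: "hol_on (\<lambda>y. coord \<kappa> g y $ i $ j) (snd \<kappa> ` (V \<inter> fst \<kappa>))"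
    and local_metric_transform: "\<kappa>' \<in> \<A> \<Longrightarrow> p \<in> V \<inter> fst \<kappa> \<inter> fst \<kappa>' \<Longrightarrow>
      g \<kappa> p = transpose (jacobian (transition \<kappa> \<kappa>') (snd \<kappa> p)) ** g \<kappa>' p ** jacobian (transition \<kappa> \<kappa>') (snd \<kappa> p)"
  using assms unfolding local_metric_def Let_def by blast+

text \<open>\<open>W\<close> may be smaller than the domain of the metric in the chart, so that the
  result also serves on the overlap with a second chart.\<close>

lemma chart_metric:
  assumes cs: "complex_structure \<A>" and cf: "conformal_structure \<A> c" and ori: "orientation \<A> c S"
    and sd: "self_dual \<A> c S" and g: "(V, g) \<in> c" and \<kappa>: "\<kappa> \<in> \<A>"
    and W: "open W" "W \<subseteq> V \<inter> fst \<kappa>"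
  shows "self_dual_metric (snd \<kappa> ` W) (coord \<kappa> g) (coord \<kappa> S)"
proof -
  have ch: "is_chart \<kappa>" using cs \<kappa> by (simp add: complex_structure_def)
  have lm: "local_metric \<A> V g" using cf g by (auto simp: conformal_structure_def)
  have pt: "\<exists>p. p \<in> W \<and> x = snd \<kappa> p \<and> p \<in> V \<inter> fst \<kappa> \<and> coord \<kappa> g x = g \<kappa> p \<and> coord \<kappa> S x = S \<kappa> p"
    if "x \<in> snd \<kappa> ` W" for x
  proof -
    from that obtain p where "p \<in> W" "x = snd \<kappa> p" by blast
    then show ?thesis using W(2) coord_chart[OF ch, of p g] coord_chart[OF ch, of p S] by auto
  qed
  have hodge: "is_hodge (coord \<kappa> g x) (coord \<kappa> S x)" if "x \<in> snd \<kappa> ` W" for x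
  proof -
    from pt[OF that] obtain p where "p \<in> V \<inter> fst \<kappa>" "coord \<kappa> g x = g \<kappa> p" "coord \<kappa> S x = S \<kappa> p"
      by blast
    moreover have "\<forall>(V, g)\<in>c. \<forall>\<kappa>\<in>\<A>. \<forall>p\<in>V \<inter> fst \<kappa>. is_hodge (g \<kappa> p) (S \<kappa> p)"
      using ori unfolding orientation_def by (rule conjunct1)
    ultimately show ?thesis using g \<kappa> by auto
  qed
  show ?thesis
  proof
    show "open (snd \<kappa> ` W)" using open_chart_image[OF ch W(1)] W(2) by blast
    fix x assume x: "x \<in> snd \<kappa> ` W"
    then obtain p where p: "x = snd \<kappa> p" "p \<in> V \<inter> fst \<kappa>" "coord \<kappa> g x = g \<kappa> p" using pt by blast
    show "transpose (coord \<kappa> g x) = coord \<kappa> g x" "nondegenerate (coord \<kappa> g x)"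
      using local_metric_sym[OF lm \<kappa> p(2)] local_metric_nondegenerate[OF lm \<kappa> p(2)] p(3) by simp_all
    show "\<exists>e. orthonormal (coord \<kappa> g x) e" using hodge[OF x] unfolding is_hodge_def by blast
    show "is_hodge (coord \<kappa> g x) (coord \<kappa> S x)" by (rule hodge[OF x])
    show "weyl_minus (coord \<kappa> g) (coord \<kappa> S) x A = 0" if "A \<in> bivectors" for A
      using bspec[OF sd[unfolded self_dual_def] g] \<kappa> p that by simp
  next
    show "hol_on (\<lambda>y. coord \<kappa> g y $ i $ j) (snd \<kappa> ` W)" for i j
      by (rule hol_on_subset[OF local_metric_hol[OF lm \<kappa>]]) (use W(2) in blast)
    show "hol_on (\<lambda>y. coord \<kappa> S y A $ i $ j) (snd \<kappa> ` W)" if "A \<in> bivectors" for A i j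
    proof (rule hol_on_subset)
      show "hol_on (\<lambda>y. coord \<kappa> S y A $ i $ j) (snd \<kappa> ` fst \<kappa>)"
        using ori \<kappa> that unfolding orientation_def by blast
      show "snd \<kappa> ` W \<subseteq> snd \<kappa> ` fst \<kappa>" using W(2) by blast
    qed
  qed simp
qed

lemma slice_chart_umbilic:
  assumes cs: "complex_structure \<A>" and cf: "conformal_structure \<A> c" and ori: "orientation \<A> c S"
    and sd: "self_dual \<A> c S" and nd: "nondegenerate_on \<A> c Q" and um: "umbilic \<A> c Q"
    and g: "(V, g) \<in> c" and \<kappa>: "\<kappa> \<in> slice_charts \<A> Q"
  shows "umbilic_slice (snd \<kappa> ` (V \<inter> fst \<kappa>)) (coord \<kappa> g) (coord \<kappa> S)"
proof -
  have \<kappa>A: "\<kappa> \<in> \<A>" and sl: "snd \<kappa> ` (fst \<kappa> \<inter> Q) = {y \<in> snd \<kappa> ` fst \<kappa>. y $ 4 = 0}"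
    using \<kappa> by (simp_all add: slice_charts_def)
  have ch: "is_chart \<kappa>" using cs \<kappa>A by (simp add: complex_structure_def)
  have "open V" using cf g by (auto simp: conformal_structure_def local_metric_def)
  then have W: "open (V \<inter> fst \<kappa>)" using ch by (simp add: is_chart_def open_Int)
  interpret self_dual_metric "snd \<kappa> ` (V \<inter> fst \<kappa>)" "coord \<kappa> g" "coord \<kappa> S"
    by (rule chart_metric[OF cs cf ori sd g \<kappa>A W]) simp
  \<comment> \<open>The slice condition provides a point of \<open>Q\<close> with coordinates
    \<open>incl u\<close>, and injectivity of the chart identifies it with the given point of
    \<open>V\<close>.\<close>
  have pt: "\<exists>p \<in> Q \<inter> V \<inter> fst \<kappa>. snd \<kappa> p = incl u" if "incl u \<in> snd \<kappa> ` (V \<inter> fst \<kappa>)" for u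
  proof -
    from that obtain p where p: "p \<in> V \<inter> fst \<kappa>" "snd \<kappa> p = incl u" by force
    from that have "incl u \<in> {y \<in> snd \<kappa> ` fst \<kappa>. y $ 4 = 0}" by auto
    then obtain q where q: "q \<in> fst \<kappa> \<inter> Q" "snd \<kappa> q = incl u" unfolding sl[symmetric] by force
    then have "p = q" using chart_inj[OF ch, of p q] p by simp
    then show ?thesis using p q by blast
  qed
  show ?thesis
  proof
    fix u assume "incl u \<in> snd \<kappa> ` (V \<inter> fst \<kappa>)"
    then obtain p where p: "p \<in> Q \<inter> V \<inter> fst \<kappa>" "snd \<kappa> p = incl u" using pt by blast
    show "nondegenerate (induced (coord \<kappa> g) u)"
    proof -
      have "nondegenerate (induced (coord \<kappa> g) (slice_coord (snd \<kappa> p)))"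
        using bspec[OF nd[unfolded nondegenerate_on_def] g] \<kappa> p(1) by blast
      then show ?thesis by (simp add: p(2))
    qed
    fix \<nu> X Y assume "unit_normal (coord \<kappa> g) (incl u) \<nu>"
    moreover have "\<forall>\<nu>. let G = coord \<kappa> g; u = slice_coord (snd \<kappa> p)
        in unit_normal G (snd \<kappa> p) \<nu> \<longrightarrow>
           (\<forall>X Y. second_ff G u \<nu> X Y - mean_curv G u \<nu> * bil (induced G u) X Y = 0)"
      using bspec[OF um[unfolded umbilic_def] g] \<kappa> p(1) by blast
    ultimately show "second_ff (coord \<kappa> g) u \<nu> X Y = mean_curv (coord \<kappa> g) u \<nu> * bil (induced (coord \<kappa> g) u) X Y"
      using p(2) by (simp add: Let_def)
  qed
qed

theorem theorem5:
  fixes \<A> :: "('a::{t2_space, second_countable_topology}, 4) chart set"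
    and c :: "('a set \<times> 'a metric) set"
    and S :: "'a hodge"
    and Q :: "'a set"
  assumes "complex_structure \<A>"
    and "conformal_structure \<A> c"
    and "orientation \<A> c S"
    and "self_dual \<A> c S"
    and "hypersurface \<A> Q"
    and "nondegenerate_on \<A> c Q"
    and "umbilic \<A> c Q"
  shows "(\<forall>x\<in>Q. \<forall>(V, g)\<in>c. \<forall>\<kappa>\<in>\<A>. x \<in> V \<inter> fst \<kappa> \<longrightarrow>
            (\<forall>X Y Z T. weyl (coord \<kappa> g) (snd \<kappa> x) X Y Z T = 0)) \<and>
         (\<forall>x\<in>Q. \<forall>(V, g)\<in>c. \<forall>\<kappa>\<in>slice_charts \<A> Q. x \<in> V \<inter> fst \<kappa> \<longrightarrow>
            (\<forall>\<nu>. \<forall>A\<in>bivectors. \<forall>B\<in>bivectors.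
               let G = coord \<kappa> g; y = snd \<kappa> x; u = slice_coord y; GQ = induced G
               in unit_normal G y \<nu> \<longrightarrow>
                  bil2 (G y) (covd_end2 G (weyl_plus G (coord \<kappa> S)) \<nu> y (incl2 A)) (incl2 B)
                  = - cotton_york GQ u A (hodge3 (GQ u) (G y) (S \<kappa> x) \<nu> B)))"
proof -
  note us = slice_chart_umbilic[OF assms(1-4,6,7)]
  have ch: "is_chart \<kappa>" if "\<kappa> \<in> \<A>" for \<kappa> using assms(1) that by (simp add: complex_structure_def)
  have sl: "snd \<kappa> x $ 4 = 0" if "x \<in> Q" "\<kappa> \<in> slice_charts \<A> Q" "x \<in> fst \<kappa>" for x \<kappa>
    using that unfolding slice_charts_def by blast
  have i: "weyl (coord \<kappa> g) (snd \<kappa> x) X Y Z T = 0"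
    if x: "x \<in> Q" and g: "(V, g) \<in> c" and \<kappa>: "\<kappa> \<in> \<A>" and xV: "x \<in> V \<inter> fst \<kappa>" for x V g \<kappa> X Y Z T
  proof -
    \<comment> \<open>The chart \<open>\<kappa>\<close> need not be adapted to \<open>Q\<close>; the
      result in a slice chart around \<open>x\<close> is transported to it.\<close>
    obtain \<kappa>' where \<kappa>': "\<kappa>' \<in> slice_charts \<A> Q" "x \<in> fst \<kappa>'" using assms(5) x unfolding hypersurface_def by blast
    then have \<kappa>'A: "\<kappa>' \<in> \<A>" by (simp add: slice_charts_def)
    note ch = ch[OF \<kappa>] ch[OF \<kappa>'A]
    have lm: "local_metric \<A> V g" using assms(2) g by (auto simp: conformal_structure_def)
    interpret M: umbilic_slice "snd \<kappa>' ` (V \<inter> fst \<kappa>')" "coord \<kappa>' g" "coord \<kappa>' S" by (rule us[OF g \<kappa>'(1)])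
    define W where "W = V \<inter> fst \<kappa> \<inter> fst \<kappa>'"
    have "open W" using lm ch by (simp add: W_def local_metric_def is_chart_def open_Int)
    then interpret M': self_dual_metric "snd \<kappa> ` W" "coord \<kappa> g" "coord \<kappa> S"
      by (rule chart_metric[OF assms(1-4) g \<kappa>]) (auto simp: W_def)
    have tr: "transition \<kappa> \<kappa>' (snd \<kappa> p) = snd \<kappa>' p" if "p \<in> W" for p
      using that chart_inverse[OF ch(1)] by (simp add: transition_def W_def)
    have "compatible \<kappa> \<kappa>'" using assms(1) \<kappa> \<kappa>'A by (simp add: complex_structure_def)
    then have hol: "vhol (transition \<kappa> \<kappa>') (snd \<kappa> ` W)"
      unfolding compatible_def vhol_def by (auto intro: hol_on_subset simp: W_def)
    \<comment> \<open>The transformation rule of the components of \<open>g\<close> says that the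
      transition map is an isometry from \<open>coord \<kappa> g\<close> to
      \<open>coord \<kappa>' g\<close>.\<close>
    interpret coordinate_change "snd \<kappa>' ` (V \<inter> fst \<kappa>')" "snd \<kappa> ` W" "coord \<kappa>' g" "coord \<kappa> g" "transition \<kappa> \<kappa>'"
    proof
      show "vhol (transition \<kappa> \<kappa>') (snd \<kappa> ` W)" by (rule hol)
      fix y assume y: "y \<in> snd \<kappa> ` W"
      then obtain p where p: "p \<in> W" "y = snd \<kappa> p" by blast
      show "transition \<kappa> \<kappa>' y \<in> snd \<kappa>' ` (V \<inter> fst \<kappa>')" using p tr[OF p(1)] by (auto simp: W_def)
      define J where "J = jacobian (transition \<kappa> \<kappa>') y"
      have J: "J *v u = vdd (transition \<kappa> \<kappa>') u y" for u
      proof -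
        have "(J *v u) $ k = dirderiv (\<lambda>y. transition \<kappa> \<kappa>' y $ k) u y" for k
          using clin_expand[OF clin_dirderiv[OF vholD[OF hol] y], of k u]
          by (simp add: J_def jacobian_def matrix_vector_mult_def mult.commute)
        then show ?thesis by (simp add: vec_eq_iff)
      qed
      have "coord \<kappa> g y = transpose J ** coord \<kappa>' g (transition \<kappa> \<kappa>' y) ** J"
        using local_metric_transform[OF lm \<kappa> \<kappa>'A, of p] p tr[OF p(1)] coord_chart[OF ch(1), of p g]
          coord_chart[OF ch(2), of p g] by (simp add: W_def J_def)
      then show "bil (coord \<kappa> g y) u v = bil (coord \<kappa>' g (transition \<kappa> \<kappa>' y))
          (vdd (transition \<kappa> \<kappa>') u y) (vdd (transition \<kappa> \<kappa>') v y)" for u v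
        by (simp add: bil_congruence J)
    qed
    have xW: "x \<in> W" using xV \<kappa>'(2) by (simp add: W_def)
    have inc: "incl (slice_coord (snd \<kappa>' x)) = snd \<kappa>' x" by (rule incl_slice_coord[OF sl[OF x \<kappa>']])
    then have u: "slice_coord (snd \<kappa>' x) \<in> M.Q" unfolding M.Q_iff using xV \<kappa>'(2) by simp
    show ?thesis
      using weyl_transform[of "snd \<kappa> x" X Y Z T] M.weyl_zero[OF u] xW tr[OF xW] by (simp add: inc)
  qed
  have ii: "bil2 (coord \<kappa> g (snd \<kappa> x))
        (covd_end2 (coord \<kappa> g) (weyl_plus (coord \<kappa> g) (coord \<kappa> S)) \<nu> (snd \<kappa> x) (incl2 A)) (incl2 B)
      = - cotton_york (induced (coord \<kappa> g)) (slice_coord (snd \<kappa> x)) A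
          (hodge3 (induced (coord \<kappa> g) (slice_coord (snd \<kappa> x))) (coord \<kappa> g (snd \<kappa> x)) (S \<kappa> x) \<nu> B)"
    if x: "x \<in> Q" and g: "(V, g) \<in> c" and \<kappa>: "\<kappa> \<in> slice_charts \<A> Q" and xV: "x \<in> V \<inter> fst \<kappa>"
      and A: "A \<in> bivectors" and B: "B \<in> bivectors" and \<nu>: "unit_normal (coord \<kappa> g) (snd \<kappa> x) \<nu>"
    for x V g \<kappa> \<nu> A B
  proof -
    interpret M: umbilic_slice "snd \<kappa> ` (V \<inter> fst \<kappa>)" "coord \<kappa> g" "coord \<kappa> S" by (rule us[OF g \<kappa>])
    have inc: "incl (slice_coord (snd \<kappa> x)) = snd \<kappa> x" using sl[OF x \<kappa>] xV by (simp add: incl_slice_coord)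
    then have u: "slice_coord (snd \<kappa> x) \<in> M.Q" unfolding M.Q_iff using xV by simp
    have "coord \<kappa> S (snd \<kappa> x) = S \<kappa> x"
      using coord_chart[OF ch, of \<kappa> x S] \<kappa> xV by (simp add: slice_charts_def)
    then show ?thesis
      using M.normal_derivative_weyl_plus[OF u, of \<nu> A B] \<nu> A B by (simp add: inc)
  qed
  show ?thesis
    using i ii unfolding Let_def by blast
qed

end
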